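(* The square formed by the functors $\mathcal P^o_f:\mathbf{RegOp}\to\mathbf{FOp}$, $\mathcal M^f_o:\mathbf{FOp}\to\mathbf{Mnd}$, $\mathcal M^r_o:\mathbf{RegOp}\to\mathbf{SanMnd}$ and the inclusion $\mathcal P^m_f:\mathbf{SanMnd}\to\mathbf{Mnd}$ commutes up to isomorphism, i.e. there is a natural isomorphism $\mathcal M^f_o\circ\mathcal P^o_f\cong\mathcal P^m_f\circ\mathcal M^r_o$.
   Context: Notation: $(n]=\{1,\dots,n\}$ for $n\in\omega=\{0,1,2,\dots\}$. $\mathbb F$ is the category with objects $(n]$, $n\in\omega$, and all functions as morphisms; $\mathbb S$ (resp. $\mathbb I$) is its subcategory with the same objects and surjections (resp. injections). For a right $S_k$-set $P$ and a left $S_k$-set $Q$, $P\otimes_kQ$ is the quotient of $P\times Q$ by $(p\sigma,q)\sim(p,\sigma q)$. **Operads.** For $\phi\in\mathbb F(n,m)$ and $\psi_i\in\mathbb F(k_i,l_i)$, $i\in(m]$, let $\langle\psi_1,\dots,\psi_m\rangle\star\phi:\sum_{j=1}^n(k_{\phi(j)}]\to\sum_{i=1}^m(l_i]$ be the function sending the element $r$ of the $j$-th summand to the element $\psi_{\phi(j)}(r)$ of the $\phi(j)$-th summand (sums ordered lexicographically). A full operad $\mathcal O$ consists of sets $\mathcal O_n$ ($n\in\omega$), a unit $\iota\in\mathcal O_1$, multiplications $\mathcal O_{n_1}\times\dots\times\mathcal O_{n_k}\times\mathcal O_k\to\mathcal O_{n_1+\dots+n_k}$, $(b_1,\dots,b_k,a)\mapsto\langle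 b_1,\dots,b_k\rangle\ast a$, and a left (functorial) action $\cdot:\mathbb F(n,m)\times\mathcal O_n\to\mathcal O_m$, such that $\ast$ is associative, $\langle a\rangle\ast\iota=a=\langle\iota,\dots,\iota\rangle\ast a$, and $\langle\psi_1\cdot b_1,\dots,\psi_m\cdot b_m\rangle\ast(\phi\cdot a)=(\langle\psi_1,\dots,\psi_m\rangle\star\phi)\cdot(\langle b_{\phi(1)},\dots,b_{\phi(n)}\rangle\ast a)$. A regular operad is defined in the same way with $\mathbb F$ replaced by $\mathbb S$. Morphisms preserve arities, unit, multiplication and action. The categories are $\mathbf{FOp}$ and $\mathbf{RegOp}$. **$\mathcal P^o_f$** (left adjoint to the restriction of the action to $\mathbb S$): $\mathcal P^o_f(\mathcal O)_n=\coprod_{k\in\omega}\mathbb I(k,n)\otimes_k\mathcal O_k$; action $\phi\cdot[f,a]=[f',\phi'\cdot a]$ where $\phi\circ f=f'\circ\phi'$ with $\phi'$ surjective and $f'$ injective; unit $[1_1,\iota]$; composition $\langle[f_1,b_1],\dots,[f_m,b_m]\rangle\ast[f,a]=[\langle f_1,\dots,f_m\rangle\star f,\langle b_{f(1)},\dots,b_{f(k)}\rangle\ast a]$ for $f\in\mathbb I(k,m)$; on morphisms $[f,a]\mapsto[f,h(a)]$. **Monads.** $\mathbf{Mnd}$ is the category of finitary monads on $Set$ and monad morphisms. A functor $Set\to Set$ is semi-analytic if it is finitary and preserves pullbacks along monomorphisms; a natural transformation is semi-cartesian if its naturality squares for monomorphisms are pullbacks. $\mathbf{SanMnd}\subset\mathbf{Mnd}$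 is the (non-full) subcategory of monads with semi-analytic functor part and semi-cartesian unit and multiplication, with semi-cartesian monad morphisms. **$\mathcal M^f_o$**: for a full operad $\mathcal O$, $\mathcal M^f_o(\mathcal O)(X)=\int^{n\in\mathbb F}X^n\times\mathcal O_n$, with classes $[\vec x,t]$; on functions $[\vec x,t]\mapsto[f\circ\vec x,t]$; unit $x\mapsto[\tilde x,\iota]$ with $\tilde x:(1]\to X$, $\tilde x(1)=x$; multiplication sends the class given by $t\in\mathcal O_k$ and $[\vec x_i,s_i]$, $i\in(k]$, to $[(\vec x_1,\dots,\vec x_k),\langle s_1,\dots,s_k\rangle\ast t]$ (concatenated tuple); on operad morphisms $[\vec x,t]\mapsto[\vec x,h(t)]$. **$\mathcal M^r_o$**: for a regular operad $\mathcal O$, $\mathcal M^r_o(\mathcal O)(X)=\sum_{n\in\omega}\left[{X\atop n}\right]\otimes_n\mathcal O_n$, where $\left[{X\atop n}\right]$ is the set of injections $(n]\to X$; for $f:X\to Y$, $[\vec x,a]\mapsto[\vec y,\alpha\cdot a]$ where $f\circ\vec x=\vec y\circ\alpha$ with $\alpha$ surjective, $\vec y$ injective. This functor is the left Kan extension of $\mathcal O:\mathbb S\to Set$ along $\mathbb S\to Set$, and the monad structure is the one induced from the operad structure: unit $x\mapsto[\tilde x,\iota]$; multiplication sends the class given by $a\in\mathcal O_k$ and distinct $[\vec x_i,b_i]$, $i\in(k]$, to $[\vec z,\alpha\cdot(\langle b_1,\dots,b_k\rangle\ast a)]$, where $\vec z\circ\alpha$ is the surjection–injection factorization of the concatenated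 tuple $(\vec x_1,\dots,\vec x_k)$. On operad morphisms $[\vec x,a]\mapsto[\vec x,h(a)]$. *)

theory Defs
  imports "HOL-Library.FuncSet" "HOL-Library.Equipollence"
begin

section \<open>Categories, functors, natural transformations\<close>

text \<open>Arrows are indexed by source and target, and the hom-sets need not be disjoint. Hence
  composition and the arrow part of a functor take the objects as arguments:
  \<open>Cmp C x y z g f\<close> is the composite of \<open>f : x \<rightarrow> y\<close> and \<open>g : y \<rightarrow> z\<close>, and
  \<open>far F x y f\<close> is the value of \<open>F\<close> at \<open>f : x \<rightarrow> y\<close>.\<close>

record ('o, 'a) category =
  Ob :: "'o set"
  Hom :: "'o \<Rightarrow> 'o \<Rightarrow> 'a set"
  Idn :: "'o \<Rightarrow> 'a"
  Cmp :: "'o \<Rightarrow> 'o \<Rightarrow> 'o \<Rightarrow> 'a \<Rightarrow> 'a \<Rightarrow> 'a"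

definition is_category :: "('o, 'a) category \<Rightarrow> bool" where
  "is_category C \<longleftrightarrow>
     (\<forall>x\<in>Ob C. Idn C x \<in> Hom C x x) \<and>
     (\<forall>x\<in>Ob C. \<forall>y\<in>Ob C. \<forall>z\<in>Ob C. \<forall>f\<in>Hom C x y. \<forall>g\<in>Hom C y z. Cmp C x y z g f \<in> Hom C x z) \<and>
     (\<forall>x\<in>Ob C. \<forall>y\<in>Ob C. \<forall>f\<in>Hom C x y.
        Cmp C x x y f (Idn C x) = f \<and> Cmp C x y y (Idn C y) f = f) \<and>
     (\<forall>w\<in>Ob C. \<forall>x\<in>Ob C. \<forall>y\<in>Ob C. \<forall>z\<in>Ob C.
        \<forall>f\<in>Hom C w x. \<forall>g\<in>Hom C x y. \<forall>h\<in>Hom C y z.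
          Cmp C w x z (Cmp C x y z h g) f = Cmp C w y z h (Cmp C w x y g f))"

record ('o, 'a, 'p, 'b) fnctr =
  fob :: "'o \<Rightarrow> 'p"
  far :: "'o \<Rightarrow> 'o \<Rightarrow> 'a \<Rightarrow> 'b"

definition is_functor :: "('o, 'a) category \<Rightarrow> ('p, 'b) category \<Rightarrow> ('o, 'a, 'p, 'b) fnctr \<Rightarrow> bool" where
  "is_functor C D F \<longleftrightarrow> is_category C \<and> is_category D \<and>
     (\<forall>x\<in>Ob C. fob F x \<in> Ob D) \<and>
     (\<forall>x\<in>Ob C. \<forall>y\<in>Ob C. \<forall>f\<in>Hom C x y. far F x y f \<in> Hom D (fob F x) (fob F y)) \<and>
     (\<forall>x\<in>Ob C. far F x x (Idn C x) = Idn D (fob F x)) \<and>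
     (\<forall>x\<in>Ob C. \<forall>y\<in>Ob C. \<forall>z\<in>Ob C. \<forall>f\<in>Hom C x y. \<forall>g\<in>Hom C y z.
        far F x z (Cmp C x y z g f) =
        Cmp D (fob F x) (fob F y) (fob F z) (far F y z g) (far F x y f))"

definition functor_id :: "('o, 'a, 'o, 'a) fnctr" where
  "functor_id = \<lparr>fob = (\<lambda>x. x), far = (\<lambda>x y f. f)\<rparr>"

definition functor_comp ::
  "('p, 'b, 'q, 'c) fnctr \<Rightarrow> ('o, 'a, 'p, 'b) fnctr \<Rightarrow> ('o, 'a, 'q, 'c) fnctr" where
  "functor_comp G F = \<lparr>fob = (\<lambda>x. fob G (fob F x)),
                far = (\<lambda>x y f. far G (fob F x) (fob F y) (far F x y f))\<rparr>"

definition nat_trans :: "('o, 'a) category \<Rightarrow> ('p, 'b) category \<Rightarrow>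
    ('o, 'a, 'p, 'b) fnctr \<Rightarrow> ('o, 'a, 'p, 'b) fnctr \<Rightarrow> ('o \<Rightarrow> 'b) \<Rightarrow> bool" where
  "nat_trans C D F G \<tau> \<longleftrightarrow> is_functor C D F \<and> is_functor C D G \<and>
     (\<forall>x\<in>Ob C. \<tau> x \<in> Hom D (fob F x) (fob G x)) \<and>
     (\<forall>x\<in>Ob C. \<forall>y\<in>Ob C. \<forall>f\<in>Hom C x y.
        Cmp D (fob F x) (fob F y) (fob G y) (\<tau> y) (far F x y f) =
        Cmp D (fob F x) (fob G x) (fob G y) (far G x y f) (\<tau> x))"

definition is_iso :: "('o, 'a) category \<Rightarrow> 'o \<Rightarrow> 'o \<Rightarrow> 'a \<Rightarrow> bool" where
  "is_iso C x y f \<longleftrightarrow> f \<in> Hom C x y \<and>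
     (\<exists>g\<in>Hom C y x. Cmp C x y x g f = Idn C x \<and> Cmp C y x y f g = Idn C y)"

definition nat_iso :: "('o, 'a) category \<Rightarrow> ('p, 'b) category \<Rightarrow>
    ('o, 'a, 'p, 'b) fnctr \<Rightarrow> ('o, 'a, 'p, 'b) fnctr \<Rightarrow> ('o \<Rightarrow> 'b) \<Rightarrow> bool" where
  "nat_iso C D F G \<tau> \<longleftrightarrow> nat_trans C D F G \<tau> \<and>
     (\<forall>x\<in>Ob C. is_iso D (fob F x) (fob G x) (\<tau> x))"

definition monic :: "('o, 'a) category \<Rightarrow> 'o \<Rightarrow> 'o \<Rightarrow> 'a \<Rightarrow> bool" where
  "monic C x y f \<longleftrightarrow> f \<in> Hom C x y \<and>
     (\<forall>w\<in>Ob C. \<forall>g\<in>Hom C w x. \<forall>h\<in>Hom C w x. Cmp C w x y f g = Cmp C w x y f h \<longrightarrow> g = h)"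

text \<open>\<open>p : P \<rightarrow> X\<close> and \<open>q : P \<rightarrow> Y\<close> form a pullback of \<open>f : X \<rightarrow> Z\<close> and \<open>g : Y \<rightarrow> Z\<close>.\<close>

definition pullback :: "('o, 'a) category \<Rightarrow> 'o \<Rightarrow> 'o \<Rightarrow> 'o \<Rightarrow> 'o \<Rightarrow> 'a \<Rightarrow> 'a \<Rightarrow> 'a \<Rightarrow> 'a \<Rightarrow> bool" where
  "pullback C P X Y Z p q f g \<longleftrightarrow>
     p \<in> Hom C P X \<and> q \<in> Hom C P Y \<and> f \<in> Hom C X Z \<and> g \<in> Hom C Y Z \<and>
     Cmp C P X Z f p = Cmp C P Y Z g q \<and>
     (\<forall>W\<in>Ob C. \<forall>u\<in>Hom C W X. \<forall>v\<in>Hom C W Y. Cmp C W X Z f u = Cmp C W Y Z g v \<longrightarrow>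
        (\<exists>!h. h \<in> Hom C W P \<and> Cmp C W P X p h = u \<and> Cmp C W P Y q h = v))"

definition filtered :: "('o, 'a) category \<Rightarrow> bool" where
  "filtered J \<longleftrightarrow> is_category J \<and> Ob J \<noteq> {} \<and>
     (\<forall>x\<in>Ob J. \<forall>y\<in>Ob J. \<exists>z\<in>Ob J. Hom J x z \<noteq> {} \<and> Hom J y z \<noteq> {}) \<and>
     (\<forall>x\<in>Ob J. \<forall>y\<in>Ob J. \<forall>f\<in>Hom J x y. \<forall>g\<in>Hom J x y.
        \<exists>z\<in>Ob J. \<exists>h\<in>Hom J y z. Cmp J x y z h f = Cmp J x y z h g)"

definition cocone :: "('j, 'b) category \<Rightarrow> ('o, 'a) category \<Rightarrow> ('j, 'b, 'o, 'a) fnctr \<Rightarrow>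
    'o \<Rightarrow> ('j \<Rightarrow> 'a) \<Rightarrow> bool" where
  "cocone J C D L l \<longleftrightarrow> L \<in> Ob C \<and> (\<forall>j\<in>Ob J. l j \<in> Hom C (fob D j) L) \<and>
     (\<forall>i\<in>Ob J. \<forall>j\<in>Ob J. \<forall>f\<in>Hom J i j. Cmp C (fob D i) (fob D j) L (l j) (far D i j f) = l i)"

definition colimit :: "('j, 'b) category \<Rightarrow> ('o, 'a) category \<Rightarrow> ('j, 'b, 'o, 'a) fnctr \<Rightarrow>
    'o \<Rightarrow> ('j \<Rightarrow> 'a) \<Rightarrow> bool" where
  "colimit J C D L l \<longleftrightarrow> cocone J C D L l \<and>
     (\<forall>M m. cocone J C D M m \<longrightarrow>
        (\<exists>!h. h \<in> Hom C L M \<and> (\<forall>j\<in>Ob J. Cmp C (fob D j) L M h (l j) = m j)))"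


section \<open>Small sets\<close>

text \<open>The small sets are the members of a family \<open>U\<close> of subsets of a type \<open>'u\<close>, closed under
  the operations below. The small sets of a Grothendieck universe containing an infinite set
  have these properties, but less is demanded: closure under power sets is not needed, and the
  subsets of any infinite type form a universe.\<close>

definition universe :: "'u set set \<Rightarrow> bool" where
  "universe U \<longleftrightarrow>
     (\<exists>X\<in>U. infinite X) \<and>
     (\<forall>X\<in>U. \<forall>Y. Y \<lesssim> X \<longrightarrow> Y \<in> U) \<and>
     (\<forall>X\<in>U. \<forall>F. (\<forall>x\<in>X. F x \<in> U) \<longrightarrow> (\<Union>x\<in>X. F x) \<in> U)"

lemma universe_UNIV: "infinite (UNIV :: 'u set) \<Longrightarrow> universe (UNIV :: 'u set set)"
  by (auto simp: universe_def)

definition SET :: "'u set set \<Rightarrow> ('u set, 'u \<Rightarrow> 'u) category" where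
  "SET U = \<lparr>Ob = U,
            Hom = (\<lambda>X Y. X \<rightarrow>\<^sub>E Y),
            Idn = (\<lambda>X. \<lambda>x\<in>X. x),
            Cmp = (\<lambda>X Y Z g f. compose X g f)\<rparr>"

text \<open>A chosen injective coding of a set \<open>A\<close> by elements of \<open>'u\<close>; the elements of quotients
  are turned into elements of \<open>'u\<close> in this way. It is meaningful only if \<open>A\<close> is at most as
  large as \<open>'u\<close>.\<close>

definition encode :: "'v set \<Rightarrow> 'v \<Rightarrow> 'u" where
  "encode A = (SOME e. inj_on e A)"


section \<open>The categories of functions, surjections and injections between finite ordinals\<close>

text \<open>A function from an \<open>n\<close>-element ordinal to a set, in particular an \<open>n\<close>-tuple, is given
  by its list of values. The ordinal with \<open>n\<close> elements is \<open>{..<n}\<close>. Thus the composite of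
  \<open>\<phi>\<close> followed by \<open>x\<close> is the list \<open>x \<odot> \<phi>\<close>, and concatenation of tuples is \<open>concat\<close>.\<close>

definition tcomp :: "'x list \<Rightarrow> nat list \<Rightarrow> 'x list" (infixl "\<odot>" 70) where
  "x \<odot> \<phi> = map (\<lambda>j. x ! j) \<phi>"

definition FF :: "nat \<Rightarrow> nat \<Rightarrow> nat list set" where
  "FF n m = {\<phi>. length \<phi> = n \<and> set \<phi> \<subseteq> {..<m}}"

definition SS :: "nat \<Rightarrow> nat \<Rightarrow> nat list set" where
  "SS n m = {\<phi> \<in> FF n m. set \<phi> = {..<m}}"

definition II :: "nat \<Rightarrow> nat \<Rightarrow> nat list set" where
  "II n m = {\<phi> \<in> FF n m. distinct \<phi>}"

text \<open>The bijections; \<open>BB n m\<close> is empty unless \<open>n = m\<close>, and \<open>BB n n\<close> is the symmetric group.\<close>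

definition BB :: "nat \<Rightarrow> nat \<Rightarrow> nat list set" where
  "BB n m = SS n m \<inter> II n m"

text \<open>\<open>star \<psi>s ls \<phi>\<close> is \<open>\<langle>\<psi>\<^sub>1,\<dots>,\<psi>\<^sub>m\<rangle> \<star> \<phi>\<close> for \<open>\<psi>\<^sub>i\<close> with codomain of size \<open>ls ! i\<close>: the
  \<open>j\<close>-th block of values is that of \<open>\<psi>\<close> at \<open>\<phi>(j)\<close>, shifted to the \<open>\<phi>(j)\<close>-th summand of the
  codomain.\<close>

definition star :: "nat list list \<Rightarrow> nat list \<Rightarrow> nat list \<Rightarrow> nat list" where
  "star \<psi>s ls \<phi> = concat (map (\<lambda>j. map (\<lambda>r. sum_list (take j ls) + r) (\<psi>s ! j)) \<phi>)"


section \<open>Operads\<close>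

text \<open>\<open>opm A ns bs a\<close> is \<open>\<langle>b\<^sub>1,\<dots>,b\<^sub>k\<rangle> \<ast> a\<close>, where \<open>ns\<close> lists the arities of the \<open>b\<^sub>i\<close>; they are
  passed explicitly because the sets \<open>ops A n\<close> need not be disjoint. For the same reason the
  action \<open>act A m \<phi> a\<close> of \<open>\<phi> : n \<rightarrow> m\<close> takes the codomain \<open>m\<close>, which the list \<open>\<phi>\<close> does not
  determine.\<close>

record 'u operad =
  ops :: "nat \<Rightarrow> 'u set"
  iota :: 'u
  opm :: "nat list \<Rightarrow> 'u list \<Rightarrow> 'u \<Rightarrow> 'u"
  act :: "nat \<Rightarrow> nat list \<Rightarrow> 'u \<Rightarrow> 'u"

definition has_arities :: "'u operad \<Rightarrow> nat list \<Rightarrow> 'u list \<Rightarrow> bool" where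
  "has_arities A ns bs \<longleftrightarrow> list_all2 (\<lambda>n b. b \<in> ops A n) ns bs"

text \<open>Operads with an action of the category \<open>H\<close> of finite ordinals: full operads for
  \<open>H = FF\<close>, regular operads for \<open>H = SS\<close>.\<close>

definition is_operad :: "'u set set \<Rightarrow> (nat \<Rightarrow> nat \<Rightarrow> nat list set) \<Rightarrow> 'u operad \<Rightarrow> bool" where
  "is_operad U H A \<longleftrightarrow>
     (\<forall>n. ops A n \<in> U) \<and>
     iota A \<in> ops A 1 \<and>
     (\<forall>ns bs a. has_arities A ns bs \<and> a \<in> ops A (length ns) \<longrightarrow>
        opm A ns bs a \<in> ops A (sum_list ns)) \<and>
     (\<forall>n m. \<forall>\<phi>\<in>H n m. \<forall>a\<in>ops A n. act A m \<phi> a \<in> ops A m) \<and>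
     (\<forall>n. \<forall>a\<in>ops A n. act A n [0..<n] a = a) \<and>
     (\<forall>n m k. \<forall>\<phi>\<in>H n m. \<forall>\<psi>\<in>H m k. \<forall>a\<in>ops A n. act A k (\<psi> \<odot> \<phi>) a = act A k \<psi> (act A m \<phi> a)) \<and>
     (\<forall>nss css bs a.
        list_all2 (has_arities A) nss css \<and> has_arities A (map length nss) bs \<and>
        a \<in> ops A (length nss) \<longrightarrow>
        opm A (map sum_list nss)
          (map (\<lambda>i. opm A (nss ! i) (css ! i) (bs ! i)) [0..<length nss]) a =
        opm A (concat nss) (concat css) (opm A (map length nss) bs a)) \<and>
     (\<forall>n. \<forall>a\<in>ops A n. opm A [n] [a] (iota A) = a) \<and>
     (\<forall>n. \<forall>a\<in>ops A n. opm A (replicate n 1) (replicate n (iota A)) a = a) \<and>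
     (\<forall>n m \<phi> \<psi>s ks ls bs a.
        \<phi> \<in> H n m \<and> length \<psi>s = m \<and> length ks = m \<and> length ls = m \<and>
        (\<forall>i<m. \<psi>s ! i \<in> H (ks ! i) (ls ! i)) \<and> has_arities A ks bs \<and> a \<in> ops A n \<longrightarrow>
        opm A ls (map (\<lambda>i. act A (ls ! i) (\<psi>s ! i) (bs ! i)) [0..<m]) (act A m \<phi> a) =
        act A (sum_list ls) (star \<psi>s ls \<phi>) (opm A (ks \<odot> \<phi>) (bs \<odot> \<phi>) a))"

definition operad_morphism ::
  "(nat \<Rightarrow> nat \<Rightarrow> nat list set) \<Rightarrow> 'u operad \<Rightarrow> 'u operad \<Rightarrow> (nat \<Rightarrow> 'u \<Rightarrow> 'u) \<Rightarrow> bool" where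
  "operad_morphism H A B h \<longleftrightarrow>
     (\<forall>n. h n \<in> ops A n \<rightarrow>\<^sub>E ops B n) \<and>
     h 1 (iota A) = iota B \<and>
     (\<forall>ns bs a. has_arities A ns bs \<and> a \<in> ops A (length ns) \<longrightarrow>
        h (sum_list ns) (opm A ns bs a) = opm B ns (map2 h ns bs) (h (length ns) a)) \<and>
     (\<forall>n m. \<forall>\<phi>\<in>H n m. \<forall>a\<in>ops A n. h m (act A m \<phi> a) = act B m \<phi> (h n a))"

definition Operads :: "'u set set \<Rightarrow> (nat \<Rightarrow> nat \<Rightarrow> nat list set) \<Rightarrow>
    ('u operad, nat \<Rightarrow> 'u \<Rightarrow> 'u) category" where
  "Operads U H = \<lparr>Ob = {A. is_operad U H A},
                  Hom = (\<lambda>A B. {h. operad_morphism H A B h}),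
                  Idn = (\<lambda>A n. \<lambda>a\<in>ops A n. a),
                  Cmp = (\<lambda>A B C g h n. compose (ops A n) (g n) (h n))\<rparr>"

abbreviation FOp :: "'u set set \<Rightarrow> ('u operad, nat \<Rightarrow> 'u \<Rightarrow> 'u) category" where
  "FOp U \<equiv> Operads U FF"

abbreviation RegOp :: "'u set set \<Rightarrow> ('u operad, nat \<Rightarrow> 'u \<Rightarrow> 'u) category" where
  "RegOp U \<equiv> Operads U SS"


section \<open>Quotients of sets of decorated tuples\<close>

text \<open>Let \<open>P\<close> be a set of tuples closed under precomposition with \<open>H\<close>. The set
  \<open>\<Coprod>\<^sub>n P\<^sub>n \<times> ops A n\<close>, where \<open>P\<^sub>n\<close> consists of the \<open>n\<close>-tuples in \<open>P\<close>, is divided by the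
  equivalence relation generated by \<open>(x \<circ> \<phi>, a) \<sim> (x, \<phi> \<cdot> a)\<close> with \<open>\<phi>\<close> in \<open>H\<close>.
  For \<open>H = FF\<close> and \<open>P = lists X\<close> this is the coend of \<open>X\<^sup>n \<times> A\<^sub>n\<close>. For \<open>H = BB\<close> it is the
  coproduct over \<open>n\<close> of \<open>P\<^sub>n \<otimes>\<^sub>n A\<^sub>n\<close>, as bijections do not change the length.\<close>

definition pairs :: "'u operad \<Rightarrow> 'x list set \<Rightarrow> ('x list \<times> 'u) set" where
  "pairs A P = {(x, a). x \<in> P \<and> a \<in> ops A (length x)}"

definition glue :: "'u operad \<Rightarrow> (nat \<Rightarrow> nat \<Rightarrow> nat list set) \<Rightarrow> 'x list set \<Rightarrow>
    ('x list \<times> 'u) rel" where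
  "glue A H P = {((x \<odot> \<phi>, a), (x, act A (length x) \<phi> a)) | x \<phi> a n.
                   x \<in> P \<and> \<phi> \<in> H n (length x) \<and> a \<in> ops A n}"

definition glue_eq :: "'u operad \<Rightarrow> (nat \<Rightarrow> nat \<Rightarrow> nat list set) \<Rightarrow> 'x list set \<Rightarrow>
    ('x list \<times> 'u) rel" where
  "glue_eq A H P = (glue A H P \<union> (glue A H P)\<inverse>)\<^sup>*"

definition classes :: "'u operad \<Rightarrow> (nat \<Rightarrow> nat \<Rightarrow> nat list set) \<Rightarrow> 'x list set \<Rightarrow>
    ('x list \<times> 'u) set set" where
  "classes A H P = pairs A P // glue_eq A H P"

definition tensor :: "'u operad \<Rightarrow> (nat \<Rightarrow> nat \<Rightarrow> nat list set) \<Rightarrow> 'x list set \<Rightarrow> 'u set" where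
  "tensor A H P = encode (classes A H P) ` classes A H P"

definition cls :: "'u operad \<Rightarrow> (nat \<Rightarrow> nat \<Rightarrow> nat list set) \<Rightarrow> 'x list set \<Rightarrow>
    'x list \<Rightarrow> 'u \<Rightarrow> 'u" where
  "cls A H P x a = encode (classes A H P) (glue_eq A H P `` {(x, a)})"


section \<open>From regular operads to full operads\<close>

abbreviation Inj :: "nat \<Rightarrow> nat list set" where
  "Inj n \<equiv> (\<Union>k. II k n)"

definition Po_ops :: "'u operad \<Rightarrow> nat \<Rightarrow> 'u set" where
  "Po_ops A n = tensor A BB (Inj n)"

definition Po_cls :: "'u operad \<Rightarrow> nat \<Rightarrow> nat list \<Rightarrow> 'u \<Rightarrow> 'u" where
  "Po_cls A n f a = cls A BB (Inj n) f a"

definition Po_act :: "'u operad \<Rightarrow> nat \<Rightarrow> nat list \<Rightarrow> 'u \<Rightarrow> 'u" where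
  "Po_act A m \<phi> q = (THE q'. \<exists>f a f' \<phi>'.
     (f, a) \<in> pairs A (Inj (length \<phi>)) \<and> q = Po_cls A (length \<phi>) f a \<and>
     \<phi> \<odot> f = f' \<odot> \<phi>' \<and> \<phi>' \<in> SS (length f) (length f') \<and> f' \<in> Inj m \<and>
     q' = Po_cls A m f' (act A (length f') \<phi>' a))"

definition Po_opm :: "'u operad \<Rightarrow> nat list \<Rightarrow> 'u list \<Rightarrow> 'u \<Rightarrow> 'u" where
  "Po_opm A ns qs q = (THE q'. \<exists>fs bs f a.
     length fs = length ns \<and> length bs = length ns \<and>
     (\<forall>i<length ns. (fs ! i, bs ! i) \<in> pairs A (Inj (ns ! i)) \<and>
                    qs ! i = Po_cls A (ns ! i) (fs ! i) (bs ! i)) \<and>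
     (f, a) \<in> pairs A (Inj (length ns)) \<and> q = Po_cls A (length ns) f a \<and>
     q' = Po_cls A (sum_list ns) (star fs ns f) (opm A (map length (fs \<odot> f)) (bs \<odot> f) a))"

definition Po_map :: "'u operad \<Rightarrow> 'u operad \<Rightarrow> (nat \<Rightarrow> 'u \<Rightarrow> 'u) \<Rightarrow> nat \<Rightarrow> 'u \<Rightarrow> 'u" where
  "Po_map A B h n = (\<lambda>q\<in>Po_ops A n. THE q'. \<exists>f a.
     (f, a) \<in> pairs A (Inj n) \<and> q = Po_cls A n f a \<and> q' = Po_cls B n f (h (length f) a))"

definition Po :: "('u operad, nat \<Rightarrow> 'u \<Rightarrow> 'u, 'u operad, nat \<Rightarrow> 'u \<Rightarrow> 'u) fnctr" where
  "Po = \<lparr>fob = (\<lambda>A. \<lparr>ops = Po_ops A, iota = Po_cls A 1 [0] (iota A),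
                    opm = Po_opm A, act = Po_act A\<rparr>),
         far = Po_map\<rparr>"


section \<open>Monads\<close>

type_synonym 'u endo = "('u set, 'u \<Rightarrow> 'u, 'u set, 'u \<Rightarrow> 'u) fnctr"

record 'u mnd =
  fn :: "'u endo"
  eta :: "'u set \<Rightarrow> 'u \<Rightarrow> 'u"
  mu :: "'u set \<Rightarrow> 'u \<Rightarrow> 'u"

definition is_monad :: "'u set set \<Rightarrow> 'u mnd \<Rightarrow> bool" where
  "is_monad U T \<longleftrightarrow>
     nat_trans (SET U) (SET U) functor_id (fn T) (eta T) \<and>
     nat_trans (SET U) (SET U) (functor_comp (fn T) (fn T)) (fn T) (mu T) \<and>
     (\<forall>X\<in>U. let TX = fob (fn T) X; TTX = fob (fn T) TX; TTTX = fob (fn T) TTX in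
        compose TTTX (mu T X) (mu T TX) = compose TTTX (mu T X) (far (fn T) TTX TX (mu T X)) \<and>
        compose TX (mu T X) (eta T TX) = (\<lambda>q\<in>TX. q) \<and>
        compose TX (mu T X) (far (fn T) X TX (eta T X)) = (\<lambda>q\<in>TX. q))"

definition monad_morphism :: "'u set set \<Rightarrow> 'u mnd \<Rightarrow> 'u mnd \<Rightarrow> ('u set \<Rightarrow> 'u \<Rightarrow> 'u) \<Rightarrow> bool" where
  "monad_morphism U S T \<tau> \<longleftrightarrow>
     nat_trans (SET U) (SET U) (fn S) (fn T) \<tau> \<and>
     (\<forall>X\<in>U. let SX = fob (fn S) X; TX = fob (fn T) X; SSX = fob (fn S) SX in
        compose X (\<tau> X) (eta S X) = eta T X \<and>
        compose SSX (\<tau> X) (mu S X) =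
          compose SSX (mu T X) (compose SSX (\<tau> TX) (far (fn S) SX TX (\<tau> X))))"

text \<open>Preservation of colimits of small filtered diagrams. Up to isomorphism a small category
  has its objects and arrows in \<open>'u\<close>.\<close>

definition finitary :: "'u set set \<Rightarrow> 'u endo \<Rightarrow> bool" where
  "finitary U F \<longleftrightarrow> (\<forall>(J :: ('u, 'u) category) D L l.
     filtered J \<and> Ob J \<in> U \<and> (\<forall>i\<in>Ob J. \<forall>j\<in>Ob J. Hom J i j \<in> U) \<and>
     is_functor J (SET U) D \<and> colimit J (SET U) D L l \<longrightarrow>
     colimit J (SET U) (functor_comp F D) (fob F L) (\<lambda>j. far F (fob D j) L (l j)))"

definition semi_analytic :: "'u set set \<Rightarrow> 'u endo \<Rightarrow> bool" where
  "semi_analytic U F \<longleftrightarrow> finitary U F \<and>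
     (\<forall>P\<in>U. \<forall>X\<in>U. \<forall>Y\<in>U. \<forall>Z\<in>U. \<forall>p q f g.
        monic (SET U) Y Z g \<and> pullback (SET U) P X Y Z p q f g \<longrightarrow>
        pullback (SET U) (fob F P) (fob F X) (fob F Y) (fob F Z)
          (far F P X p) (far F P Y q) (far F X Z f) (far F Y Z g))"

definition semi_cartesian :: "'u set set \<Rightarrow> 'u endo \<Rightarrow> 'u endo \<Rightarrow> ('u set \<Rightarrow> 'u \<Rightarrow> 'u) \<Rightarrow> bool" where
  "semi_cartesian U F G \<tau> \<longleftrightarrow>
     (\<forall>X\<in>U. \<forall>Y\<in>U. \<forall>f. monic (SET U) X Y f \<longrightarrow>
        pullback (SET U) (fob F X) (fob F Y) (fob G X) (fob G Y)
          (far F X Y f) (\<tau> X) (\<tau> Y) (far G X Y f))"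

definition Mnd :: "'u set set \<Rightarrow> ('u mnd, 'u set \<Rightarrow> 'u \<Rightarrow> 'u) category" where
  "Mnd U = \<lparr>Ob = {T. is_monad U T \<and> finitary U (fn T)},
            Hom = (\<lambda>S T. {\<tau> \<in> extensional U. monad_morphism U S T \<tau>}),
            Idn = (\<lambda>T. \<lambda>X\<in>U. \<lambda>q\<in>fob (fn T) X. q),
            Cmp = (\<lambda>R S T \<sigma> \<tau>. \<lambda>X\<in>U. compose (fob (fn R) X) (\<sigma> X) (\<tau> X))\<rparr>"

definition SanMnd :: "'u set set \<Rightarrow> ('u mnd, 'u set \<Rightarrow> 'u \<Rightarrow> 'u) category" where
  "SanMnd U = \<lparr>Ob = {T \<in> Ob (Mnd U). semi_analytic U (fn T) \<and>
                      semi_cartesian U functor_id (fn T) (eta T) \<and>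
                      semi_cartesian U (functor_comp (fn T) (fn T)) (fn T) (mu T)},
               Hom = (\<lambda>S T. {\<tau> \<in> Hom (Mnd U) S T. semi_cartesian U (fn S) (fn T) \<tau>}),
               Idn = Idn (Mnd U),
               Cmp = Cmp (Mnd U)\<rparr>"

definition Pm :: "('u mnd, 'u set \<Rightarrow> 'u \<Rightarrow> 'u, 'u mnd, 'u set \<Rightarrow> 'u \<Rightarrow> 'u) fnctr" where
  "Pm = \<lparr>fob = (\<lambda>T. T), far = (\<lambda>S T \<tau>. \<tau>)\<rparr>"


section \<open>The monad of a full operad\<close>

definition Mf_ob :: "'u operad \<Rightarrow> 'u set \<Rightarrow> 'u set" where
  "Mf_ob A X = tensor A FF (lists X)"

definition Mf_cls :: "'u operad \<Rightarrow> 'u set \<Rightarrow> 'u list \<Rightarrow> 'u \<Rightarrow> 'u" where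
  "Mf_cls A X x t = cls A FF (lists X) x t"

definition Mf_far :: "'u operad \<Rightarrow> 'u set \<Rightarrow> 'u set \<Rightarrow> ('u \<Rightarrow> 'u) \<Rightarrow> 'u \<Rightarrow> 'u" where
  "Mf_far A X Y f = (\<lambda>q\<in>Mf_ob A X. THE q'. \<exists>x t.
     (x, t) \<in> pairs A (lists X) \<and> q = Mf_cls A X x t \<and> q' = Mf_cls A Y (map f x) t)"

definition Mf_eta :: "'u operad \<Rightarrow> 'u set \<Rightarrow> 'u \<Rightarrow> 'u" where
  "Mf_eta A X = (\<lambda>x\<in>X. Mf_cls A X [x] (iota A))"

definition Mf_mu :: "'u operad \<Rightarrow> 'u set \<Rightarrow> 'u \<Rightarrow> 'u" where
  "Mf_mu A X = (\<lambda>q\<in>Mf_ob A (Mf_ob A X). THE q'. \<exists>xs ss t.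
     list_all2 (\<lambda>x s. (x, s) \<in> pairs A (lists X)) xs ss \<and> t \<in> ops A (length xs) \<and>
     q = Mf_cls A (Mf_ob A X) (map2 (Mf_cls A X) xs ss) t \<and>
     q' = Mf_cls A X (concat xs) (opm A (map length xs) ss t))"

definition Mf_map :: "'u set set \<Rightarrow> 'u operad \<Rightarrow> 'u operad \<Rightarrow> (nat \<Rightarrow> 'u \<Rightarrow> 'u) \<Rightarrow>
    'u set \<Rightarrow> 'u \<Rightarrow> 'u" where
  "Mf_map U A B h = (\<lambda>X\<in>U. \<lambda>q\<in>Mf_ob A X. THE q'. \<exists>x t.
     (x, t) \<in> pairs A (lists X) \<and> q = Mf_cls A X x t \<and> q' = Mf_cls B X x (h (length x) t))"

definition Mf :: "'u set set \<Rightarrow>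
    ('u operad, nat \<Rightarrow> 'u \<Rightarrow> 'u, 'u mnd, 'u set \<Rightarrow> 'u \<Rightarrow> 'u) fnctr" where
  "Mf U = \<lparr>fob = (\<lambda>A. \<lparr>fn = \<lparr>fob = Mf_ob A, far = Mf_far A\<rparr>, eta = Mf_eta A, mu = Mf_mu A\<rparr>),
           far = Mf_map U\<rparr>"


section \<open>The semi-analytic monad of a regular operad\<close>

definition inj_lists :: "'x set \<Rightarrow> 'x list set" where
  "inj_lists X = {x \<in> lists X. distinct x}"

definition Mr_ob :: "'u operad \<Rightarrow> 'u set \<Rightarrow> 'u set" where
  "Mr_ob A X = tensor A BB (inj_lists X)"

definition Mr_cls :: "'u operad \<Rightarrow> 'u set \<Rightarrow> 'u list \<Rightarrow> 'u \<Rightarrow> 'u" where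
  "Mr_cls A X x a = cls A BB (inj_lists X) x a"

definition Mr_far :: "'u operad \<Rightarrow> 'u set \<Rightarrow> 'u set \<Rightarrow> ('u \<Rightarrow> 'u) \<Rightarrow> 'u \<Rightarrow> 'u" where
  "Mr_far A X Y f = (\<lambda>q\<in>Mr_ob A X. THE q'. \<exists>x a y \<alpha>.
     (x, a) \<in> pairs A (inj_lists X) \<and> q = Mr_cls A X x a \<and>
     map f x = y \<odot> \<alpha> \<and> \<alpha> \<in> SS (length x) (length y) \<and> y \<in> inj_lists Y \<and>
     q' = Mr_cls A Y y (act A (length y) \<alpha> a))"

definition Mr_eta :: "'u operad \<Rightarrow> 'u set \<Rightarrow> 'u \<Rightarrow> 'u" where
  "Mr_eta A X = (\<lambda>x\<in>X. Mr_cls A X [x] (iota A))"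

definition Mr_mu :: "'u operad \<Rightarrow> 'u set \<Rightarrow> 'u \<Rightarrow> 'u" where
  "Mr_mu A X = (\<lambda>q\<in>Mr_ob A (Mr_ob A X). THE q'. \<exists>xs bs a z \<alpha>.
     list_all2 (\<lambda>x b. (x, b) \<in> pairs A (inj_lists X)) xs bs \<and> a \<in> ops A (length xs) \<and>
     distinct (map2 (Mr_cls A X) xs bs) \<and>
     q = Mr_cls A (Mr_ob A X) (map2 (Mr_cls A X) xs bs) a \<and>
     concat xs = z \<odot> \<alpha> \<and> \<alpha> \<in> SS (length (concat xs)) (length z) \<and> z \<in> inj_lists X \<and>
     q' = Mr_cls A X z (act A (length z) \<alpha> (opm A (map length xs) bs a)))"

definition Mr_map :: "'u set set \<Rightarrow> 'u operad \<Rightarrow> 'u operad \<Rightarrow> (nat \<Rightarrow> 'u \<Rightarrow> 'u) \<Rightarrow>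
    'u set \<Rightarrow> 'u \<Rightarrow> 'u" where
  "Mr_map U A B h = (\<lambda>X\<in>U. \<lambda>q\<in>Mr_ob A X. THE q'. \<exists>x a.
     (x, a) \<in> pairs A (inj_lists X) \<and> q = Mr_cls A X x a \<and> q' = Mr_cls B X x (h (length x) a))"

definition Mr :: "'u set set \<Rightarrow>
    ('u operad, nat \<Rightarrow> 'u \<Rightarrow> 'u, 'u mnd, 'u set \<Rightarrow> 'u \<Rightarrow> 'u) fnctr" where
  "Mr U = \<lparr>fob = (\<lambda>A. \<lparr>fn = \<lparr>fob = Mr_ob A, far = Mr_far A\<rparr>, eta = Mr_eta A, mu = Mr_mu A\<rparr>),
           far = Mr_map U\<rparr>"

end

theory Submission
  imports Defs
begin

text \<open>Both monads are instances of one construction: for \<open>H\<close> the category of all functions or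
  of the surjections between finite ordinals, an operad \<open>A\<close> with an action of \<open>H\<close> yields the
  monad \<open>X \<mapsto> \<integral>\<^sup>n X\<^sup>n \<times> A\<^sub>n\<close>, the coend being taken over \<open>H\<close>, with concatenation of tuples as
  multiplication. By surjection--injection factorization \<open>X \<mapsto> \<Sum>\<^sub>n [X, n] \<otimes>\<^sub>n A\<^sub>n\<close> is the case of
  surjections, and the full operad generated by a regular operad \<open>A\<close> consists of the values of
  that functor at the finite ordinals. The unit \<open>a \<mapsto> [1, a]\<close> of the adjunction therefore induces
  a morphism of monads \<open>[x, a] \<mapsto> [x, [1, a]]\<close>; it is invertible with inverse
  \<open>[x, [f, a]] \<mapsto> [x \<circ> f, a]\<close>, because \<open>[x, [f, a]] = [x, f \<cdot> [1, a]] = [x \<circ> f, [1, a]]\<close>.\<close>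

section \<open>Small sets\<close>

text \<open>The structure maps are defined by descriptions over representatives, so the main
  obstacle is independence of the choices. In a quotient presented by gluings, a function that
  respects every generating step descends (\<open>cl_lift\<close>). For the multiplication this has
  to be done for the inner tuples and for the outer tuple, and this is where the law relating
  \<open>opm\<close>, \<open>act\<close> and \<open>star\<close> enters. For surjections there is
  moreover an explicit criterion of equality, \<open>req\<close>; it shows that the set of entries
  of a tuple is an invariant and that injective relabellings can be cancelled, and all statements
  about pullbacks rest on these two facts. Gluing along arbitrary functions changes the set of
  entries, so finitarity is proved uniformly by lifting a chain of gluings step by step to the
  stages of a filtered diagram. The inverse of the comparison is only shown to be well defined on
  elements: a monad morphism with bijective components is automatically invertible. Finally,
  operations of the generated full operad are represented by tuples with repetitions allowed, which
  turns the action into plain composition.\<close>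

lemma universe_lepoll: "universe U \<Longrightarrow> X \<in> U \<Longrightarrow> Y \<lesssim> X \<Longrightarrow> Y \<in> U"
  unfolding universe_def by blast

lemma universe_infinite:
  assumes "universe U" obtains Z where "Z \<in> U" "infinite Z"
  using assms unfolding universe_def by blast

lemma universe_UN: "universe U \<Longrightarrow> X \<in> U \<Longrightarrow> (\<And>x. x \<in> X \<Longrightarrow> F x \<in> U) \<Longrightarrow> (\<Union>x\<in>X. F x) \<in> U"
  unfolding universe_def by blast

lemma universe_finite:
  assumes U: "universe U" and "finite F"
  shows "F \<in> U"
proof -
  obtain Z where "Z \<in> U" "infinite Z" using universe_infinite[OF U] .
  then show ?thesis using finite_lepoll_infinite[OF _ assms(2)] universe_lepoll[OF U] by blast
qed

text \<open>Two points index a binary union, and as a target they turn subsets into maps when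
  colimits are tested.\<close>

lemma universe_two_points:
  fixes U :: "'u set set"
  assumes "universe U" obtains p q :: 'u where "p \<noteq> q" "{p, q} \<in> U"
proof -
  obtain Z where Z: "Z \<in> U" "infinite Z" using universe_infinite[OF assms] .
  then obtain p where "p \<in> Z" by fastforce
  have "infinite (Z - {p})" using Z by simp
  then obtain q where "q \<in> Z - {p}" using infinite_imp_nonempty by blast
  with that[of p q] universe_finite[OF assms] show ?thesis by auto
qed

lemma universe_Un:
  assumes U: "universe U" and "X \<in> U" "Y \<in> U"
  shows "X \<union> Y \<in> U"
proof -
  obtain p q :: 'a where pq: "p \<noteq> q" "{p, q} \<in> U" using universe_two_points[OF U] .
  have "(\<Union>x\<in>{p,q}. if x = p then X else Y) \<in> U"
    by (rule universe_UN[OF U pq(2)]) (use assms in auto)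
  with pq show ?thesis by (simp add: Un_commute)
qed

text \<open>Closure under unions is granted for families indexed by a small subset of
  \<open>'u\<close>; an injection of the natural numbers into an infinite small set supplies such an
  index.\<close>

lemma universe_UN_nat:
  assumes U: "universe U" and F: "\<And>n::nat. F n \<in> U"
  shows "(\<Union>n. F n) \<in> U"
proof -
  obtain Z where Z: "Z \<in> U" "infinite Z" using universe_infinite[OF U] .
  then obtain g :: "nat \<Rightarrow> 'a" where g: "inj g" "range g \<subseteq> Z"
    by (meson infinite_countable_subset)
  have "range g \<in> U" using universe_lepoll[OF U Z(1)] subset_imp_lepoll[OF g(2)] by blast
  then have "(\<Union>x\<in>range g. F (inv g x)) \<in> U" by (rule universe_UN[OF U]) (rule F)
  then show ?thesis using g(1) by simp
qed

lemma infinite_Times_lepoll: "infinite Z \<Longrightarrow> Z \<times> Z \<lesssim> Z"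
  using card_of_Times_same_infinite eqpoll_iff_card_of_ordIso eqpoll_imp_lepoll by blast

text \<open>Folding a pairing on \<open>Z\<close> codes lists of a fixed length injectively; pairing
  the result with a code of the length separates the lengths.\<close>

lemma infinite_lists_lepoll:
  assumes "infinite Z" shows "lists Z \<lesssim> Z"
proof -
  obtain p where p: "inj_on p (Z \<times> Z)" "p ` (Z \<times> Z) \<subseteq> Z"
    using infinite_Times_lepoll[OF assms] unfolding lepoll_def by blast
  obtain c where c: "c \<in> Z" using assms by fastforce
  obtain g :: "nat \<Rightarrow> 'a" where g: "inj g" "range g \<subseteq> Z"
    using assms by (meson infinite_countable_subset)
  \<comment> \<open>The end marker \<open>c\<close> is an arbitrary element of \<open>Z\<close> and
    may also occur as a value, so \<open>e\<close> alone need not distinguish lists of different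
    lengths.\<close>
  define e where "e xs = foldr (\<lambda>x y. p (x, y)) xs c" for xs
  have eZ: "e xs \<in> Z" if "xs \<in> lists Z" for xs
    using that by (induction xs) (use c p in \<open>auto simp: e_def image_subset_iff\<close>)
  have inj: "length xs = length ys \<Longrightarrow> xs \<in> lists Z \<Longrightarrow> ys \<in> lists Z \<Longrightarrow> e xs = e ys \<Longrightarrow> xs = ys"
    for xs ys
  proof (induction xs ys rule: list_induct2)
    case (Cons x xs y ys)
    then have "(x, e xs) = (y, e ys)"
      by (intro inj_onD[OF p(1)]) (auto simp: eZ, simp add: e_def)
    with Cons show ?case by auto
  qed simp
  have "inj_on (\<lambda>xs. p (g (length xs), e xs)) (lists Z)"
  proof (rule inj_onI)
    fix xs ys assume *: "xs \<in> lists Z" "ys \<in> lists Z"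
      "p (g (length xs), e xs) = p (g (length ys), e ys)"
    then have "(g (length xs), e xs) = (g (length ys), e ys)"
      using g eZ by (intro inj_onD[OF p(1)]) auto
    with g inj * show "xs = ys" by (auto dest: injD)
  qed
  moreover have "(\<lambda>xs. p (g (length xs), e xs)) ` lists Z \<subseteq> Z"
    using p(2) g eZ by (auto simp: image_subset_iff)
  ultimately show ?thesis unfolding lepoll_def by blast
qed


section \<open>The category of small sets\<close>

lemma SET_simps [simp]:
  "Ob (SET U) = U" "Hom (SET U) X Y = (X \<rightarrow>\<^sub>E Y)" "Idn (SET U) X = (\<lambda>x\<in>X. x)"
  "Cmp (SET U) X Y Z g f = compose X g f"
  by (simp_all add: SET_def)

lemma compose_apply [simp]: "x \<in> A \<Longrightarrow> compose A g f x = g (f x)"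
  by (simp add: compose_def)

lemma compose_PiE [intro]: "f \<in> X \<rightarrow>\<^sub>E Y \<Longrightarrow> g \<in> Y \<rightarrow>\<^sub>E Z \<Longrightarrow> compose X g f \<in> X \<rightarrow>\<^sub>E Z"
  by (auto simp: compose_def)

lemma compose_eqI: "(\<And>x. x \<in> X \<Longrightarrow> g (f x) = g' (f' x)) \<Longrightarrow> compose X g f = compose X g' f'"
  by (auto simp: compose_def fun_eq_iff)

lemma compose_eq_iff: "compose X g f = compose X g' f' \<longleftrightarrow> (\<forall>x\<in>X. g (f x) = g' (f' x))"
  by (metis compose_apply compose_eqI)

lemma PiE_eqI: "f \<in> X \<rightarrow>\<^sub>E Y \<Longrightarrow> g \<in> X \<rightarrow>\<^sub>E Z \<Longrightarrow> (\<And>x. x \<in> X \<Longrightarrow> f x = g x) \<Longrightarrow> f = g"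
  by (rule extensionalityI[of _ X]) (auto simp: PiE_def)

lemma PiE_restrict_id [simp]: "(\<lambda>x\<in>X. x) \<in> X \<rightarrow>\<^sub>E X"
  by auto

lemma compose_restrict_id [simp]:
  assumes "f \<in> X \<rightarrow>\<^sub>E Y"
  shows "compose X f (\<lambda>x\<in>X. x) = f" "compose X (\<lambda>y\<in>Y. y) f = f"
proof -
  show "compose X f (\<lambda>x\<in>X. x) = f"
    by (rule PiE_eqI[OF compose_PiE[OF PiE_restrict_id assms] assms]) simp
  show "compose X (\<lambda>y\<in>Y. y) f = f"
    by (rule PiE_eqI[OF compose_PiE[OF assms PiE_restrict_id] assms])
      (use assms in \<open>auto dest: PiE_mem\<close>)
qed

lemma SET_category: "is_category (SET U)"
  unfolding is_category_def SET_simps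
  by (intro conjI ballI compose_PiE PiE_restrict_id) (auto simp: compose_eq_iff dest: PiE_mem)

text \<open>The functor laws on elements: equations between extensional functions become equations
  at points, where representatives of classes can be inserted.\<close>

definition set_functor :: "'u set set \<Rightarrow> 'u endo \<Rightarrow> bool" where
  "set_functor U F \<longleftrightarrow> (\<forall>X\<in>U. fob F X \<in> U) \<and>
     (\<forall>X\<in>U. \<forall>Y\<in>U. \<forall>f\<in>X \<rightarrow>\<^sub>E Y. far F X Y f \<in> fob F X \<rightarrow>\<^sub>E fob F Y) \<and>
     (\<forall>X\<in>U. \<forall>q\<in>fob F X. far F X X (\<lambda>x\<in>X. x) q = q) \<and>
     (\<forall>X\<in>U. \<forall>Y\<in>U. \<forall>Z\<in>U. \<forall>f\<in>X \<rightarrow>\<^sub>E Y. \<forall>g\<in>Y \<rightarrow>\<^sub>E Z. \<forall>q\<in>fob F X.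
        far F X Z (compose X g f) q = far F Y Z g (far F X Y f q))"

lemma is_functor_SET: "is_functor (SET U) (SET U) F \<longleftrightarrow> set_functor U F"
proof
  assume "is_functor (SET U) (SET U) F"
  then show "set_functor U F"
    unfolding is_functor_def set_functor_def by simp
next
  assume F: "set_functor U F"
  note D = F[unfolded set_functor_def]
  show "is_functor (SET U) (SET U) F"
    unfolding is_functor_def
  proof (intro conjI ballI)
    fix X assume X: "X \<in> Ob (SET U)"
    show "far F X X (Idn (SET U) X) = Idn (SET U) (fob F X)"
      by (rule PiE_eqI[of _ "fob F X" "fob F X" _ "fob F X"]) (use D X in simp_all)
    fix Y Z f g
    assume *: "Y \<in> Ob (SET U)" "Z \<in> Ob (SET U)" "f \<in> Hom (SET U) X Y" "g \<in> Hom (SET U) Y Z"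
    show "far F X Z (Cmp (SET U) X Y Z g f) =
      Cmp (SET U) (fob F X) (fob F Y) (fob F Z) (far F Y Z g) (far F X Y f)"
    proof (rule PiE_eqI[of _ "fob F X" "fob F Z" _ "fob F Z"])
      show "Cmp (SET U) (fob F X) (fob F Y) (fob F Z) (far F Y Z g) (far F X Y f) \<in> fob F X \<rightarrow>\<^sub>E fob F Z"
        using D X * unfolding SET_simps by (intro compose_PiE[of _ _ "fob F Y"]) blast+
    qed (use D X * compose_PiE[of f X Y g Z] in simp_all)
  qed (use F in \<open>auto simp: SET_category set_functor_def\<close>)
qed

lemma set_functorD:
  assumes "set_functor U F"
  shows "X \<in> U \<Longrightarrow> fob F X \<in> U"
    "X \<in> U \<Longrightarrow> Y \<in> U \<Longrightarrow> f \<in> X \<rightarrow>\<^sub>E Y \<Longrightarrow> far F X Y f \<in> fob F X \<rightarrow>\<^sub>E fob F Y"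
    "X \<in> U \<Longrightarrow> q \<in> fob F X \<Longrightarrow> far F X X (\<lambda>x\<in>X. x) q = q"
    "X \<in> U \<Longrightarrow> Y \<in> U \<Longrightarrow> Z \<in> U \<Longrightarrow> f \<in> X \<rightarrow>\<^sub>E Y \<Longrightarrow> g \<in> Y \<rightarrow>\<^sub>E Z \<Longrightarrow> q \<in> fob F X \<Longrightarrow>
      far F X Z (compose X g f) q = far F Y Z g (far F X Y f q)"
  using assms unfolding set_functor_def by blast+

lemma functor_id_simps [simp]: "fob functor_id x = x" "far functor_id x y f = f"
  by (simp_all add: functor_id_def)

lemma functor_comp_simps [simp]:
  "fob (functor_comp G F) x = fob G (fob F x)"
  "far (functor_comp G F) x y f = far G (fob F x) (fob F y) (far F x y f)"
  by (simp_all add: functor_comp_def)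

lemma is_functor_comp:
  assumes F: "is_functor C D F" and G: "is_functor D E G"
  shows "is_functor C E (functor_comp G F)"
  unfolding is_functor_def
proof (intro conjI ballI)
  fix x y z f g
  assume *: "x \<in> Ob C" "y \<in> Ob C" "z \<in> Ob C" "f \<in> Hom C x y" "g \<in> Hom C y z"
  then have "far F x y f \<in> Hom D (fob F x) (fob F y)" "far F y z g \<in> Hom D (fob F y) (fob F z)"
    "fob F x \<in> Ob D" "fob F y \<in> Ob D" "fob F z \<in> Ob D"
    using F unfolding is_functor_def by blast+
  moreover have "far F x z (Cmp C x y z g f) = Cmp D (fob F x) (fob F y) (fob F z) (far F y z g) (far F x y f)"
    using * F unfolding is_functor_def by blast
  ultimately show "far (functor_comp G F) x z (Cmp C x y z g f) =
    Cmp E (fob (functor_comp G F) x) (fob (functor_comp G F) y) (fob (functor_comp G F) z)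
      (far (functor_comp G F) y z g) (far (functor_comp G F) x y f)"
    using G unfolding is_functor_def by simp
qed (use assms in \<open>auto simp: is_functor_def\<close>)

lemma set_functor_id: "set_functor U functor_id"
  by (auto simp: set_functor_def)

lemma set_functor_comp: "set_functor U F \<Longrightarrow> set_functor U G \<Longrightarrow> set_functor U (functor_comp G F)"
  using is_functor_comp is_functor_SET by blast

section \<open>Transformations, monomorphisms and pullbacks of small sets in terms of
  elements\<close>

lemma nat_trans_SET:
  "nat_trans (SET U) (SET U) F G \<tau> \<longleftrightarrow> set_functor U F \<and> set_functor U G \<and>
     (\<forall>X\<in>U. \<tau> X \<in> fob F X \<rightarrow>\<^sub>E fob G X) \<and>
     (\<forall>X\<in>U. \<forall>Y\<in>U. \<forall>f\<in>X \<rightarrow>\<^sub>E Y. \<forall>q\<in>fob F X. \<tau> Y (far F X Y f q) = far G X Y f (\<tau> X q))"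
  unfolding nat_trans_def is_functor_SET by (simp add: compose_eq_iff)

text \<open>Elements of \<open>X\<close> are arrows out of a one-element set, and such a set is
  small; cancelling \<open>f\<close> against them is injectivity.\<close>

lemma set_monic_iff:
  fixes U :: "'u set set"
  assumes U: "universe U" and X: "X \<in> U"
  shows "monic (SET U) X Y f \<longleftrightarrow> f \<in> X \<rightarrow>\<^sub>E Y \<and> inj_on f X"
proof
  assume m: "monic (SET U) X Y f"
  show "f \<in> X \<rightarrow>\<^sub>E Y \<and> inj_on f X"
  proof (intro conjI inj_onI)
    fix x y assume xy: "x \<in> X" "y \<in> X" "f x = f y"
    obtain p :: 'u where True by simp
    have "{p} \<in> U" by (simp add: universe_finite[OF U])
    moreover have "(\<lambda>_\<in>{p}. x) \<in> {p} \<rightarrow>\<^sub>E X" "(\<lambda>_\<in>{p}. y) \<in> {p} \<rightarrow>\<^sub>E X"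
      using xy by (simp_all add: restrict_PiE_iff)
    moreover have "compose {p} f (\<lambda>_\<in>{p}. x) = compose {p} f (\<lambda>_\<in>{p}. y)"
      using xy by (intro compose_eqI) simp
    ultimately have "(\<lambda>_\<in>{p}. x) = (\<lambda>_\<in>{p}. y)"
      using m unfolding monic_def by simp
    then show "x = y" by (metis insertI1 restrict_apply')
  qed (use m in \<open>simp add: monic_def\<close>)
next
  assume f: "f \<in> X \<rightarrow>\<^sub>E Y \<and> inj_on f X"
  then show "monic (SET U) X Y f"
    unfolding monic_def SET_simps compose_eq_iff
    by (metis PiE_eqI PiE_mem inj_onD)
qed

text \<open>The universal property tested on one-element sets only.\<close>

definition set_pullback ::
  "'u set \<Rightarrow> 'u set \<Rightarrow> 'u set \<Rightarrow> ('u \<Rightarrow> 'u) \<Rightarrow> ('u \<Rightarrow> 'u) \<Rightarrow> ('u \<Rightarrow> 'u) \<Rightarrow> ('u \<Rightarrow> 'u) \<Rightarrow> bool" where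
  "set_pullback P X Y p q f g \<longleftrightarrow> (\<forall>w\<in>P. f (p w) = g (q w)) \<and>
     (\<forall>u\<in>X. \<forall>v\<in>Y. f u = g v \<longrightarrow> (\<exists>!w. w \<in> P \<and> p w = u \<and> q w = v))"

text \<open>A one-element test set gives existence and uniqueness of a single point over a
  compatible pair; conversely these unique points assemble into the mediating arrow.\<close>

lemma pullback_SET_iff:
  fixes U :: "'u set set"
  assumes U: "universe U"
    and p: "p \<in> P \<rightarrow>\<^sub>E X" and q: "q \<in> P \<rightarrow>\<^sub>E Y" and f: "f \<in> X \<rightarrow>\<^sub>E Z" and g: "g \<in> Y \<rightarrow>\<^sub>E Z"
  shows "pullback (SET U) P X Y Z p q f g \<longleftrightarrow> set_pullback P X Y p q f g"
proof
  assume pb: "pullback (SET U) P X Y Z p q f g"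
  show "set_pullback P X Y p q f g"
    unfolding set_pullback_def
  proof (intro conjI ballI impI)
    fix w assume "w \<in> P" then show "f (p w) = g (q w)"
      using pb unfolding pullback_def by (simp add: compose_eq_iff)
  next
    fix u v assume uv: "u \<in> X" "v \<in> Y" "f u = g v"
    obtain c :: 'u where True by simp
    have C: "{c} \<in> U" by (simp add: universe_finite[OF U])
    have eq: "compose {c} f (\<lambda>_\<in>{c}. u) = compose {c} g (\<lambda>_\<in>{c}. v)"
      using uv by (intro compose_eqI) simp
    have "\<exists>!h. h \<in> {c} \<rightarrow>\<^sub>E P \<and> compose {c} p h = (\<lambda>_\<in>{c}. u) \<and> compose {c} q h = (\<lambda>_\<in>{c}. v)"
      using pb[unfolded pullback_def] C uv eq by (simp add: restrict_PiE_iff)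
    then obtain h where h: "h \<in> {c} \<rightarrow>\<^sub>E P" "compose {c} p h = (\<lambda>_\<in>{c}. u)"
        "compose {c} q h = (\<lambda>_\<in>{c}. v)"
      and uq: "\<And>h'. h' \<in> {c} \<rightarrow>\<^sub>E P \<and> compose {c} p h' = (\<lambda>_\<in>{c}. u) \<and>
        compose {c} q h' = (\<lambda>_\<in>{c}. v) \<Longrightarrow> h' = h" by (metis (no_types, lifting))
    show "\<exists>!w. w \<in> P \<and> p w = u \<and> q w = v"
    proof (rule ex1I[of _ "h c"])
      show "h c \<in> P \<and> p (h c) = u \<and> q (h c) = v"
        using PiE_mem[OF h(1), of c] fun_cong[OF h(2), of c] fun_cong[OF h(3), of c]
        by (simp add: compose_def)
      fix w assume w: "w \<in> P \<and> p w = u \<and> q w = v"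
      have "(\<lambda>_\<in>{c}. w) = h"
        using w by (intro uq conjI) (simp_all add: restrict_PiE_iff compose_def fun_eq_iff)
      then show "w = h c" by (metis insertI1 restrict_apply')
    qed
  qed
next
  assume pb: "set_pullback P X Y p q f g"
  show "pullback (SET U) P X Y Z p q f g"
    unfolding pullback_def SET_simps
  proof (intro conjI ballI impI p q f g)
    show "compose P f p = compose P g q" using pb unfolding set_pullback_def by (simp add: compose_eq_iff)
  next
    fix W u v assume W: "W \<in> U" "u \<in> W \<rightarrow>\<^sub>E X" "v \<in> W \<rightarrow>\<^sub>E Y" "compose W f u = compose W g v"
    then have *: "\<exists>!w. w \<in> P \<and> p w = u x \<and> q w = v x" if "x \<in> W" for x
      using pb PiE_mem[OF W(2) that] PiE_mem[OF W(3) that] that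
      unfolding set_pullback_def compose_eq_iff by blast
    define h where "h = (\<lambda>x\<in>W. THE w. w \<in> P \<and> p w = u x \<and> q w = v x)"
    have h: "h x \<in> P \<and> p (h x) = u x \<and> q (h x) = v x" if "x \<in> W" for x
      using theI'[OF *[OF that]] that by (simp add: h_def)
    show "\<exists>!h. h \<in> W \<rightarrow>\<^sub>E P \<and> compose W p h = u \<and> compose W q h = v"
    proof (rule ex1I[of _ h])
      have hP: "h \<in> W \<rightarrow>\<^sub>E P" using h by (auto simp: h_def)
      then show "h \<in> W \<rightarrow>\<^sub>E P \<and> compose W p h = u \<and> compose W q h = v"
        by (intro conjI PiE_eqI[OF compose_PiE[OF _ p] W(2)] PiE_eqI[OF compose_PiE[OF _ q] W(3)])
          (use h in auto)
      fix h' assume h': "h' \<in> W \<rightarrow>\<^sub>E P \<and> compose W p h' = u \<and> compose W q h' = v"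
      show "h' = h"
      proof (rule PiE_eqI[OF conjunct1[OF h'] hP])
        fix x assume x: "x \<in> W"
        then have "h' x \<in> P \<and> p (h' x) = u x \<and> q (h' x) = v x" using h' by (auto dest: PiE_mem)
        with h[OF x] *[OF x] show "h' x = h x" by blast
      qed
    qed
  qed
qed

section \<open>Tuples and maps of finite ordinals\<close>

lemma length_tcomp [simp]: "length (x \<odot> \<phi>) = length \<phi>"
  by (simp add: tcomp_def)

lemma nth_tcomp [simp]: "i < length \<phi> \<Longrightarrow> (x \<odot> \<phi>) ! i = x ! (\<phi> ! i)"
  by (simp add: tcomp_def)

lemma tcomp_simps [simp]:
  "x \<odot> [] = []" "x \<odot> (j # \<phi>) = x ! j # (x \<odot> \<phi>)" "x \<odot> (\<phi> @ \<psi>) = (x \<odot> \<phi>) @ (x \<odot> \<psi>)"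
  "x \<odot> map h \<chi> = map (\<lambda>j. x ! h j) \<chi>" "x \<odot> concat \<phi>s = concat (map ((\<odot>) x) \<phi>s)"
  by (auto simp: tcomp_def map_concat comp_def intro!: arg_cong[where f = concat])

lemma tcomp_id [simp]: "x \<odot> [0..<length x] = x"
  by (simp add: tcomp_def map_nth)

lemma upt_tcomp [simp]: "set \<phi> \<subseteq> {..<n} \<Longrightarrow> [0..<n] \<odot> \<phi> = \<phi>"
  by (auto simp: tcomp_def intro!: map_idI)

lemma map_tcomp: "set \<phi> \<subseteq> {..<length x} \<Longrightarrow> map f (x \<odot> \<phi>) = map f x \<odot> \<phi>"
  by (auto simp: tcomp_def)

lemma tcomp_assoc: "set z \<subseteq> {..<length y} \<Longrightarrow> x \<odot> (y \<odot> z) = (x \<odot> y) \<odot> z"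
  by (auto simp: tcomp_def)

lemma set_tcomp_eq: "set (x \<odot> \<phi>) = (!) x ` set \<phi>"
  by (simp add: tcomp_def)

lemma set_tcomp_subset: "set \<phi> \<subseteq> {..<length x} \<Longrightarrow> set (x \<odot> \<phi>) \<subseteq> set x"
  by (auto simp: set_tcomp_eq)

lemma set_tcomp_surj: "set \<phi> = {..<length x} \<Longrightarrow> set (x \<odot> \<phi>) = set x"
  using nth_image[of "length x" x] by (simp add: set_tcomp_eq lessThan_atLeast0)

lemma distinct_tcomp: "distinct x \<Longrightarrow> set \<phi> \<subseteq> {..<length x} \<Longrightarrow> distinct (x \<odot> \<phi>) \<longleftrightarrow> distinct \<phi>"
  by (auto simp: tcomp_def distinct_map nth_eq_iff_index_eq subset_iff inj_on_def)

text \<open>An injective tuple is a monomorphism. This makes the surjective factor unique once the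
  injective factor is fixed.\<close>

lemma tcomp_cancel:
  assumes "distinct z" "set \<alpha> \<subseteq> {..<length z}" "set \<beta> \<subseteq> {..<length z}" "z \<odot> \<alpha> = z \<odot> \<beta>"
  shows "\<alpha> = \<beta>"
proof (rule map_inj_on[of "(!) z"])
  show "map ((!) z) \<alpha> = map ((!) z) \<beta>" using assms(4) by (simp add: tcomp_def)
  show "inj_on ((!) z) (set \<alpha> \<union> set \<beta>)"
    using assms(1-3) by (auto simp: inj_on_def nth_eq_iff_index_eq subset_iff)
qed

lemma FF_iff: "\<phi> \<in> FF n m \<longleftrightarrow> length \<phi> = n \<and> set \<phi> \<subseteq> {..<m}"
  by (auto simp: FF_def)

lemma SS_iff: "\<phi> \<in> SS n m \<longleftrightarrow> length \<phi> = n \<and> set \<phi> = {..<m}"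
  by (auto simp: SS_def FF_def)

lemma BB_iff: "\<phi> \<in> BB n m \<longleftrightarrow> length \<phi> = n \<and> set \<phi> = {..<m} \<and> distinct \<phi>"
  by (auto simp: SS_def BB_def II_def FF_def)

lemma Inj_eq: "Inj n = inj_lists {..<n}"
  by (auto simp: II_def FF_def inj_lists_def)

lemma inj_lists_iff: "x \<in> inj_lists X \<longleftrightarrow> set x \<subseteq> X \<and> distinct x"
  by (auto simp: inj_lists_def)

section \<open>Surjection-injection factorization of tuples\<close>

definition surj_part :: "'x list \<Rightarrow> nat list" where
  "surj_part x = map (\<lambda>e. SOME i. i < length (remdups x) \<and> remdups x ! i = e) x"

text \<open>Each entry of \<open>x\<close> has exactly one position in \<open>remdups x\<close>, so
  the choice in \<open>surj_part\<close> is forced; every position is hit because both lists have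
  the same entries.\<close>

lemma surj_part_eq: "remdups x \<odot> surj_part x = x"
  and surj_part_SS: "surj_part x \<in> SS (length x) (length (remdups x))"
proof -
  have *: "(SOME i. i < length (remdups x) \<and> remdups x ! i = e) < length (remdups x) \<and>
      remdups x ! (SOME i. i < length (remdups x) \<and> remdups x ! i = e) = e" if "e \<in> set x" for e
    using that by (intro someI_ex[of "\<lambda>i. i < length (remdups x) \<and> remdups x ! i = e"])
      (metis in_set_conv_nth set_remdups)
  then show eq: "remdups x \<odot> surj_part x = x"
    by (auto simp: surj_part_def intro!: map_idI)
  have sub: "set (surj_part x) \<subseteq> {..<length (remdups x)}"
    using * by (auto simp: surj_part_def)
  have "i \<in> set (surj_part x)" if i: "i < length (remdups x)" for i
  proof -
    have "remdups x ! i \<in> set (remdups x \<odot> surj_part x)"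
      using i by (metis eq nth_mem set_remdups)
    then obtain j where "j \<in> set (surj_part x)" "remdups x ! i = remdups x ! j"
      by (auto simp: set_tcomp_eq)
    with sub i show ?thesis by (auto simp: nth_eq_iff_index_eq subset_iff)
  qed
  with sub show "surj_part x \<in> SS (length x) (length (remdups x))"
    by (auto simp: SS_iff) (simp add: surj_part_def)
qed

text \<open>A repeated value of \<alpha> would repeat an entry of \<open>x\<close>. On injective
  tuples, gluings along surjections thus reduce to gluings along bijections.\<close>

lemma distinct_factor_BB:
  assumes "distinct x" "x = z \<odot> \<alpha>" "\<alpha> \<in> SS n (length z)"
  shows "\<alpha> \<in> BB n (length z)"
proof -
  have "distinct \<alpha>"
    using assms(1) unfolding assms(2) by (simp add: tcomp_def distinct_map)
  with assms(3) show ?thesis by (simp add: SS_iff BB_iff)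
qed

text \<open>Uniqueness of the image up to a bijection: two injective enumerations of one set differ
  by a permutation of positions.\<close>

lemma distinct_same_set:
  assumes "distinct z" "distinct z'" "set z = set z'"
  obtains \<sigma> where "\<sigma> \<in> BB (length z') (length z)" "z' = z \<odot> \<sigma>"
proof -
  define \<sigma> where "\<sigma> = map (\<lambda>e. SOME i. i < length z \<and> z ! i = e) z'"
  have *: "(SOME i. i < length z \<and> z ! i = e) < length z \<and>
      z ! (SOME i. i < length z \<and> z ! i = e) = e" if "e \<in> set z'" for e
    using that assms(3) by (intro someI_ex[of "\<lambda>i. i < length z \<and> z ! i = e"])
      (metis in_set_conv_nth)
  have eq: "z \<odot> \<sigma> = z'" using * by (auto simp: \<sigma>_def intro!: map_idI)
  have sub: "set \<sigma> \<subseteq> {..<length z}" using * by (auto simp: \<sigma>_def)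
  have "i \<in> set \<sigma>" if i: "i < length z" for i
  proof -
    have "z ! i \<in> set (z \<odot> \<sigma>)" unfolding eq assms(3)[symmetric] using i by simp
    then obtain j where "j \<in> set \<sigma>" "z ! i = z ! j" by (auto simp: set_tcomp_eq)
    with sub i assms(1) show ?thesis by (auto simp: nth_eq_iff_index_eq subset_iff)
  qed
  then have "\<sigma> \<in> SS (length z') (length z)" using sub by (auto simp: SS_iff \<sigma>_def)
  with distinct_factor_BB[OF assms(2) eq[symmetric]] eq show ?thesis by (intro that) auto
qed

section \<open>Offsets of blocks in a concatenation, and the map \<open>star\<close>\<close>

lemma concat_nth_block:
  assumes "j < length ws" "r < length (ws ! j)"
  shows "concat ws ! (sum_list (take j (map length ws)) + r) = ws ! j ! r"
  using assms
proof (induction ws arbitrary: j)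
  case (Cons w ws)
  then show ?case by (cases j) (auto simp: nth_append)
qed simp

lemma offset_less:
  fixes ls :: "nat list"
  assumes "j < length ls" "r < ls ! j" shows "sum_list (take j ls) + r < sum_list ls"
  using assms
proof (induction ls arbitrary: j)
  case (Cons l ls)
  then show ?case by (cases j) (auto simp: add.assoc)
qed simp

lemma offset_cases:
  fixes ls :: "nat list"
  assumes "t < sum_list ls"
  obtains j r where "j < length ls" "r < ls ! j" "t = sum_list (take j ls) + r"
  using assms
proof (induction ls arbitrary: t thesis)
  case (Cons l ls)
  show ?case
  proof (cases "t < l")
    case True then show ?thesis by (intro Cons.prems(1)[of 0 t]) auto
  next
    case False
    with Cons.prems have "t - l < sum_list ls" by auto
    then obtain j r where "j < length ls" "r < ls ! j" "t - l = sum_list (take j ls) + r"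
      by (rule Cons.IH[rotated])
    with False show ?thesis by (intro Cons.prems(1)[of "Suc j" r]) auto
  qed
qed simp

lemma offset_inj:
  fixes ls :: "nat list"
  assumes "j < length ls" "r < ls ! j" "j' < length ls" "r' < ls ! j'"
    "sum_list (take j ls) + r = sum_list (take j' ls) + r'"
  shows "j = j' \<and> r = r'"
proof -
  \<comment> \<open>\<open>concat ws\<close> lists the pairs (block, position in the block), so its
    entry at an offset recovers both coordinates.\<close>
  define ws where "ws = map (\<lambda>j. map (Pair j) [0..<ls ! j]) [0..<length ls]"
  have ls: "map length ws = ls" by (simp add: ws_def comp_def map_nth)
  have "concat ws ! (sum_list (take j ls) + r) = (j, r)" if "j < length ls" "r < ls ! j" for j r
    using that concat_nth_block[of j ws r] unfolding ls by (simp add: ws_def)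
  from this[OF assms(1,2)] this[OF assms(3,4)] assms(5) show ?thesis by (metis prod.inject)
qed

lemma length_star: "length (star \<psi>s ls \<phi>) = sum_list (map length \<psi>s \<odot> \<phi>)"
  if "set \<phi> \<subseteq> {..<length \<psi>s}"
  using that by (auto simp: star_def length_concat tcomp_def comp_def subset_iff
      intro!: arg_cong[where f = sum_list])

text \<open>Reason for the shape of \<open>star\<close>: its shift by the sizes of the preceding
  summands is the offset of a block in the concatenation, so composing with \<open>star\<close>
  selects whole blocks and reindexes each of them.\<close>

lemma concat_star:
  assumes "set \<phi> \<subseteq> {..<length ws}" "\<And>j. j < length ws \<Longrightarrow> set (\<psi>s ! j) \<subseteq> {..<length (ws ! j)}"
    and ls: "ls = map length ws"
  shows "concat ws \<odot> star \<psi>s ls \<phi> = concat (map (\<lambda>j. ws ! j \<odot> \<psi>s ! j) \<phi>)"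
proof -
  have "concat ws \<odot> map (\<lambda>r. sum_list (take j ls) + r) (\<psi>s ! j) = ws ! j \<odot> \<psi>s ! j"
    if "j \<in> set \<phi>" for j
  proof -
    have j: "j < length ws" using that assms(1) by auto
    show ?thesis
      using concat_nth_block[OF j] assms(2)[OF j] by (auto simp: tcomp_def ls)
  qed
  then show ?thesis
    by (auto simp: star_def comp_def intro!: arg_cong[where f = concat])
qed

lemma set_star_subset:
  assumes "set \<phi> \<subseteq> {..<length ls}" "\<And>j. j < length ls \<Longrightarrow> set (\<psi>s ! j) \<subseteq> {..<ls ! j}"
  shows "set (star \<psi>s ls \<phi>) \<subseteq> {..<sum_list ls}"
proof
  fix t assume "t \<in> set (star \<psi>s ls \<phi>)"
  then obtain j r where "j \<in> set \<phi>" "r \<in> set (\<psi>s ! j)" "t = sum_list (take j ls) + r"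
    by (auto simp: star_def)
  moreover from this assms have "j < length ls" "r < ls ! j" by auto
  ultimately show "t \<in> {..<sum_list ls}" using offset_less by auto
qed

lemma set_star_surj:
  assumes "set \<phi> = {..<length ls}" "\<And>j. j < length ls \<Longrightarrow> set (\<psi>s ! j) = {..<ls ! j}"
  shows "set (star \<psi>s ls \<phi>) = {..<sum_list ls}"
proof
  show "set (star \<psi>s ls \<phi>) \<subseteq> {..<sum_list ls}"
    using assms by (intro set_star_subset) auto
  show "{..<sum_list ls} \<subseteq> set (star \<psi>s ls \<phi>)"
  proof
    fix t assume "t \<in> {..<sum_list ls}"
    then obtain j r where jr: "j < length ls" "r < ls ! j" "t = sum_list (take j ls) + r"
      using offset_cases by (metis lessThan_iff)
    with assms(2)[OF jr(1)] have "r \<in> set (\<psi>s ! j)" "j \<in> set \<phi>" using assms(1) by auto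
    then show "t \<in> set (star \<psi>s ls \<phi>)" using jr(3) by (force simp: star_def)
  qed
qed

text \<open>Blocks over different indices lie in disjoint summands by \<open>offset_inj\<close>, and
  no block occurs twice because \<phi> has no repetitions.\<close>

lemma distinct_star:
  assumes "distinct \<phi>" "set \<phi> \<subseteq> {..<length ls}"
    "\<And>j. j < length ls \<Longrightarrow> set (\<psi>s ! j) \<subseteq> {..<ls ! j} \<and> distinct (\<psi>s ! j)"
  shows "distinct (star \<psi>s ls \<phi>)"
  using assms(1,2)
proof (induction \<phi>)
  case Nil then show ?case by (simp add: star_def)
next
  case (Cons j \<phi>)
  let ?b = "map (\<lambda>r. sum_list (take j ls) + r) (\<psi>s ! j)"
  have [simp]: "star \<psi>s ls (j # \<phi>) = ?b @ star \<psi>s ls \<phi>" by (simp add: star_def)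
  have "distinct ?b" using assms(3) Cons.prems by (auto simp: distinct_map)
  moreover have "set ?b \<inter> set (star \<psi>s ls \<phi>) = {}"
  proof (rule ccontr)
    assume "set ?b \<inter> set (star \<psi>s ls \<phi>) \<noteq> {}"
    then obtain i r r' where "i \<in> set \<phi>" "r \<in> set (\<psi>s ! j)" "r' \<in> set (\<psi>s ! i)"
      "sum_list (take j ls) + r = sum_list (take i ls) + r'"
      unfolding star_def by auto
    moreover from this have "i < length ls" "j < length ls" "r < ls ! j" "r' < ls ! i"
      using Cons.prems assms(3) by (auto simp: subset_iff)
    ultimately show False using Cons.prems offset_inj[of j ls r i r'] by auto
  qed
  ultimately show ?case using Cons by auto
qed

text \<open>General arguments see \<open>H\<close> only through \<open>ordinal_catD\<close> and
  \<open>ordinal_cat_star\<close>: it is a category of functions that contains the surjections and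
  is closed under \<open>star\<close>.\<close>

definition ordinal_cat :: "(nat \<Rightarrow> nat \<Rightarrow> nat list set) \<Rightarrow> bool" where
  "ordinal_cat H \<longleftrightarrow> H = FF \<or> H = SS"

lemma ordinal_cat_FF: "ordinal_cat FF" and ordinal_cat_SS: "ordinal_cat SS"
  by (simp_all add: ordinal_cat_def)

lemma ordinal_catD:
  assumes "ordinal_cat H"
  shows "\<phi> \<in> H n m \<Longrightarrow> length \<phi> = n" "\<phi> \<in> H n m \<Longrightarrow> set \<phi> \<subseteq> {..<m}"
    "\<phi> \<in> SS n m \<Longrightarrow> \<phi> \<in> H n m" "[0..<n] \<in> H n n"
    "\<phi> \<in> H n m \<Longrightarrow> \<psi> \<in> H m k \<Longrightarrow> \<psi> \<odot> \<phi> \<in> H n k"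
proof -
  show "\<phi> \<in> H n m \<Longrightarrow> length \<phi> = n" "\<phi> \<in> H n m \<Longrightarrow> set \<phi> \<subseteq> {..<m}"
    "\<phi> \<in> SS n m \<Longrightarrow> \<phi> \<in> H n m" "[0..<n] \<in> H n n"
    using assms[unfolded ordinal_cat_def]
    by (elim disjE; hypsubst; simp add: FF_iff SS_iff lessThan_atLeast0; fail)+
  show "\<psi> \<odot> \<phi> \<in> H n k" if "\<phi> \<in> H n m" "\<psi> \<in> H m k"
  proof (cases "H = FF")
    case True
    then have *: "length \<phi> = n" "set \<phi> \<subseteq> {..<length \<psi>}" "set \<psi> \<subseteq> {..<k}"
      using that by (simp_all add: FF_iff)
    show ?thesis
      unfolding True FF_iff using set_tcomp_subset[OF *(2)] *(1,3) by (metis length_tcomp order_trans)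
  next
    case False
    then have "H = SS" using assms by (simp add: ordinal_cat_def)
    then have *: "H = SS" "length \<phi> = n" "set \<phi> = {..<length \<psi>}" "set \<psi> = {..<k}"
      using that by (simp_all add: SS_iff)
    show ?thesis
      unfolding *(1) SS_iff using set_tcomp_surj[OF *(3)] *(2,4) by (metis length_tcomp)
  qed
qed

lemma ordinal_cat_star:
  assumes "ordinal_cat H" and \<phi>: "\<phi> \<in> H n m" and len: "length \<psi>s = m" "length ks = m" "length ls = m"
    and \<psi>s: "\<And>i. i < m \<Longrightarrow> \<psi>s ! i \<in> H (ks ! i) (ls ! i)"
  shows "star \<psi>s ls \<phi> \<in> H (sum_list (ks \<odot> \<phi>)) (sum_list ls)"
proof -
  have \<phi>m: "set \<phi> \<subseteq> {..<m}" using ordinal_catD(2)[OF assms(1) \<phi>] .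
  have "map length \<psi>s = ks"
    using \<psi>s len ordinal_catD(1)[OF assms(1)] by (intro nth_equalityI) auto
  then have "length (star \<psi>s ls \<phi>) = sum_list (ks \<odot> \<phi>)"
    using length_star[of \<phi> \<psi>s ls] \<phi>m len by simp
  moreover have "set (star \<psi>s ls \<phi>) \<subseteq> {..<sum_list ls}"
    using \<phi>m len ordinal_catD(2)[OF assms(1) \<psi>s] by (intro set_star_subset) auto
  moreover have "set (star \<psi>s ls \<phi>) = {..<sum_list ls}" if "H = SS"
    using \<phi> len \<psi>s unfolding that by (intro set_star_surj) (auto simp: SS_iff)
  ultimately show ?thesis
    using assms(1) unfolding ordinal_cat_def by (auto simp: FF_iff SS_iff)
qed

section \<open>Filtered colimits of small sets\<close>

lemma is_functor_to_SET:
  assumes "is_functor J (SET U) D"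
  shows "j \<in> Ob J \<Longrightarrow> fob D j \<in> U"
    "i \<in> Ob J \<Longrightarrow> j \<in> Ob J \<Longrightarrow> f \<in> Hom J i j \<Longrightarrow> far D i j f \<in> fob D i \<rightarrow>\<^sub>E fob D j"
    "j \<in> Ob J \<Longrightarrow> x \<in> fob D j \<Longrightarrow> far D j j (Idn J j) x = x"
    "i \<in> Ob J \<Longrightarrow> j \<in> Ob J \<Longrightarrow> k \<in> Ob J \<Longrightarrow> f \<in> Hom J i j \<Longrightarrow> g \<in> Hom J j k \<Longrightarrow> x \<in> fob D i \<Longrightarrow>
      far D i k (Cmp J i j k g f) x = far D j k g (far D i j f x)"
  using assms unfolding is_functor_def by simp_all

lemma is_categoryD:
  assumes "is_category C"
  shows "x \<in> Ob C \<Longrightarrow> Idn C x \<in> Hom C x x"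
    "x \<in> Ob C \<Longrightarrow> y \<in> Ob C \<Longrightarrow> z \<in> Ob C \<Longrightarrow> f \<in> Hom C x y \<Longrightarrow> g \<in> Hom C y z \<Longrightarrow>
      Cmp C x y z g f \<in> Hom C x z"
  using assms unfolding is_category_def by blast+

lemma filtered_coequalize:
  assumes "filtered J" "x \<in> Ob J" "y \<in> Ob J" "f \<in> Hom J x y" "g \<in> Hom J x y"
  shows "\<exists>z\<in>Ob J. \<exists>h\<in>Hom J y z. Cmp J x y z h f = Cmp J x y z h g"
  using assms unfolding filtered_def by simp

lemma cocone_SET:
  assumes "is_functor J (SET U) D"
  shows "cocone J (SET U) D L l \<longleftrightarrow> L \<in> U \<and> (\<forall>j\<in>Ob J. l j \<in> fob D j \<rightarrow>\<^sub>E L) \<and>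
     (\<forall>i\<in>Ob J. \<forall>j\<in>Ob J. \<forall>f\<in>Hom J i j. \<forall>x\<in>fob D i. l j (far D i j f x) = l i x)"
proof -
  have "compose (fob D i) (l j) (far D i j f) = l i \<longleftrightarrow> (\<forall>x\<in>fob D i. l j (far D i j f x) = l i x)"
    if l: "\<forall>j\<in>Ob J. l j \<in> fob D j \<rightarrow>\<^sub>E L" and ij: "i \<in> Ob J" "j \<in> Ob J" "f \<in> Hom J i j" for i j f
  proof
    assume "\<forall>x\<in>fob D i. l j (far D i j f x) = l i x"
    then show "compose (fob D i) (l j) (far D i j f) = l i"
      by (intro PiE_eqI[OF compose_PiE[OF is_functor_to_SET(2)[OF assms ij] bspec[OF l ij(2)]]
            bspec[OF l ij(1)]]) simp
  qed (metis compose_apply)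
  then show ?thesis unfolding cocone_def SET_simps by blast
qed

definition joint_surj :: "('j, 'b) category \<Rightarrow> ('j, 'b, 'u set, 'u \<Rightarrow> 'u) fnctr \<Rightarrow> 'u set \<Rightarrow> ('j \<Rightarrow> 'u \<Rightarrow> 'u) \<Rightarrow> bool" where
  "joint_surj J D L l \<longleftrightarrow> (\<forall>y\<in>L. \<exists>j\<in>Ob J. \<exists>x\<in>fob D j. l j x = y)"

text \<open>The classical identification in a filtered colimit of sets: two elements become equal at
  some common later stage.\<close>

definition merges :: "('j, 'b) category \<Rightarrow> ('j, 'b, 'u set, 'u \<Rightarrow> 'u) fnctr \<Rightarrow> 'j \<Rightarrow> 'u \<Rightarrow> 'j \<Rightarrow> 'u \<Rightarrow> bool" where
  "merges J D i x j y \<longleftrightarrow>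
     (\<exists>k\<in>Ob J. \<exists>f\<in>Hom J i k. \<exists>g\<in>Hom J j k. far D i k f x = far D j k g y)"

text \<open>Merging depends only on the images of an element at later stages. This gives the cocone
  condition for the characteristic map of merging, and it lets equations found at different stages
  be combined.\<close>

lemma merges_arrow:
  assumes J: "filtered J" and D: "is_functor J (SET U) D"
    and ob: "i \<in> Ob J" "j \<in> Ob J" "j' \<in> Ob J" and e: "e \<in> Hom J j j'"
    and x: "x \<in> fob D i" and y: "y \<in> fob D j"
  shows "merges J D i x j' (far D j j' e y) \<longleftrightarrow> merges J D i x j y"
proof
  have cat: "is_category J" using J unfolding filtered_def by blast
  note C = is_categoryD[OF cat] and DF = is_functor_to_SET[OF D]
  {
    assume "merges J D i x j' (far D j j' e y)"
    then obtain k f g where k: "k \<in> Ob J" "f \<in> Hom J i k" "g \<in> Hom J j' k"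
      "far D i k f x = far D j' k g (far D j j' e y)" unfolding merges_def by blast
    then have "Cmp J j j' k g e \<in> Hom J j k" "far D i k f x = far D j k (Cmp J j j' k g e) y"
      using C(2)[OF ob(2,3) k(1) e k(3)] DF(4)[OF ob(2,3) k(1) e k(3) y] by auto
    then show "merges J D i x j y" unfolding merges_def using k by blast
  next
    assume "merges J D i x j y"
    then obtain k f g where k: "k \<in> Ob J" "f \<in> Hom J i k" "g \<in> Hom J j k"
      "far D i k f x = far D j k g y" unfolding merges_def by blast
    \<comment> \<open>The two composites from \<open>j\<close> into \<open>z\<close>, through
      \<open>k\<close> and through \<open>j'\<close>, need not agree; a further arrow
      \<open>w\<close> makes them equal.\<close>
    obtain z u v where z: "z \<in> Ob J" "u \<in> Hom J k z" "v \<in> Hom J j' z"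
      using J k ob unfolding filtered_def by blast
    have ug: "Cmp J j k z u g \<in> Hom J j z" and ve: "Cmp J j j' z v e \<in> Hom J j z"
      using C(2)[OF ob(2) k(1) z(1) k(3) z(2)] C(2)[OF ob(2,3) z(1) e z(3)] .
    then obtain z' w where w: "z' \<in> Ob J" "w \<in> Hom J z z'"
      "Cmp J j z z' w (Cmp J j k z u g) = Cmp J j z z' w (Cmp J j j' z v e)"
      using filtered_coequalize[OF J ob(2) z(1) ug ve] by blast
    have gy: "far D j k g y \<in> fob D k" using DF(2) ob k y by (meson PiE_mem)
    have ey: "far D j j' e y \<in> fob D j'" using DF(2) ob e y by (meson PiE_mem)
    have "far D i z' (Cmp J i z z' w (Cmp J i k z u f)) x = far D z z' w (far D k z u (far D j k g y))"
      using DF(4) C(2) ob k z w x by simp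
    also have "\<dots> = far D j z' (Cmp J j z z' w (Cmp J j k z u g)) y"
      by (simp only: DF(4)[OF ob(2) z(1) w(1) ug w(2) y] DF(4)[OF ob(2) k(1) z(1) k(3) z(2) y])
    also have "\<dots> = far D z z' w (far D j' z v (far D j j' e y))"
      by (simp only: w(3) DF(4)[OF ob(2) z(1) w(1) ve w(2) y] DF(4)[OF ob(2,3) z(1) e z(3) y])
    also have "\<dots> = far D j' z' (Cmp J j' z z' w v) (far D j j' e y)"
      using DF(4) C(2) ob k z w ey by simp
    finally show "merges J D i x j' (far D j j' e y)"
      unfolding merges_def
      using w(1) C(2)[OF ob(1) z(1) w(1) C(2)[OF ob(1) k(1) z(1) k(2) z(2)] w(2)]
        C(2)[OF ob(3) z(1) w(1) z(3) w(2)] by blast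
  }
qed

text \<open>Necessity of both conditions is read off from maps into a two-element set. For
  sufficiency, joint surjectivity forces the mediating map on elements and merging makes it
  single-valued.\<close>

lemma colimit_SET_iff:
  fixes U :: "'u set set"
  assumes U: "universe U" and J: "filtered J" and D: "is_functor J (SET U) D"
    and L: "cocone J (SET U) D L l"
  shows "colimit J (SET U) D L l \<longleftrightarrow> joint_surj J D L l \<and>
    (\<forall>i\<in>Ob J. \<forall>j\<in>Ob J. \<forall>x\<in>fob D i. \<forall>y\<in>fob D j. l i x = l j y \<longrightarrow> merges J D i x j y)"
    (is "?C \<longleftrightarrow> ?S \<and> ?M")
proof
  note DF = is_functor_to_SET[OF D]
  have cat: "is_category J" using J unfolding filtered_def by blast
  note coc = cocone_SET[OF D]
  have lL: "l j \<in> fob D j \<rightarrow>\<^sub>E L" if "j \<in> Ob J" for j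
    using L that unfolding coc by blast
  assume col: ?C
  obtain p q :: 'u where pq: "p \<noteq> q" "{p, q} \<in> U" using universe_two_points[OF U] .
  have univ: "\<exists>!h. h \<in> L \<rightarrow>\<^sub>E M \<and> (\<forall>j\<in>Ob J. compose (fob D j) h (l j) = m j)"
    if "cocone J (SET U) D M m" for M m
    using col that unfolding colimit_def SET_simps by blast
  have ?S unfolding joint_surj_def
  proof (rule ccontr)
    assume "\<not> (\<forall>y\<in>L. \<exists>j\<in>Ob J. \<exists>x\<in>fob D j. l j x = y)"
    then obtain y where y: "y \<in> L" "\<And>j x. j \<in> Ob J \<Longrightarrow> x \<in> fob D j \<Longrightarrow> l j x \<noteq> y" by blast
    have m: "cocone J (SET U) D {p, q} (\<lambda>j. \<lambda>_\<in>fob D j. p)"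
      unfolding coc using pq(2) DF(2) by (auto dest: PiE_mem)
    \<comment> \<open>\<open>h\<close> and the constant map agree after every \<open>l j\<close>
      because \<open>y\<close> is not attained, yet they differ at \<open>y\<close>.\<close>
    define h where "h = (\<lambda>z\<in>L. if z = y then q else p)"
    have "h \<in> L \<rightarrow>\<^sub>E {p, q} \<and> (\<forall>j\<in>Ob J. compose (fob D j) h (l j) = (\<lambda>_\<in>fob D j. p))"
      using y(2) lL by (auto simp: h_def compose_def fun_eq_iff dest: PiE_mem)
    moreover have "(\<lambda>z\<in>L. p) \<in> L \<rightarrow>\<^sub>E {p, q} \<and>
        (\<forall>j\<in>Ob J. compose (fob D j) (\<lambda>z\<in>L. p) (l j) = (\<lambda>_\<in>fob D j. p))"
      using lL by (auto simp: compose_def fun_eq_iff dest: PiE_mem)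
    ultimately have "h = (\<lambda>z\<in>L. p)" using univ[OF m] by blast
    then have "h y = p" using y(1) by simp
    then show False using y(1) pq(1) by (simp add: h_def)
  qed
  moreover have ?M
  proof (intro ballI impI)
    fix i j x y
    assume *: "i \<in> Ob J" "j \<in> Ob J" "x \<in> fob D i" "y \<in> fob D j" "l i x = l j y"
    \<comment> \<open>The characteristic map of being merged with \<open>x\<close>. As a cocone it
      factors through \<open>L\<close>, so it takes the same value at \<open>y\<close> as at
      \<open>x\<close>.\<close>
    define m where "m = (\<lambda>j. \<lambda>y\<in>fob D j. if merges J D i x j y then p else q)"
    have "cocone J (SET U) D {p, q} m"
      unfolding coc
    proof (intro conjI ballI pq(2))
      fix j assume "j \<in> Ob J"
      show "m j \<in> fob D j \<rightarrow>\<^sub>E {p, q}" by (auto simp: m_def)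
      fix k f y assume k: "k \<in> Ob J" "f \<in> Hom J j k" "y \<in> fob D j"
      then have "far D j k f y \<in> fob D k" using DF(2) \<open>j \<in> Ob J\<close> by (meson PiE_mem)
      then show "m k (far D j k f y) = m j y"
        using merges_arrow[OF J D *(1) \<open>j \<in> Ob J\<close> k(1,2) *(3) k(3)] k by (simp add: m_def)
    qed
    then obtain h where h: "\<And>j. j \<in> Ob J \<Longrightarrow> compose (fob D j) h (l j) = m j"
      using univ by blast
    have "merges J D i x i x"
      unfolding merges_def using is_categoryD(1)[OF cat *(1)] *(1) by blast
    then have "m i x = p" using *(3) by (simp add: m_def)
    moreover have "m i x = m j y" using h * by (metis compose_apply)
    ultimately have "m j y = p" by simp
    then show "merges J D i x j y" using *(4) pq(1) by (simp add: m_def split: if_splits)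
  qed
  ultimately show "?S \<and> ?M" ..
next
  note DF = is_functor_to_SET[OF D]
  note coc = cocone_SET[OF D]
  have lL: "l j \<in> fob D j \<rightarrow>\<^sub>E L" if "j \<in> Ob J" for j
    using L that unfolding coc by blast
  assume SM: "?S \<and> ?M"
  show ?C unfolding colimit_def SET_simps
  proof (intro conjI allI impI L)
    fix M m assume M: "cocone J (SET U) D M m"
    have mM: "m j \<in> fob D j \<rightarrow>\<^sub>E M" if "j \<in> Ob J" for j using M that unfolding coc by blast
    have mm: "m k (far D i k f x) = m i x"
      if "i \<in> Ob J" "k \<in> Ob J" "f \<in> Hom J i k" "x \<in> fob D i" for i k f x
      using M that unfolding coc by blast
    have wd: "m i x = m j y" if "i \<in> Ob J" "j \<in> Ob J" "x \<in> fob D i" "y \<in> fob D j" "l i x = l j y" for i j x y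
    proof -
      have "merges J D i x j y" using SM that by blast
      then show ?thesis unfolding merges_def using mm that by metis
    qed
    define h where "h = (\<lambda>z\<in>L. THE v. \<exists>j\<in>Ob J. \<exists>x\<in>fob D j. l j x = z \<and> v = m j x)"
    have hl: "h (l j x) = m j x" if "j \<in> Ob J" "x \<in> fob D j" for j x
    proof -
      have "l j x \<in> L" using lL that by (meson PiE_mem)
      moreover have "(THE v. \<exists>j'\<in>Ob J. \<exists>x'\<in>fob D j'. l j' x' = l j x \<and> v = m j' x') = m j x"
      proof (rule the_equality)
        show "\<exists>j'\<in>Ob J. \<exists>x'\<in>fob D j'. l j' x' = l j x \<and> m j x = m j' x'" using that by blast
        show "v = m j x" if v: "\<exists>j'\<in>Ob J. \<exists>x'\<in>fob D j'. l j' x' = l j x \<and> v = m j' x'" for v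
          using v wd[OF _ \<open>j \<in> Ob J\<close> _ \<open>x \<in> fob D j\<close>] by blast
      qed
      ultimately show ?thesis by (simp add: h_def)
    qed
    show "\<exists>!h. h \<in> L \<rightarrow>\<^sub>E M \<and> (\<forall>j\<in>Ob J. compose (fob D j) h (l j) = m j)"
    proof (rule ex1I[of _ h])
      have "h z \<in> M" if "z \<in> L" for z
        using SM that hl mM unfolding joint_surj_def by (metis PiE_mem)
      then have hM: "h \<in> L \<rightarrow>\<^sub>E M" by (auto simp: h_def)
      moreover have "compose (fob D j) h (l j) = m j" if "j \<in> Ob J" for j
        by (rule PiE_eqI[OF compose_PiE[OF lL[OF that] hM] mM[OF that]]) (simp add: hl that)
      ultimately show "h \<in> L \<rightarrow>\<^sub>E M \<and> (\<forall>j\<in>Ob J. compose (fob D j) h (l j) = m j)" by blast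
      fix h' assume h': "h' \<in> L \<rightarrow>\<^sub>E M \<and> (\<forall>j\<in>Ob J. compose (fob D j) h' (l j) = m j)"
      show "h' = h"
      proof (rule PiE_eqI[OF conjunct1[OF h'] hM])
        fix z assume "z \<in> L"
        then obtain j x where "j \<in> Ob J" "x \<in> fob D j" "l j x = z"
          using SM unfolding joint_surj_def by blast
        then show "h' z = h z" using h' hl by (metis compose_apply)
      qed
    qed
  qed
qed

text \<open>Filteredness brings finitely many elements to one stage; the empty list uses that
  \<open>J\<close> has an object.\<close>

lemma filtered_lift_list:
  assumes J: "filtered J" and D: "is_functor J (SET U) D" and L: "cocone J (SET U) D L l"
    and S: "joint_surj J D L l" and "x \<in> lists L"
  shows "\<exists>j\<in>Ob J. \<exists>y\<in>lists (fob D j). map (l j) y = x"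
  using \<open>x \<in> lists L\<close>
proof (induction x)
  case Nil
  then show ?case using J unfolding filtered_def by auto
next
  case (Cons a x)
  note DF = is_functor_to_SET[OF D]
  obtain i y where i: "i \<in> Ob J" "y \<in> lists (fob D i)" "map (l i) y = x"
    using Cons by auto
  obtain j b where j: "j \<in> Ob J" "b \<in> fob D j" "l j b = a"
    using Cons S unfolding joint_surj_def by blast
  obtain k f g where k: "k \<in> Ob J" "f \<in> Hom J i k" "g \<in> Hom J j k"
    using J i j unfolding filtered_def by blast
  have l: "c \<in> fob D i \<Longrightarrow> l k (far D i k f c) = l i c"
    "d \<in> fob D j \<Longrightarrow> l k (far D j k g d) = l j d" for c d
    using L[unfolded cocone_SET[OF D]] i j k by blast+
  have "map (l k) (far D j k g b # map (far D i k f) y) = a # x"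
    using l j i(2) i(3)[symmetric] by (auto simp: in_lists_conv_set)
  moreover have "far D j k g b # map (far D i k f) y \<in> lists (fob D k)"
    using PiE_mem[OF DF(2)[OF i(1) k(1,2)]] PiE_mem[OF DF(2)[OF j(1) k(1,3)]] i(2) j(2)
    by (auto simp: in_lists_conv_set)
  ultimately show ?case using k(1) by metis
qed

text \<open>Finitely many equations hold together at one later stage; the induction extends a stage
  that is good for the tail to one that is also good for the head.\<close>

lemma filtered_merge_lists:
  assumes J: "filtered J" and D: "is_functor J (SET U) D"
    and M: "\<And>i j x y. i \<in> Ob J \<Longrightarrow> j \<in> Ob J \<Longrightarrow> x \<in> fob D i \<Longrightarrow> y \<in> fob D j \<Longrightarrow> l i x = l j y \<Longrightarrow>
      merges J D i x j y"
    and ij: "i \<in> Ob J" "j \<in> Ob J"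
    and "x \<in> lists (fob D i)" "y \<in> lists (fob D j)" "map (l i) x = map (l j) y"
  shows "\<exists>k\<in>Ob J. \<exists>f\<in>Hom J i k. \<exists>g\<in>Hom J j k. map (far D i k f) x = map (far D j k g) y"
proof -
  note DF = is_functor_to_SET[OF D]
  have cat: "is_category J" using J unfolding filtered_def by blast
  note C = is_categoryD[OF cat]
  have "length x = length y" using assms(8) by (metis length_map)
  then show ?thesis using assms(6-8)
  proof (induction x y rule: list_induct2)
    case Nil
    then show ?case using J ij unfolding filtered_def by (auto simp: ex_in_conv)
  next
    case (Cons a x b y)
    then obtain k f g where k: "k \<in> Ob J" "f \<in> Hom J i k" "g \<in> Hom J j k"
      "map (far D i k f) x = map (far D j k g) y" by auto
    have ab: "a \<in> fob D i" "b \<in> fob D j" using Cons by auto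
    have "merges J D i a j b" using M ij ab Cons.prems by simp
    then have "merges J D i a k (far D j k g b)" using merges_arrow[OF J D _ _ _ k(3)] ij k ab by simp
    then obtain z u v where z: "z \<in> Ob J" "u \<in> Hom J i z" "v \<in> Hom J k z"
      "far D i z u a = far D k z v (far D j k g b)" unfolding merges_def by blast
    have vf: "Cmp J i k z v f \<in> Hom J i z" and vg: "Cmp J j k z v g \<in> Hom J j z"
      using C(2)[OF ij(1) k(1) z(1) k(2) z(3)] C(2)[OF ij(2) k(1) z(1) k(3) z(3)] .
    \<comment> \<open>The heads are merged along \<open>u\<close>, the tails along \<open>v\<close>
      after \<open>f\<close>; \<open>w\<close> makes these two arrows out of \<open>i\<close>
      equal.\<close>
    obtain z' w where w: "z' \<in> Ob J" "w \<in> Hom J z z'"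
      "Cmp J i z z' w u = Cmp J i z z' w (Cmp J i k z v f)"
      using filtered_coequalize[OF J ij(1) z(1,2) vf] by blast
    have fx: "far D i z' (Cmp J i z z' w (Cmp J i k z v f)) c = far D z z' w (far D k z v (far D i k f c))"
      if "c \<in> fob D i" for c using DF(4) that ij k z w vf by simp
    have gx: "far D j z' (Cmp J j z z' w (Cmp J j k z v g)) c = far D z z' w (far D k z v (far D j k g c))"
      if "c \<in> fob D j" for c using DF(4) that ij k z w vg by simp
    have "map (far D i z' (Cmp J i z z' w (Cmp J i k z v f))) x =
      map (\<lambda>c. far D z z' w (far D k z v c)) (map (far D i k f) x)"
      using fx Cons.prems by (auto simp: in_lists_conv_set)
    also have "\<dots> = map (far D j z' (Cmp J j z z' w (Cmp J j k z v g))) y"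
      unfolding k(4) using gx Cons.prems by (auto simp: in_lists_conv_set)
    finally have 1: "map (far D i z' (Cmp J i z z' w (Cmp J i k z v f))) x =
      map (far D j z' (Cmp J j z z' w (Cmp J j k z v g))) y" .
    have "far D i z' (Cmp J i z z' w (Cmp J i k z v f)) a = far D z z' w (far D i z u a)"
      unfolding w(3)[symmetric] using DF(4)[OF ij(1) z(1) w(1) z(2) w(2) ab(1)] .
    also have "\<dots> = far D j z' (Cmp J j z z' w (Cmp J j k z v g)) b"
      unfolding z(4) using gx[OF ab(2)] by (rule sym)
    finally have "map (far D i z' (Cmp J i z z' w (Cmp J i k z v f))) (a # x) =
      map (far D j z' (Cmp J j z z' w (Cmp J j k z v g))) (b # y)" using 1 by simp
    then show ?case
      using w(1) C(2)[OF ij(1) z(1) w(1) vf w(2)] C(2)[OF ij(2) z(1) w(1) vg w(2)] by blast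
  qed
qed

section \<open>Operads and quotients of decorated tuples\<close>

locale small_operad =
  fixes U :: "'u set set" and H :: "nat \<Rightarrow> nat \<Rightarrow> nat list set" and A :: "'u operad"
  assumes universe: "universe U" and ordinal_cat: "ordinal_cat H" and operad: "is_operad U H A"
begin

lemmas H_length = ordinal_catD(1)[OF ordinal_cat]
  and H_set = ordinal_catD(2)[OF ordinal_cat]
  and SS_H = ordinal_catD(3)[OF ordinal_cat]
  and H_id = ordinal_catD(4)[OF ordinal_cat]
  and H_comp = ordinal_catD(5)[OF ordinal_cat]
  and H_star = ordinal_cat_star[OF ordinal_cat]

lemma ops_small: "ops A n \<in> U"
  and iota_ops: "iota A \<in> ops A (Suc 0)"
  and opm_ops: "has_arities A ns bs \<Longrightarrow> a \<in> ops A (length ns) \<Longrightarrow> opm A ns bs a \<in> ops A (sum_list ns)"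
  and act_ops: "\<phi> \<in> H n m \<Longrightarrow> a \<in> ops A n \<Longrightarrow> act A m \<phi> a \<in> ops A m"
  and act_id: "a \<in> ops A n \<Longrightarrow> act A n [0..<n] a = a"
  and act_comp: "\<phi> \<in> H n m \<Longrightarrow> \<psi> \<in> H m k \<Longrightarrow> a \<in> ops A n \<Longrightarrow>
        act A k (\<psi> \<odot> \<phi>) a = act A k \<psi> (act A m \<phi> a)"
  and opm_assoc: "list_all2 (has_arities A) nss css \<Longrightarrow> has_arities A (map length nss) bs \<Longrightarrow>
        a \<in> ops A (length nss) \<Longrightarrow>
        opm A (map sum_list nss)
          (map (\<lambda>i. opm A (nss ! i) (css ! i) (bs ! i)) [0..<length nss]) a =
        opm A (concat nss) (concat css) (opm A (map length nss) bs a)"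
  and opm_iota: "a \<in> ops A n \<Longrightarrow> opm A [n] [a] (iota A) = a"
  and iota_opm: "a \<in> ops A n \<Longrightarrow> opm A (replicate n (Suc 0)) (replicate n (iota A)) a = a"
  and opm_act: "\<phi> \<in> H n m \<Longrightarrow> length \<psi>s = m \<Longrightarrow> length ks = m \<Longrightarrow> length ls = m \<Longrightarrow>
        (\<And>i. i < m \<Longrightarrow> \<psi>s ! i \<in> H (ks ! i) (ls ! i)) \<Longrightarrow> has_arities A ks bs \<Longrightarrow> a \<in> ops A n \<Longrightarrow>
        opm A ls (map (\<lambda>i. act A (ls ! i) (\<psi>s ! i) (bs ! i)) [0..<m]) (act A m \<phi> a) =
        act A (sum_list ls) (star \<psi>s ls \<phi>) (opm A (ks \<odot> \<phi>) (bs \<odot> \<phi>) a)"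
  using operad unfolding is_operad_def One_nat_def by ((elim conjE, blast) | metis)+

end

section \<open>The equivalence relation generated by gluing\<close>

lemma glue_eq_refl [simp]: "(p, p) \<in> glue_eq A K P"
  by (simp add: glue_eq_def)

lemma glue_eq_sym: "(p, q) \<in> glue_eq A K P \<Longrightarrow> (q, p) \<in> glue_eq A K P"
  unfolding glue_eq_def by (rule symD[OF sym_rtrancl[OF sym_Un_converse]])

lemma glue_eq_trans: "(p, q) \<in> glue_eq A K P \<Longrightarrow> (q, r) \<in> glue_eq A K P \<Longrightarrow> (p, r) \<in> glue_eq A K P"
  unfolding glue_eq_def by (rule rtrancl_trans)

lemma glue_eq_class_iff: "glue_eq A K P `` {p} = glue_eq A K P `` {q} \<longleftrightarrow> (p, q) \<in> glue_eq A K P"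
  by (metis (no_types, lifting) Image_singleton_iff equalityI glue_eq_refl glue_eq_sym glue_eq_trans subsetI)

lemma glue_subset_glue_eq: "glue A K P \<subseteq> glue_eq A K P"
  unfolding glue_eq_def by blast

lemma glueI:
  "x \<in> P \<Longrightarrow> \<phi> \<in> K n (length x) \<Longrightarrow> a \<in> ops A n \<Longrightarrow>
    ((x \<odot> \<phi>, a), (x, act A (length x) \<phi> a)) \<in> glue_eq A K P"
  by (rule subsetD[OF glue_subset_glue_eq], unfold glue_def mem_Collect_eq,
      rule exI[of _ x], rule exI[of _ \<phi>], rule exI[of _ a], rule exI[of _ n]) simp

text \<open>A chain may use a generator in either direction, hence two step cases; they call for
  different arguments in \<open>finitary_T\<close>.\<close>

lemma glue_eq_induct [consumes 1, case_names refl glue unglue]: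
  assumes "(p, q) \<in> glue_eq A K P" and "Q p"
    and "\<And>x \<phi> a n. x \<in> P \<Longrightarrow> \<phi> \<in> K n (length x) \<Longrightarrow> a \<in> ops A n \<Longrightarrow> Q (x \<odot> \<phi>, a) \<Longrightarrow>
      Q (x, act A (length x) \<phi> a)"
    and "\<And>x \<phi> a n. x \<in> P \<Longrightarrow> \<phi> \<in> K n (length x) \<Longrightarrow> a \<in> ops A n \<Longrightarrow>
      Q (x, act A (length x) \<phi> a) \<Longrightarrow> Q (x \<odot> \<phi>, a)"
  shows "Q q"
  using assms(1) unfolding glue_eq_def
proof (induction rule: rtrancl_induct)
  case (step q r)
  from step(2) show ?case
  proof
    assume "(q, r) \<in> glue A K P"
    then obtain x \<phi> a n where "q = (x \<odot> \<phi>, a)" "r = (x, act A (length x) \<phi> a)"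
      "x \<in> P" "\<phi> \<in> K n (length x)" "a \<in> ops A n" unfolding glue_def by auto
    with step(3) assms(3) show "Q r" by metis
  next
    assume "(q, r) \<in> (glue A K P)\<inverse>"
    then obtain x \<phi> a n where "r = (x \<odot> \<phi>, a)" "q = (x, act A (length x) \<phi> a)"
      "x \<in> P" "\<phi> \<in> K n (length x)" "a \<in> ops A n" unfolding glue_def by auto
    with step(3) assms(4) show "Q r" by metis
  qed
qed (rule assms(2))

text \<open>Tuples of ordinals and sets of classes do not live in \<open>'u\<close>, so smallness is
  measured by an injection into a member of \<open>U\<close>.\<close>

definition small :: "'u set set \<Rightarrow> 'x set \<Rightarrow> bool" where
  "small U X \<longleftrightarrow> (\<exists>V\<in>U. X \<lesssim> V)"

lemma small_member: "X \<in> U \<Longrightarrow> small U X"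
  unfolding small_def by blast

lemma small_finite: "universe U \<Longrightarrow> finite X \<Longrightarrow> small U X"
  unfolding small_def using universe_infinite finite_lepoll_infinite by metis

context small_operad
begin

text \<open>A class is named by a tuple and an operation, and over an infinite small set both lists
  and pairs can be coded by single elements.\<close>

lemma small_classes:
  fixes P :: "'x list set"
  assumes "small U X" "P \<subseteq> lists X"
  shows "small U (classes A K P)"
proof -
  obtain V where V: "V \<in> U" "X \<lesssim> V" using assms(1) unfolding small_def by blast
  obtain Z where Z: "Z \<in> U" "infinite Z" using universe_infinite[OF universe] .
  \<comment> \<open>\<open>V\<close> houses the entries, the last union all operations, and
    \<open>Z\<close> makes the set infinite so that lists and pairs inject into it.\<close>
  define Y where "Y = V \<union> Z \<union> (\<Union>n. ops A n)"
  have Y: "Y \<in> U" unfolding Y_def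
    by (intro universe_Un universe_UN_nat universe ops_small V Z)
  have inf: "infinite Y" using Z(2) by (simp add: Y_def)
  have "X \<lesssim> Y" using V(2) subset_imp_lepoll[of V Y] lepoll_trans unfolding Y_def by blast
  then obtain e where e: "inj_on e X" "e ` X \<subseteq> Y" unfolding lepoll_def by blast
  have "inj_on (map e) (lists X)"
    by (rule inj_onI) (metis e(1) inj_on_map_eq_map inj_on_subset in_lists_conv_set subsetI Un_iff)
  moreover have "map e ` lists X \<subseteq> lists Y" using e(2) by (auto simp: image_subset_iff)
  ultimately have "lists X \<lesssim> lists Y" unfolding lepoll_def by blast
  then have X: "lists X \<lesssim> Y" using infinite_lists_lepoll[OF inf] lepoll_trans by blast
  have "pairs A P \<subseteq> lists X \<times> Y"
    using assms(2) by (auto simp: pairs_def Y_def)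
  then have "pairs A P \<lesssim> lists X \<times> Y" by (rule subset_imp_lepoll)
  also have "lists X \<times> Y \<lesssim> Y \<times> Y" using X by (intro times_lepoll_mono lepoll_refl)
  also have "Y \<times> Y \<lesssim> Y" by (rule infinite_Times_lepoll[OF inf])
  finally have "pairs A P \<lesssim> Y" .
  moreover have "classes A K P \<lesssim> pairs A P"
    unfolding classes_def quotient_def by (rule subset_image_lepoll[of _ "\<lambda>p. glue_eq A K P `` {p}"]) auto
  ultimately have "classes A K P \<lesssim> Y" using lepoll_trans by blast
  with Y show ?thesis unfolding small_def by blast
qed

text \<open>Smallness guarantees that some injection into \<open>'u\<close> exists, so the one
  chosen by \<open>encode\<close> is injective and equality of codes is equality of classes.\<close>

lemma encode_inj:
  assumes "small U C" shows "inj_on (encode C :: _ \<Rightarrow> 'u) C"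
proof -
  obtain e :: "_ \<Rightarrow> 'u" where "inj_on e C"
    using assms unfolding small_def lepoll_def by blast
  then show ?thesis unfolding encode_def by (rule someI[of "\<lambda>e. inj_on e C"])
qed

lemma tensor_small:
  assumes "small U X" "P \<subseteq> lists X" shows "tensor A K P \<in> U"
proof -
  obtain V where "V \<in> U" "classes A K P \<lesssim> V"
    using small_classes[OF assms] unfolding small_def by blast
  moreover have "tensor A K P \<lesssim> classes A K P" unfolding tensor_def by (rule image_lepoll)
  ultimately show ?thesis using universe_lepoll[OF universe] lepoll_trans by blast
qed

lemma cls_eq_iff:
  assumes "small U X" "P \<subseteq> lists X" "(x, a) \<in> pairs A P" "(y, b) \<in> pairs A P"
  shows "cls A K P x a = cls A K P y b \<longleftrightarrow> ((x, a), (y, b)) \<in> glue_eq A K P"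
proof -
  have "inj_on (encode (classes A K P) :: _ \<Rightarrow> 'u) (classes A K P)"
    by (rule encode_inj[OF small_classes[OF assms(1,2)]])
  moreover have "glue_eq A K P `` {(x, a)} \<in> classes A K P" "glue_eq A K P `` {(y, b)} \<in> classes A K P"
    using assms(3,4) unfolding classes_def by (auto intro: quotientI)
  ultimately show ?thesis
    unfolding cls_def by (metis glue_eq_class_iff inj_on_def)
qed

end

lemma tensor_eq: "tensor A K P = {cls A K P x a | x a. (x, a) \<in> pairs A P}"
  by (auto simp: tensor_def classes_def cls_def quotient_def image_iff)

lemma pairs_lists_iff: "(x, a) \<in> pairs A (lists X) \<longleftrightarrow> set x \<subseteq> X \<and> a \<in> ops A (length x)"
  by (auto simp: pairs_def)

lemma pairs_inj_lists_iff:
  "(x, a) \<in> pairs A (inj_lists X) \<longleftrightarrow> set x \<subseteq> X \<and> distinct x \<and> a \<in> ops A (length x)"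
  by (auto simp: pairs_def inj_lists_def)

text \<open>Equality of the normal forms obtained by surjection--injection factorization. It agrees
  with \<open>glue_eq\<close> both for \<open>BB\<close> on injective tuples and for \<open>SS\<close> on all tuples, which is why
  \<open>Mr\<close> and \<open>Po\<close> can be computed on representatives that are not injective.\<close>

definition req :: "'u operad \<Rightarrow> 'x list \<Rightarrow> 'u \<Rightarrow> 'x list \<Rightarrow> 'u \<Rightarrow> bool" where
  "req A x a y b \<longleftrightarrow> (\<exists>z \<alpha> \<beta>. distinct z \<and> x = z \<odot> \<alpha> \<and> y = z \<odot> \<beta> \<and>
     \<alpha> \<in> SS (length x) (length z) \<and> \<beta> \<in> SS (length y) (length z) \<and>
     act A (length z) \<alpha> a = act A (length z) \<beta> b)"

text \<open>The canonical map from the quotient of all tuples by surjections to the quotient of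
  injective tuples by bijections; it gives a class to a tuple with repetitions.\<close>

definition rc :: "'u operad \<Rightarrow> 'x set \<Rightarrow> 'x list \<Rightarrow> 'u \<Rightarrow> 'u" where
  "rc A X x a = cls A BB (inj_lists X) (remdups x) (act A (length (remdups x)) (surj_part x) a)"

lemma req_sym: "req A x a y b \<Longrightarrow> req A y b x a"
  unfolding req_def by metis

text \<open>Surjections neither add nor lose entries, so an element of the regular quotient has a
  support. Gluing along arbitrary functions has no such invariant.\<close>

lemma req_set: "req A x a y b \<Longrightarrow> set x = set y"
  unfolding req_def SS_iff by (metis set_tcomp_surj)

lemma req_map:
  assumes "req A x a y b" "inj_on f (set x)" shows "req A (map f x) a (map f y) b"
proof -
  obtain z \<alpha> \<beta> where z: "distinct z" "x = z \<odot> \<alpha>" "y = z \<odot> \<beta>"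
    "\<alpha> \<in> SS (length x) (length z)" "\<beta> \<in> SS (length y) (length z)"
    "act A (length z) \<alpha> a = act A (length z) \<beta> b" using assms(1) unfolding req_def by blast
  then have "set z = set x" "map f x = map f z \<odot> \<alpha>" "map f y = map f z \<odot> \<beta>"
    using set_tcomp_surj[of \<alpha> z] map_tcomp[of \<alpha> z f] map_tcomp[of \<beta> z f] by (auto simp: SS_iff)
  moreover from this have "distinct (map f z)" using z(1) assms(2) by (simp add: distinct_map)
  ultimately show ?thesis
    unfolding req_def using z by (intro exI[of _ "map f z"] exI[of _ \<alpha>] exI[of _ \<beta>]) simp
qed

text \<open>Undoing \<open>f\<close> on the finitely many entries involved carries the common
  factorization back. This is why the functor of a regular operad preserves monomorphisms.\<close>

lemma req_map_cancel:
  assumes "req A (map f x) a (map f y) b" "inj_on f (set x \<union> set y)" shows "req A x a y b"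
proof -
  let ?g = "inv_into (set x \<union> set y) f"
  have "inj_on ?g (set (map f x))" by (rule inj_on_inv_into) auto
  then have "req A (map ?g (map f x)) a (map ?g (map f y)) b" using req_map[OF assms(1)] by blast
  moreover have "map ?g (map f x) = x" "map ?g (map f y) = y"
    using assms(2) by (auto intro!: map_idI)
  ultimately show ?thesis by simp
qed

locale regular_operad = small_operad U SS A
  for U :: "'u set set" and A :: "'u operad"
begin

lemma req_refl: "req A x a x a"
  unfolding req_def using surj_part_eq[of x] surj_part_SS[of x]
  by (intro exI[of _ "remdups x"] exI[of _ "surj_part x"]) simp

text \<open>Precomposing the factorization of \<open>x\<close> with \<phi> factors
  \<open>x \<odot> \<phi>\<close> over the same injective tuple; functoriality of the action
  compares the operations.\<close>

lemma req_tcomp: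
  assumes "\<phi> \<in> SS n (length x)" "a \<in> ops A n"
  shows "req A (x \<odot> \<phi>) a x (act A (length x) \<phi> a)"
proof -
  let ?z = "remdups x" and ?s = "surj_part x"
  have s: "?s \<in> SS (length x) (length ?z)" by (rule surj_part_SS)
  have "?z \<odot> (?s \<odot> \<phi>) = x \<odot> \<phi>"
    using s assms(1) tcomp_assoc[of \<phi> ?s ?z] by (simp add: surj_part_eq SS_iff)
  moreover have "?s \<odot> \<phi> \<in> SS n (length ?z)" using H_comp[OF assms(1) s] .
  moreover have "act A (length ?z) (?s \<odot> \<phi>) a = act A (length ?z) ?s (act A (length x) \<phi> a)"
    by (rule act_comp[OF assms(1) s assms(2)])
  ultimately show ?thesis
    unfolding req_def using s assms(1)
    by (intro exI[of _ ?z] exI[of _ "?s \<odot> \<phi>"] exI[of _ ?s]) (simp add: surj_part_eq SS_iff)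
qed

text \<open>The two factorizations of the middle tuple \<open>y\<close> have injective parts that
  differ by a permutation \<sigma>; transport along \<sigma> puts all three tuples over
  \<open>z\<close>.\<close>

lemma req_trans:
  assumes xy: "req A x a y b" and yw: "req A y b w c"
    and ops: "a \<in> ops A (length x)" "b \<in> ops A (length y)" "c \<in> ops A (length w)"
  shows "req A x a w c"
proof -
  obtain z \<alpha> \<beta> where z: "distinct z" "x = z \<odot> \<alpha>" "y = z \<odot> \<beta>"
    "\<alpha> \<in> SS (length x) (length z)" "\<beta> \<in> SS (length y) (length z)"
    "act A (length z) \<alpha> a = act A (length z) \<beta> b" using xy unfolding req_def by blast
  obtain z' \<beta>' \<gamma> where z': "distinct z'" "y = z' \<odot> \<beta>'" "w = z' \<odot> \<gamma>"
    "\<beta>' \<in> SS (length y) (length z')" "\<gamma> \<in> SS (length w) (length z')"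
    "act A (length z') \<beta>' b = act A (length z') \<gamma> c" using yw unfolding req_def by blast
  have "set z = set z'" using z z' set_tcomp_surj unfolding SS_iff by metis
  then obtain \<sigma> where \<sigma>: "\<sigma> \<in> BB (length z') (length z)" "z' = z \<odot> \<sigma>"
    using distinct_same_set[OF z(1) z'(1)] by blast
  have \<sigma>S: "\<sigma> \<in> SS (length z') (length z)" using \<sigma>(1) by (simp add: BB_iff SS_iff)
  have comp: "\<sigma> \<odot> \<beta>' \<in> SS (length y) (length z)" "\<sigma> \<odot> \<gamma> \<in> SS (length w) (length z)"
    using H_comp z' \<sigma>S by blast+
  have len: "length \<sigma> = length z'" using \<sigma>S by (simp add: SS_iff)
  have "set \<beta>' \<subseteq> {..<length \<sigma>}" "set \<gamma> \<subseteq> {..<length \<sigma>}"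
    using z'(4,5) unfolding len SS_iff by simp_all
  from this[THEN tcomp_assoc, of z] have "z \<odot> (\<sigma> \<odot> \<beta>') = y" "z \<odot> (\<sigma> \<odot> \<gamma>) = w"
    unfolding \<sigma>(2)[symmetric] z'(2)[symmetric] z'(3)[symmetric] .
  \<comment> \<open>Both are surjective factors of \<open>y\<close> over the same injective tuple
    \<open>z\<close>.\<close>
  moreover have "\<beta> = \<sigma> \<odot> \<beta>'"
    using z(3,5) comp(1) calculation(1) by (intro tcomp_cancel[OF z(1)]) (auto simp: SS_iff)
  moreover have "act A (length z) (\<sigma> \<odot> \<beta>') b = act A (length z) (\<sigma> \<odot> \<gamma>) c"
    using act_comp[OF z'(4) \<sigma>S ops(2)] act_comp[OF z'(5) \<sigma>S ops(3)] z'(6) by simp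
  ultimately show ?thesis
    unfolding req_def using z comp by metis
qed

text \<open>Formulated for any class of surjections and any set of tuples closed under it, to cover
  \<open>SS\<close> on all tuples and \<open>BB\<close> on injective ones at once.\<close>

lemma glue_eq_req:
  assumes K: "\<And>n m \<phi>. \<phi> \<in> K n m \<Longrightarrow> \<phi> \<in> SS n m"
    and P: "\<And>x n \<phi>. x \<in> P \<Longrightarrow> \<phi> \<in> K n (length x) \<Longrightarrow> x \<odot> \<phi> \<in> P"
    and p: "p \<in> pairs A P" and "(p, q) \<in> glue_eq A K P"
  shows "q \<in> pairs A P \<and> req A (fst p) (snd p) (fst q) (snd q)"
  using assms(4)
proof (induction rule: glue_eq_induct)
  case refl
  then show ?case using p req_refl by simp
next
  case (glue x \<phi> a n)
  then have "act A (length x) \<phi> a \<in> ops A (length x)" using K act_ops by blast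
  moreover have "a \<in> ops A (length (x \<odot> \<phi>))" using glue K by (simp add: SS_iff)
  ultimately show ?case
    using glue p req_trans[OF _ req_tcomp[OF K]] by (auto simp: pairs_def)
next
  case (unglue x \<phi> a n)
  then have "act A (length x) \<phi> a \<in> ops A (length x)" using K act_ops by blast
  moreover have "a \<in> ops A (length (x \<odot> \<phi>))" using unglue K by (simp add: SS_iff)
  ultimately show ?case
    using unglue p P req_trans[OF _ req_sym[OF req_tcomp[OF K]]] by (auto simp: pairs_def)
qed

text \<open>For the converse of invariance, both pairs are glued to the one pair over the common
  injective tuple \<open>z\<close>.\<close>

lemma glue_eq_SS_iff:
  assumes "(x, a) \<in> pairs A (lists X)" "(y, b) \<in> pairs A (lists X)"
  shows "((x, a), (y, b)) \<in> glue_eq A SS (lists X) \<longleftrightarrow> req A x a y b"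
proof
  assume *: "((x, a), (y, b)) \<in> glue_eq A SS (lists X)"
  have "x \<odot> \<phi> \<in> lists X" if "x \<in> lists X" "\<phi> \<in> SS n (length x)" for x \<phi> n
    using that set_tcomp_surj[of \<phi> x] by (auto simp: SS_iff)
  from glue_eq_req[OF _ this assms(1) *] show "req A x a y b" by simp
next
  assume r: "req A x a y b"
  obtain z \<alpha> \<beta> where z: "distinct z" "x = z \<odot> \<alpha>" "y = z \<odot> \<beta>"
    "\<alpha> \<in> SS (length x) (length z)" "\<beta> \<in> SS (length y) (length z)"
    "act A (length z) \<alpha> a = act A (length z) \<beta> b" using r unfolding req_def by blast
  have "z \<in> lists X"
    using assms(1) z(2,4) set_tcomp_surj[of \<alpha> z] by (auto simp: SS_iff pairs_lists_iff)
  from glueI[where K = SS, OF this z(4), of a A] glueI[where K = SS, OF this z(5), of b A] assms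
  show "((x, a), (y, b)) \<in> glue_eq A SS (lists X)"
    unfolding z(6) z(2,3)[symmetric] pairs_lists_iff by (blast intro: glue_eq_trans glue_eq_sym)
qed

text \<open>As for \<open>SS\<close>, but now the factors over \<open>z\<close> are bijections
  because the tuples are injective, so the gluings stay inside \<open>BB\<close>.\<close>

lemma glue_eq_BB_iff:
  assumes "(x, a) \<in> pairs A (inj_lists X)" "(y, b) \<in> pairs A (inj_lists X)"
  shows "((x, a), (y, b)) \<in> glue_eq A BB (inj_lists X) \<longleftrightarrow> req A x a y b"
proof
  assume *: "((x, a), (y, b)) \<in> glue_eq A BB (inj_lists X)"
  have "x \<odot> \<phi> \<in> inj_lists X" if "x \<in> inj_lists X" "\<phi> \<in> BB n (length x)" for x \<phi> n
    using that set_tcomp_surj[of \<phi> x] by (auto simp: inj_lists_iff BB_iff distinct_tcomp)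
  from glue_eq_req[OF _ this assms(1) *] show "req A x a y b"
    by (auto simp: BB_iff SS_iff)
next
  assume r: "req A x a y b"
  obtain z \<alpha> \<beta> where z: "distinct z" "x = z \<odot> \<alpha>" "y = z \<odot> \<beta>"
    "\<alpha> \<in> SS (length x) (length z)" "\<beta> \<in> SS (length y) (length z)"
    "act A (length z) \<alpha> a = act A (length z) \<beta> b" using r unfolding req_def by blast
  have Z: "z \<in> inj_lists X"
    using assms(1) z(1,2,4) set_tcomp_surj[of \<alpha> z] by (auto simp: SS_iff pairs_inj_lists_iff inj_lists_iff)
  have B: "\<alpha> \<in> BB (length x) (length z)" "\<beta> \<in> BB (length y) (length z)"
    using assms distinct_factor_BB z(2-5) by (auto simp: pairs_inj_lists_iff)
  from glueI[where K = BB, OF Z B(1), of a A] glueI[where K = BB, OF Z B(2), of b A] assms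
  show "((x, a), (y, b)) \<in> glue_eq A BB (inj_lists X)"
    unfolding z(6) z(2,3)[symmetric] pairs_inj_lists_iff by (blast intro: glue_eq_trans glue_eq_sym)
qed

lemma inj_lists_subset: "inj_lists X \<subseteq> lists X"
  by (auto simp: inj_lists_def)

lemma normal_form:
  assumes "(x, a) \<in> pairs A (lists X)"
  shows "(remdups x, act A (length (remdups x)) (surj_part x) a) \<in> pairs A (inj_lists X)"
    "req A x a (remdups x) (act A (length (remdups x)) (surj_part x) a)"
  using assms act_ops[OF surj_part_SS, of a x] req_tcomp[OF surj_part_SS, of a x]
  by (simp_all add: pairs_inj_lists_iff pairs_lists_iff surj_part_eq)

lemma cls_BB_eq_iff:
  assumes "small U X" "(x, a) \<in> pairs A (inj_lists X)" "(y, b) \<in> pairs A (inj_lists X)"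
  shows "cls A BB (inj_lists X) x a = cls A BB (inj_lists X) y b \<longleftrightarrow> req A x a y b"
  using cls_eq_iff[OF assms(1) inj_lists_subset assms(2,3)] glue_eq_BB_iff[OF assms(2,3)] by simp

lemma rc_eq_iff:
  assumes "small U X" "(x, a) \<in> pairs A (lists X)" "(y, b) \<in> pairs A (lists X)"
  shows "rc A X x a = rc A X y b \<longleftrightarrow> req A x a y b"
  unfolding rc_def
  using cls_BB_eq_iff[OF assms(1) normal_form(1)[OF assms(2)] normal_form(1)[OF assms(3)]]
    normal_form[OF assms(2)] normal_form[OF assms(3)] assms(2,3)
  by (metis pairs_inj_lists_iff pairs_lists_iff req_sym req_trans)

lemma rc_distinct:
  assumes "small U X" "(x, a) \<in> pairs A (inj_lists X)"
  shows "rc A X x a = cls A BB (inj_lists X) x a"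
proof -
  have "(x, a) \<in> pairs A (lists X)" using assms(2) by (simp add: pairs_lists_iff pairs_inj_lists_iff)
  from cls_BB_eq_iff[OF assms(1) normal_form(1)[OF this] assms(2)] normal_form(2)[OF this]
  show ?thesis unfolding rc_def by (simp add: req_sym)
qed

text \<open>The quotient is formed with bijections only; extended to all tuples by
  \<open>rc\<close>, its classes obey the gluing relation for every surjection.\<close>

lemma rc_tcomp:
  assumes "small U X" "set x \<subseteq> X" "\<phi> \<in> SS n (length x)" "a \<in> ops A n"
  shows "rc A X (x \<odot> \<phi>) a = rc A X x (act A (length x) \<phi> a)"
  using assms act_ops[OF assms(3,4)] set_tcomp_surj[of \<phi> x]
  by (subst rc_eq_iff[OF assms(1)]) (auto simp: pairs_lists_iff req_tcomp SS_iff)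

lemma tensor_rc:
  assumes "small U X"
  shows "tensor A BB (inj_lists X) = {rc A X x a | x a. set x \<subseteq> X \<and> a \<in> ops A (length x)}"
proof
  show "tensor A BB (inj_lists X) \<subseteq> {rc A X x a | x a. set x \<subseteq> X \<and> a \<in> ops A (length x)}"
  proof
    fix q assume "q \<in> tensor A BB (inj_lists X)"
    then obtain x a where xa: "(x, a) \<in> pairs A (inj_lists X)" "q = cls A BB (inj_lists X) x a"
      unfolding tensor_eq by blast
    show "q \<in> {rc A X x a | x a. set x \<subseteq> X \<and> a \<in> ops A (length x)}"
      using xa(1) rc_distinct[OF assms xa(1)] unfolding xa(2) pairs_inj_lists_iff
      by (intro CollectI exI[of _ x] exI[of _ a]) simp
  qed
  show "{rc A X x a | x a. set x \<subseteq> X \<and> a \<in> ops A (length x)} \<subseteq> tensor A BB (inj_lists X)"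
  proof
    fix q assume "q \<in> {rc A X x a | x a. set x \<subseteq> X \<and> a \<in> ops A (length x)}"
    then obtain x a where "(x, a) \<in> pairs A (lists X)" "q = rc A X x a"
      unfolding pairs_lists_iff by blast
    with normal_form(1) show "q \<in> tensor A BB (inj_lists X)"
      unfolding tensor_eq rc_def by blast
  qed
qed

end

section \<open>Monads of decorated tuples\<close>

lemma has_arities_map: "has_arities A (map f L) (map g L) \<longleftrightarrow> (\<forall>p\<in>set L. g p \<in> ops A (f p))"
  by (auto simp: has_arities_def list_all2_map1 list_all2_map2 list_all2_same)

text \<open>Indexing the families by the entries of \<open>L\<close>, instead of using parallel
  lists, turns reindexing along \<phi> into \<open>map\<close> followed by
  \<open>tcomp\<close>.\<close>

lemma concat_star_list:
  assumes "set \<phi> \<subseteq> {..<length L}" "\<And>p. p \<in> set L \<Longrightarrow> set (\<psi> p) \<subseteq> {..<length (w p)}"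
  shows "concat (map w L) \<odot> star (map \<psi> L) (map (\<lambda>p. length (w p)) L) \<phi> =
    concat (map (\<lambda>p. w p \<odot> \<psi> p) L \<odot> \<phi>)"
proof -
  have "concat (map w L) \<odot> star (map \<psi> L) (map (\<lambda>p. length (w p)) L) \<phi> =
      concat (map (\<lambda>j. map w L ! j \<odot> map \<psi> L ! j) \<phi>)"
    using assms by (intro concat_star) (simp_all add: comp_def)
  also have "map (\<lambda>j. map w L ! j \<odot> map \<psi> L ! j) \<phi> = map (\<lambda>p. w p \<odot> \<psi> p) L \<odot> \<phi>"
    using assms(1) by (auto simp: tcomp_def subset_iff)
  finally show ?thesis .
qed

context small_operad
begin

lemma opm_act_list:
  assumes \<phi>: "\<phi> \<in> H n (length L)" and a: "a \<in> ops A n"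
    and L: "\<And>p. p \<in> set L \<Longrightarrow> \<psi> p \<in> H (k p) (l p) \<and> b p \<in> ops A (k p)"
  shows "opm A (map l L) (map (\<lambda>p. act A (l p) (\<psi> p) (b p)) L) (act A (length L) \<phi> a) =
    act A (sum_list (map l L)) (star (map \<psi> L) (map l L) \<phi>) (opm A (map k L \<odot> \<phi>) (map b L \<odot> \<phi>) a)"
proof -
  have "map (\<lambda>i. act A (map l L ! i) (map \<psi> L ! i) (map b L ! i)) [0..<length L] =
      map (\<lambda>p. act A (l p) (\<psi> p) (b p)) L"
    by (rule nth_equalityI) auto
  then show ?thesis
    using opm_act[OF \<phi>, of "map \<psi> L" "map k L" "map l L" "map b L" a] L a
    by (simp add: has_arities_map)
qed

lemma opm_ops_list:
  assumes "\<And>p. p \<in> set L \<Longrightarrow> b p \<in> ops A (k p)" "a \<in> ops A (length L)"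
  shows "opm A (map k L) (map b L) a \<in> ops A (sum_list (map k L))"
  using assms by (intro opm_ops) (auto simp: has_arities_map)

lemma opm_assoc_list:
  assumes L: "\<And>p. p \<in> set L \<Longrightarrow> b p \<in> ops A (length (qs p)) \<and> (\<forall>q\<in>set (qs p). c q \<in> ops A (n q))"
    and a: "a \<in> ops A (length L)"
  shows "opm A (map (\<lambda>p. sum_list (map n (qs p))) L) (map (\<lambda>p. opm A (map n (qs p)) (map c (qs p)) (b p)) L) a =
    opm A (map n (concat (map qs L))) (map c (concat (map qs L)))
      (opm A (map (\<lambda>p. length (qs p)) L) (map b L) a)"
proof -
  let ?ns = "map (\<lambda>p. map n (qs p)) L" and ?cs = "map (\<lambda>p. map c (qs p)) L"
  have "map (\<lambda>i. opm A (?ns ! i) (?cs ! i) (map b L ! i)) [0..<length L] =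
      map (\<lambda>p. opm A (map n (qs p)) (map c (qs p)) (b p)) L"
    by (rule nth_equalityI) auto
  moreover have "list_all2 (has_arities A) ?ns ?cs"
    using L by (auto simp: list_all2_map1 list_all2_map2 list_all2_same has_arities_map)
  moreover have "has_arities A (map length ?ns) (map b L)"
    using L by (simp add: comp_def has_arities_map)
  ultimately show ?thesis
    using opm_assoc[of ?ns ?cs "map b L" a] a by (simp add: comp_def map_concat)
qed

end

text \<open>The common form of \<open>Mf\<close> (with \<open>H = FF\<close>) and \<open>Mr\<close> (with \<open>H = SS\<close>): \<open>ob X\<close> is a copy of the
  coend of \<open>X\<^sup>n \<times> A\<^sub>n\<close> over \<open>H\<close>.\<close>

locale tuple_quotient = small_operad U H A
  for U :: "'u set set" and H and A :: "'u operad" +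
  fixes ob :: "'u set \<Rightarrow> 'u set" and cl :: "'u set \<Rightarrow> 'u list \<Rightarrow> 'u \<Rightarrow> 'u"
  assumes ob_eq: "X \<in> U \<Longrightarrow> ob X = (\<lambda>(x, a). cl X x a) ` pairs A (lists X)"
    and ob_small: "X \<in> U \<Longrightarrow> ob X \<in> U"
    and cl_eq_iff: "X \<in> U \<Longrightarrow> (x, a) \<in> pairs A (lists X) \<Longrightarrow> (y, b) \<in> pairs A (lists X) \<Longrightarrow>
      cl X x a = cl X y b \<longleftrightarrow> ((x, a), (y, b)) \<in> glue_eq A H (lists X)"
begin

definition pc :: "'u set \<Rightarrow> 'u list \<times> 'u \<Rightarrow> 'u" where
  "pc X = (\<lambda>(x, a). cl X x a)"

text \<open>The multiplication on representatives: a list of decorated tuples under an outer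
  operation \<open>t\<close>. That it depends only on the class of the nested data is
  \<open>conc_wd\<close>.\<close>

definition conc :: "'u set \<Rightarrow> ('u list \<times> 'u) list \<Rightarrow> 'u \<Rightarrow> 'u" where
  "conc X ps t = cl X (concat (map fst ps)) (opm A (map (\<lambda>p. length (fst p)) ps) (map snd ps) t)"

lemma pc_simp [simp]: "pc X (x, a) = cl X x a"
  by (simp add: pc_def)

lemma ob_pc: "X \<in> U \<Longrightarrow> ob X = pc X ` pairs A (lists X)"
  by (simp add: ob_eq pc_def)

lemma cl_in_ob: "X \<in> U \<Longrightarrow> (x, a) \<in> pairs A (lists X) \<Longrightarrow> cl X x a \<in> ob X"
  by (force simp: ob_eq)

lemma ob_cases:
  assumes "q \<in> ob X" "X \<in> U"
  obtains x a where "(x, a) \<in> pairs A (lists X)" "q = cl X x a"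
  using assms by (auto simp: ob_eq)

lemma ob_list_cases:
  assumes "set qs \<subseteq> ob X" "X \<in> U"
  obtains ps where "set ps \<subseteq> pairs A (lists X)" "qs = map (pc X) ps"
proof -
  have "qs \<in> lists (pc X ` pairs A (lists X))" using assms by (auto simp: ob_pc)
  then have "qs \<in> map (pc X) ` lists (pairs A (lists X))" by (simp only: lists_image)
  then show ?thesis by (elim imageE) (rule that, auto)
qed

lemma ob_ob_cases:
  assumes "Q \<in> ob (ob X)" "X \<in> U"
  obtains ps t where "set ps \<subseteq> pairs A (lists X)" "t \<in> ops A (length ps)"
    "Q = cl (ob X) (map (pc X) ps) t"
proof -
  obtain qs t where qs: "(qs, t) \<in> pairs A (lists (ob X))" "Q = cl (ob X) qs t"
    using ob_cases[OF assms(1) ob_small[OF assms(2)]] .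
  then have "set qs \<subseteq> ob X" by (simp add: pairs_lists_iff)
  from ob_list_cases[OF this assms(2)] obtain ps where "set ps \<subseteq> pairs A (lists X)" "qs = map (pc X) ps" .
  with qs show ?thesis by (intro that[of ps t]) (simp_all add: pairs_lists_iff)
qed

lemma map_pc_pairs:
  assumes "X \<in> U" "set ps \<subseteq> pairs A (lists X)" "t \<in> ops A (length ps)"
  shows "(map (pc X) ps, t) \<in> pairs A (lists (ob X))"
  using assms by (auto simp: pairs_lists_iff ob_pc)

lemma conc_pairs:
  assumes "set ps \<subseteq> pairs A (lists X)" "t \<in> ops A (length ps)"
  shows "(concat (map fst ps), opm A (map (\<lambda>p. length (fst p)) ps) (map snd ps) t) \<in> pairs A (lists X)"
proof -
  have "opm A (map (\<lambda>p. length (fst p)) ps) (map snd ps) t \<in> ops A (sum_list (map (\<lambda>p. length (fst p)) ps))"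
    using assms by (intro opm_ops_list) (auto simp: pairs_def)
  with assms(1) show ?thesis
    by (auto simp: pairs_lists_iff length_concat comp_def) (auto simp: pairs_def)
qed

lemma cl_tcomp:
  assumes "X \<in> U" "set x \<subseteq> X" "\<phi> \<in> H n (length x)" "a \<in> ops A n"
  shows "cl X (x \<odot> \<phi>) a = cl X x (act A (length x) \<phi> a)"
proof -
  have "x \<in> lists X" using assms(2) by auto
  from glueI[where K = H, OF this assms(3,4)] show ?thesis
    using assms act_ops[OF assms(3,4)] H_length[OF assms(3)] H_set[OF assms(3)] set_tcomp_subset[of \<phi> x]
    by (subst cl_eq_iff) (auto simp: pairs_lists_iff)
qed

text \<open>The universal property of the coend: whatever respects each generating gluing is
  constant along chains of them.\<close>

lemma cl_lift:
  assumes "X \<in> U" "(x, a) \<in> pairs A (lists X)" "(y, b) \<in> pairs A (lists X)" "cl X x a = cl X y b"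
    and G: "\<And>x \<phi> a n. set x \<subseteq> X \<Longrightarrow> \<phi> \<in> H n (length x) \<Longrightarrow> a \<in> ops A n \<Longrightarrow>
      G (x \<odot> \<phi>) a = G x (act A (length x) \<phi> a)"
  shows "G x a = G y b"
proof -
  have "((x, a), (y, b)) \<in> glue_eq A H (lists X)" using assms(1-4) cl_eq_iff by blast
  then have "G x a = case_prod G (y, b)"
    by (induction rule: glue_eq_induct) (use G in \<open>auto simp: in_lists_conv_set subset_iff\<close>)
  then show ?thesis by simp
qed

text \<open>Inner gluings and an outer gluing along \<phi> amount to one gluing of the concatenated
  tuple along \<open>star\<close>; the compatibility of \<open>opm\<close> with \<open>act\<close>
  matches the operations. An entry of \<open>L\<close> holds an inner tuple, a map into its
  positions, an arity and an operation of that arity.\<close>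

lemma conc_glue:
  assumes X: "X \<in> U" and \<phi>: "\<phi> \<in> H n (length L)" and a: "a \<in> ops A n"
    and L: "\<And>w \<psi> k b. (w, \<psi>, k, b) \<in> set L \<Longrightarrow> set w \<subseteq> X \<and> \<psi> \<in> H k (length w) \<and> b \<in> ops A k"
  shows "conc X (map (\<lambda>(w, \<psi>, k, b). (w \<odot> \<psi>, b)) L \<odot> \<phi>) a =
    conc X (map (\<lambda>(w, \<psi>, k, b). (w, act A (length w) \<psi> b)) L) (act A (length L) \<phi> a)"
proof -
  \<comment> \<open>The components of an entry as functions, the form in which the list versions of
    the operad laws take their families.\<close>
  define w where "w = (\<lambda>p::'u list \<times> nat list \<times> nat \<times> 'u. fst p)"
  define \<psi> where "\<psi> = (\<lambda>p::'u list \<times> nat list \<times> nat \<times> 'u. fst (snd p))"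
  define k where "k = (\<lambda>p::'u list \<times> nat list \<times> nat \<times> 'u. fst (snd (snd p)))"
  define b where "b = (\<lambda>p::'u list \<times> nat list \<times> nat \<times> 'u. snd (snd (snd p)))"
  note defs = w_def \<psi>_def k_def b_def
  have L': "set (w p) \<subseteq> X" "\<psi> p \<in> H (k p) (length (w p))" "b p \<in> ops A (k p)"
    "length (\<psi> p) = k p" "set (\<psi> p) \<subseteq> {..<length (w p)}" if "p \<in> set L" for p
  proof -
    have p: "set (w p) \<subseteq> X \<and> \<psi> p \<in> H (k p) (length (w p)) \<and> b p \<in> ops A (k p)"
      using L[of "w p" "\<psi> p" "k p" "b p"] that by (simp add: defs)
    then show "set (w p) \<subseteq> X" "\<psi> p \<in> H (k p) (length (w p))" "b p \<in> ops A (k p)"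
      "length (\<psi> p) = k p" "set (\<psi> p) \<subseteq> {..<length (w p)}"
      using H_length[of "\<psi> p"] H_set[of "\<psi> p"] by blast+
  qed
  have \<phi>L: "length \<phi> = n" "set \<phi> \<subseteq> {..<length L}" using H_length[OF \<phi>] H_set[OF \<phi>] by auto
  let ?ls = "map (\<lambda>p. length (w p)) L" and ?st = "star (map \<psi> L) (map (\<lambda>p. length (w p)) L) \<phi>"
  have st: "?st \<in> H (sum_list (map k L \<odot> \<phi>)) (length (concat (map w L)))"
    using H_star[OF \<phi>, of "map \<psi> L" "map k L" ?ls] L' by (simp add: length_concat comp_def)
  have "opm A (map k L \<odot> \<phi>) (map b L \<odot> \<phi>) a \<in> ops A (sum_list (map k L \<odot> \<phi>))"
    using a L' \<phi>L by (intro opm_ops) (auto simp: tcomp_def has_arities_map subset_iff)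
  then have "cl X (concat (map w L) \<odot> ?st) (opm A (map k L \<odot> \<phi>) (map b L \<odot> \<phi>) a) =
    cl X (concat (map w L)) (act A (length (concat (map w L))) ?st (opm A (map k L \<odot> \<phi>) (map b L \<odot> \<phi>) a))"
  proof (intro cl_tcomp[OF X _ st])
    show "set (concat (map w L)) \<subseteq> X" unfolding set_concat set_map using L'(1) by blast
  qed
  also have "act A (length (concat (map w L))) ?st (opm A (map k L \<odot> \<phi>) (map b L \<odot> \<phi>) a) =
    opm A ?ls (map (\<lambda>p. act A (length (w p)) (\<psi> p) (b p)) L) (act A (length L) \<phi> a)"
    using opm_act_list[OF \<phi> a, where \<psi> = \<psi> and k = k and l = "\<lambda>p. length (w p)" and b = b] L'
    by (simp add: length_concat comp_def)
  also have "concat (map w L) \<odot> ?st = concat (map (\<lambda>p. w p \<odot> \<psi> p) L \<odot> \<phi>)"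
    by (rule concat_star_list[OF \<phi>L(2) L'(5)])
  finally have main: "cl X (concat (map (\<lambda>p. w p \<odot> \<psi> p) L \<odot> \<phi>)) (opm A (map k L \<odot> \<phi>) (map b L \<odot> \<phi>) a) =
    cl X (concat (map w L)) (opm A ?ls (map (\<lambda>p. act A (length (w p)) (\<psi> p) (b p)) L) (act A (length L) \<phi> a))" .
  have k: "map (\<lambda>p. length (\<psi> p)) L = map k L" using L'(4) by simp
  have "conc X (map (\<lambda>p. (w p \<odot> \<psi> p, b p)) L \<odot> \<phi>) a =
    conc X (map (\<lambda>p. (w p, act A (length (w p)) (\<psi> p) (b p))) L) (act A (length L) \<phi> a)"
    using \<phi>L(2) by (simp add: conc_def comp_def map_tcomp k main)
  then show ?thesis by (simp add: defs split_def)
qed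

text \<open>Representatives of the inner classes are exchanged one at a time, each exchange being an
  instance of \<open>cl_lift\<close> at a single position.\<close>

lemma conc_cong:
  assumes X: "X \<in> U" and "list_all2 (\<lambda>p q. pc X p = pc X q) ps qs"
    and "set ps \<subseteq> pairs A (lists X)" "set qs \<subseteq> pairs A (lists X)" "t \<in> ops A (length ps)"
  shows "conc X ps t = conc X qs t"
proof -
  have one: "conc X (us @ p # vs) t = conc X (us @ q # vs) t"
    if "pc X p = pc X q" "set us \<subseteq> pairs A (lists X)" "p \<in> pairs A (lists X)"
      "q \<in> pairs A (lists X)" "set vs \<subseteq> pairs A (lists X)" "t \<in> ops A (length (us @ p # vs))" for us p q vs
  proof -
    have "conc X (us @ (fst p, snd p) # vs) t = conc X (us @ (fst q, snd q) # vs) t"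
    proof (rule cl_lift[OF X, of "fst p" "snd p" "fst q" "snd q"])
      fix x \<phi> a n assume x: "set x \<subseteq> X" "\<phi> \<in> H n (length x)" "a \<in> ops A n"
      note usvs = that(2,5)
      \<comment> \<open>Identities at all other blocks, and on the outer level, let
        \<open>conc_glue\<close> change this one block only.\<close>
      let ?i = "\<lambda>(y, b). (y, [0..<length y], length y, b)"
      let ?L = "map ?i us @ (x, \<phi>, n, a) # map ?i vs"
      have id: "map (\<lambda>(w, \<psi>, k, b). (w, act A (length w) \<psi> b)) (map ?i zs) = zs"
        "map (\<lambda>(w, \<psi>, k, b). (w \<odot> \<psi>, b)) (map ?i zs) = zs" if "set zs \<subseteq> pairs A (lists X)" for zs
        using that by (auto simp: pairs_def act_id intro!: map_idI)
      have uv: "set y \<subseteq> X" "b \<in> ops A (length y)" if "(y, b) \<in> set us \<or> (y, b) \<in> set vs" for y b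
      proof -
        have "(y, b) \<in> pairs A (lists X)" using that usvs by blast
        then show "set y \<subseteq> X" "b \<in> ops A (length y)" by (simp_all add: pairs_lists_iff)
      qed
      have "conc X (map (\<lambda>(w, \<psi>, k, b). (w \<odot> \<psi>, b)) ?L \<odot> [0..<length ?L]) t =
        conc X (map (\<lambda>(w, \<psi>, k, b). (w, act A (length w) \<psi> b)) ?L) (act A (length ?L) [0..<length ?L] t)"
      proof (rule conc_glue[OF X H_id])
        show "t \<in> ops A (length ?L)" using that(6) by simp
        fix w \<psi> k b assume "(w, \<psi>, k, b) \<in> set ?L"
        then consider "(w, b) \<in> set us \<or> (w, b) \<in> set vs" "\<psi> = [0..<length w]" "k = length w"
          | "w = x" "\<psi> = \<phi>" "k = n" "b = a" by auto
        then show "set w \<subseteq> X \<and> \<psi> \<in> H k (length w) \<and> b \<in> ops A k"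
        proof cases
          case 1
          show ?thesis unfolding 1(2,3) using uv[OF 1(1)] H_id by (intro conjI)
        next
          case 2
          show ?thesis unfolding 2 using x by (intro conjI)
        qed
      qed
      moreover have "map (\<lambda>(w, \<psi>, k, b). (w \<odot> \<psi>, b)) ?L \<odot> [0..<length ?L] =
          map (\<lambda>(w, \<psi>, k, b). (w \<odot> \<psi>, b)) ?L"
        using tcomp_id[of "map (\<lambda>(w, \<psi>, k, b). (w \<odot> \<psi>, b)) ?L"] by (simp only: length_map)
      moreover have "map (\<lambda>(w, \<psi>, k, b). (w \<odot> \<psi>, b)) ?L = us @ (x \<odot> \<phi>, a) # vs"
        "map (\<lambda>(w, \<psi>, k, b). (w, act A (length w) \<psi> b)) ?L = us @ (x, act A (length x) \<phi> a) # vs"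
        by (simp_all only: map_append list.map prod.case id[OF usvs(1)] id[OF usvs(2)])
      moreover have "act A (length ?L) [0..<length ?L] t = t"
        using that(6) by (intro act_id) simp
      ultimately show "conc X (us @ (x \<odot> \<phi>, a) # vs) t = conc X (us @ (x, act A (length x) \<phi> a) # vs) t"
        by (simp only:)
    qed (use that in \<open>auto simp: pc_def case_prod_beta\<close>)
    then show ?thesis by simp
  qed
  \<comment> \<open>Generalized over a prefix \<open>us\<close> of blocks that have already been
    exchanged.\<close>
  have "conc X (us @ ps) t = conc X (us @ qs) t"
    if "set us \<subseteq> pairs A (lists X)" "t \<in> ops A (length (us @ ps))" for us
    using assms(2) that assms(3,4)
  proof (induction ps qs arbitrary: us rule: list_all2_induct)
    case (Cons p ps q qs)
    have "conc X (us @ p # ps) t = conc X ((us @ [q]) @ ps) t" using one[of p q us ps] Cons.prems Cons.hyps by simp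
    also have "\<dots> = conc X ((us @ [q]) @ qs) t" using Cons.prems by (intro Cons.IH) auto
    finally show ?case by simp
  qed simp
  from this[of "[]"] assms(5) show ?thesis by simp
qed

text \<open>Once a representative is fixed for each inner class, \<open>conc\<close> becomes a
  function of the outer pair, and \<open>cl_lift\<close> applies to it.\<close>

lemma conc_wd:
  assumes X: "X \<in> U" and ps: "set ps \<subseteq> pairs A (lists X)" "t \<in> ops A (length ps)"
    and rs: "set rs \<subseteq> pairs A (lists X)" "u \<in> ops A (length rs)"
    and eq: "cl (ob X) (map (pc X) ps) t = cl (ob X) (map (pc X) rs) u"
  shows "conc X ps t = conc X rs u"
proof -
  define rep where "rep q = (SOME p. p \<in> pairs A (lists X) \<and> pc X p = q)" for q
  have rep: "rep q \<in> pairs A (lists X)" "pc X (rep q) = q" if "q \<in> ob X" for q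
  proof -
    have "\<exists>p. p \<in> pairs A (lists X) \<and> pc X p = q" using that unfolding ob_pc[OF X] by blast
    from someI_ex[OF this] show "rep q \<in> pairs A (lists X)" "pc X (rep q) = q"
      unfolding rep_def by blast+
  qed
  have reps: "conc X zs v = conc X (map rep (map (pc X) zs)) v"
    if "set zs \<subseteq> pairs A (lists X)" "v \<in> ops A (length zs)" for zs v
  proof (rule conc_cong[OF X _ that(1) _ that(2)])
    have zs: "pc X p \<in> ob X" if "p \<in> set zs" for p
      using that \<open>set zs \<subseteq> _\<close> by (auto simp: ob_pc[OF X])
    show "list_all2 (\<lambda>p q. pc X p = pc X q) zs (map rep (map (pc X) zs))"
      using rep(2)[OF zs] by (simp add: list_all2_map2 list_all2_same)
    show "set (map rep (map (pc X) zs)) \<subseteq> pairs A (lists X)"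
      using rep(1)[OF zs] by auto
  qed
  have "conc X (map rep (map (pc X) ps)) t = conc X (map rep (map (pc X) rs)) u"
  proof (rule cl_lift[OF ob_small[OF X] map_pc_pairs[OF X ps] map_pc_pairs[OF X rs] eq])
    fix qs \<phi> a n assume qs: "set qs \<subseteq> ob X" "\<phi> \<in> H n (length qs)" "a \<in> ops A n"
    \<comment> \<open>Identities on the inner level: only the outer gluing along \<phi> is
      performed.\<close>
    let ?L = "map (\<lambda>q. (fst (rep q), [0..<length (fst (rep q))], length (fst (rep q)), snd (rep q))) qs"
    have "set (fst (rep q)) \<subseteq> X" "snd (rep q) \<in> ops A (length (fst (rep q)))" if "q \<in> set qs" for q
    proof -
      have "q \<in> ob X" using that qs(1) by blast
      from rep(1)[OF this] have "(fst (rep q), snd (rep q)) \<in> pairs A (lists X)" by simp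
      then show "set (fst (rep q)) \<subseteq> X" "snd (rep q) \<in> ops A (length (fst (rep q)))"
        unfolding pairs_lists_iff by blast+
    qed
    note r = this
    from r have "conc X (map (\<lambda>(w, \<psi>, k, b). (w \<odot> \<psi>, b)) ?L \<odot> \<phi>) a =
        conc X (map (\<lambda>(w, \<psi>, k, b). (w, act A (length w) \<psi> b)) ?L) (act A (length ?L) \<phi> a)"
      using qs by (intro conc_glue[OF X]) (auto simp: H_id)
    moreover have "map (\<lambda>(w, \<psi>, k, b). (w \<odot> \<psi>, b)) ?L = map rep qs"
      by (simp add: comp_def)
    moreover have "map (\<lambda>(w, \<psi>, k, b). (w, act A (length w) \<psi> b)) ?L = map rep qs"
      using r(2) by (simp add: comp_def act_id)
    ultimately show "conc X (map rep (qs \<odot> \<phi>)) a = conc X (map rep qs) (act A (length qs) \<phi> a)"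
      by (simp only: map_tcomp[OF H_set[OF qs(2)]] length_map)
  qed
  with reps ps rs show ?thesis by simp
qed

lemma map_wd:
  assumes XY: "X \<in> U" "Y \<in> U" and f: "f \<in> X \<rightarrow>\<^sub>E Y"
    and "(x, a) \<in> pairs A (lists X)" "(y, b) \<in> pairs A (lists X)" "cl X x a = cl X y b"
  shows "cl Y (map f x) a = cl Y (map f y) b"
proof (rule cl_lift[OF XY(1) assms(4-6)])
  fix x \<phi> a n assume x: "set x \<subseteq> X" "\<phi> \<in> H n (length x)" "a \<in> ops A n"
  then have "set (map f x) \<subseteq> Y" using f by (auto dest: PiE_mem)
  from cl_tcomp[OF XY(2) this, of \<phi> n a] x show "cl Y (map f (x \<odot> \<phi>)) a = cl Y (map f x) (act A (length x) \<phi> a)"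
    using H_set[OF x(2)] by (simp add: map_tcomp)
qed

end

text \<open>The structure maps of \<open>T\<close> enter only through their values on
  representatives and their extensionality. Establishing these assumptions is where the descriptions
  in \<open>Mf\<close> and \<open>Mr\<close> are evaluated; the monad laws and finitarity are then
  shared.\<close>

locale tuple_monad = tuple_quotient U H A ob cl
  for U :: "'u set set" and H and A :: "'u operad" and ob cl +
  fixes T :: "'u mnd"
  assumes fob_T: "fob (fn T) = ob"
    and far_cl: "X \<in> U \<Longrightarrow> Y \<in> U \<Longrightarrow> f \<in> X \<rightarrow>\<^sub>E Y \<Longrightarrow> (x, a) \<in> pairs A (lists X) \<Longrightarrow>
      far (fn T) X Y f (cl X x a) = cl Y (map f x) a"
    and far_ext: "far (fn T) X Y f \<in> extensional (ob X)"
    and eta_T: "X \<in> U \<Longrightarrow> eta T X = (\<lambda>x\<in>X. cl X [x] (iota A))"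
    and mu_cl: "X \<in> U \<Longrightarrow> set ps \<subseteq> pairs A (lists X) \<Longrightarrow> t \<in> ops A (length ps) \<Longrightarrow>
      mu T X (cl (ob X) (map (pc X) ps) t) = conc X ps t"
    and mu_ext: "mu T X \<in> extensional (ob (ob X))"
begin

lemma map_pairs: "f \<in> X \<rightarrow>\<^sub>E Y \<Longrightarrow> (x, a) \<in> pairs A (lists X) \<Longrightarrow> (map f x, a) \<in> pairs A (lists Y)"
  by (auto simp: pairs_lists_iff dest: PiE_mem)

lemma far_in: "X \<in> U \<Longrightarrow> Y \<in> U \<Longrightarrow> f \<in> X \<rightarrow>\<^sub>E Y \<Longrightarrow> far (fn T) X Y f \<in> ob X \<rightarrow>\<^sub>E ob Y"
proof (rule PiE_I)
  fix q assume XY: "X \<in> U" "Y \<in> U" "f \<in> X \<rightarrow>\<^sub>E Y" and "q \<in> ob X"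
  from this(4,1) obtain x a where "(x, a) \<in> pairs A (lists X)" "q = cl X x a" by (rule ob_cases)
  with XY show "far (fn T) X Y f q \<in> ob Y" by (simp add: far_cl cl_in_ob map_pairs)
qed (rule extensional_arb[OF far_ext])

lemma set_functor_T: "set_functor U (fn T)"
  unfolding set_functor_def fob_T
proof (intro conjI ballI)
  fix X q assume X: "X \<in> U" "q \<in> ob X"
  from X(2,1) obtain x a where xa: "(x, a) \<in> pairs A (lists X)" "q = cl X x a" by (rule ob_cases)
  then have "map (\<lambda>x\<in>X. x) x = x" by (intro map_idI) (auto simp: pairs_lists_iff)
  with xa X show "far (fn T) X X (\<lambda>x\<in>X. x) q = q" by (simp add: far_cl)
next
  fix X Y Z f g q assume *: "X \<in> U" "Y \<in> U" "Z \<in> U" "f \<in> X \<rightarrow>\<^sub>E Y" "g \<in> Y \<rightarrow>\<^sub>E Z" "q \<in> ob X"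
  from *(6,1) obtain x a where xa: "(x, a) \<in> pairs A (lists X)" "q = cl X x a" by (rule ob_cases)
  have "map (compose X g f) x = map g (map f x)" using xa(1) by (auto simp: pairs_lists_iff)
  moreover have "compose X g f \<in> X \<rightarrow>\<^sub>E Z" by (rule compose_PiE[OF *(4,5)])
  ultimately show "far (fn T) X Z (compose X g f) q = far (fn T) Y Z g (far (fn T) X Y f q)"
    using far_cl[OF *(1,3) _ xa(1)] far_cl[OF *(2,3,5) map_pairs[OF *(4) xa(1)]] far_cl[OF *(1,2,4) xa(1)]
    by (simp only: xa(2))
qed (use ob_small far_in in auto)

lemma eta_in: "X \<in> U \<Longrightarrow> eta T X \<in> X \<rightarrow>\<^sub>E ob X"
  by (auto simp: eta_T pairs_lists_iff iota_ops intro!: cl_in_ob)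

lemma mu_in: "X \<in> U \<Longrightarrow> mu T X \<in> ob (ob X) \<rightarrow>\<^sub>E ob X"
proof (rule PiE_I)
  fix Q assume X: "X \<in> U" and "Q \<in> ob (ob X)"
  from this(2,1) obtain ps t where "set ps \<subseteq> pairs A (lists X)" "t \<in> ops A (length ps)"
    "Q = cl (ob X) (map (pc X) ps) t" by (rule ob_ob_cases)
  with X show "mu T X Q \<in> ob X" by (simp add: mu_cl conc_def cl_in_ob conc_pairs)
qed (rule extensional_arb[OF mu_ext])

lemma eta_natural:
  assumes "X \<in> U" "Y \<in> U" "f \<in> X \<rightarrow>\<^sub>E Y" "x \<in> X"
  shows "eta T Y (f x) = far (fn T) X Y f (eta T X x)"
  using assms PiE_mem[OF assms(3,4)] by (simp add: eta_T far_cl pairs_lists_iff iota_ops)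

lemma mu_natural:
  assumes "X \<in> U" "Y \<in> U" "f \<in> X \<rightarrow>\<^sub>E Y" "Q \<in> ob (ob X)"
  shows "mu T Y (far (fn T) (ob X) (ob Y) (far (fn T) X Y f) Q) = far (fn T) X Y f (mu T X Q)"
proof -
  from assms(4,1) obtain ps t where ps: "set ps \<subseteq> pairs A (lists X)" "t \<in> ops A (length ps)"
    "Q = cl (ob X) (map (pc X) ps) t" by (rule ob_ob_cases)
  let ?fs = "map (\<lambda>(x, a). (map f x, a)) ps"
  have fs: "set ?fs \<subseteq> pairs A (lists Y)" using ps(1) map_pairs[OF assms(3)] by auto
  have eq: "map (far (fn T) X Y f) (map (pc X) ps) = map (pc Y) ?fs"
    using ps(1) assms(1-3) by (auto simp: far_cl)
  have "mu T Y (far (fn T) (ob X) (ob Y) (far (fn T) X Y f) Q) = conc Y ?fs t"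
    using far_cl[OF ob_small[OF assms(1)] ob_small[OF assms(2)] far_in[OF assms(1-3)]
        map_pc_pairs[OF assms(1) ps(1,2)]] mu_cl[OF assms(2) fs] ps(2)
    by (simp only: ps(3) eq length_map)
  also have "\<dots> = cl Y (map f (concat (map fst ps))) (opm A (map (\<lambda>p. length (fst p)) ps) (map snd ps) t)"
    by (simp add: conc_def map_concat comp_def case_prod_beta)
  also have "\<dots> = far (fn T) X Y f (conc X ps t)"
    unfolding conc_def using far_cl[OF assms(1-3) conc_pairs[OF ps(1,2)]] by simp
  finally show ?thesis using mu_cl[OF assms(1) ps(1,2)] ps(3) by simp
qed

text \<open>A single block under the operadic unit: this is \<open>opm_iota\<close>.\<close>

lemma mu_eta:
  assumes "X \<in> U" "q \<in> ob X" shows "mu T X (eta T (ob X) q) = q"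
proof -
  from assms(2,1) obtain x a where xa: "(x, a) \<in> pairs A (lists X)" "q = cl X x a" by (rule ob_cases)
  then have "mu T X (eta T (ob X) q) = conc X [(x, a)] (iota A)"
    using mu_cl[OF assms(1), of "[(x, a)]" "iota A"] assms(2) iota_ops by (simp add: eta_T ob_small[OF assms(1)])
  also have "\<dots> = q" using xa by (simp add: conc_def opm_iota pairs_def)
  finally show ?thesis .
qed

text \<open>One block \<open>[e]\<close> decorated with the operadic unit for each entry: this is
  \<open>iota_opm\<close>.\<close>

lemma mu_far_eta:
  assumes "X \<in> U" "q \<in> ob X" shows "mu T X (far (fn T) X (ob X) (eta T X) q) = q"
proof -
  from assms(2,1) obtain x a where xa: "(x, a) \<in> pairs A (lists X)" "q = cl X x a" by (rule ob_cases)
  let ?ps = "map (\<lambda>e. ([e], iota A)) x"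
  have eq: "map (eta T X) x = map (pc X) ?ps" using xa(1) by (auto simp: eta_T[OF assms(1)] pairs_lists_iff)
  have "set ?ps \<subseteq> pairs A (lists X)" using xa(1) iota_ops by (auto simp: pairs_lists_iff)
  then have "mu T X (far (fn T) X (ob X) (eta T X) q) = conc X ?ps a"
    using mu_cl[OF assms(1), of ?ps a] xa(1)
      far_cl[OF assms(1) ob_small[OF assms(1)] eta_in[OF assms(1)] xa(1)]
    by (simp only: xa(2) eq length_map pairs_lists_iff)
  also have "\<dots> = q"
    using xa by (simp add: conc_def comp_def map_replicate_const iota_opm pairs_def)
  finally show ?thesis .
qed

text \<open>Flattening the inner or the outer level first gives the same tuple, and the operations
  agree by associativity in the operad, in the form \<open>opm_assoc_list\<close>.\<close>

lemma mu_assoc: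
  assumes X: "X \<in> U" and Q: "Q \<in> ob (ob (ob X))"
  shows "mu T X (mu T (ob X) Q) = mu T X (far (fn T) (ob (ob X)) (ob X) (mu T X) Q)"
proof -
  note X1 = ob_small[OF X] note X2 = ob_small[OF X1]
  let ?e = "\<lambda>r. (map (pc X) (fst r), snd r)"
  from Q X1 obtain Qs t where Qs: "set Qs \<subseteq> pairs A (lists (ob X))" "t \<in> ops A (length Qs)"
    "Q = cl (ob (ob X)) (map (pc (ob X)) Qs) t" by (rule ob_ob_cases)
  have "\<exists>r. set (fst r) \<subseteq> pairs A (lists X) \<and> snd r \<in> ops A (length (fst r)) \<and> p = ?e r"
    if p: "p \<in> pairs A (lists (ob X))" for p
  proof -
    have "set (fst p) \<subseteq> ob X" using p by (auto simp: pairs_def)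
    then obtain ps where "set ps \<subseteq> pairs A (lists X)" "fst p = map (pc X) ps"
      using ob_list_cases X by blast
    with p show ?thesis by (intro exI[of _ "(ps, snd p)"]) (auto simp: pairs_def)
  qed
  then have "Qs \<in> lists (?e ` {r. set (fst r) \<subseteq> pairs A (lists X) \<and> snd r \<in> ops A (length (fst r))})"
    using Qs(1) by blast
  \<comment> \<open>\<open>R\<close> is \<open>Qs\<close> with its tuples of classes replaced by
    tuples of representatives, so that all nested levels are plain data.\<close>
  then obtain R where R: "Qs = map ?e R"
    "\<And>r. r \<in> set R \<Longrightarrow> set (fst r) \<subseteq> pairs A (lists X) \<and> snd r \<in> ops A (length (fst r))"
    unfolding lists_image by auto
  have t: "t \<in> ops A (length R)" using Qs(2) R(1) by simp
  let ?ps = "concat (map fst R)" and ?s = "opm A (map (\<lambda>r. length (fst r)) R) (map snd R) t"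
  have ps: "set ?ps \<subseteq> pairs A (lists X)" "?s \<in> ops A (length ?ps)"
    using R(2) opm_ops_list[of R snd "\<lambda>r. length (fst r)" t] t by (auto simp: length_concat comp_def)
  have "mu T (ob X) Q = cl (ob X) (map (pc X) ?ps) ?s"
    using mu_cl[OF X1 Qs(1,2)] unfolding Qs(3) by (simp add: R(1) conc_def comp_def map_concat)
  then have 1: "mu T X (mu T (ob X) Q) = conc X ?ps ?s" using mu_cl[OF X ps] by simp
  let ?c = "\<lambda>r. (concat (map fst (fst r)), opm A (map (\<lambda>p. length (fst p)) (fst r)) (map snd (fst r)) (snd r))"
  have "?c r \<in> pairs A (lists X)" if "r \<in> set R" for r
    using R(2)[OF that] by (intro conc_pairs) blast+
  then have cs: "set (map ?c R) \<subseteq> pairs A (lists X)" by auto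
  have "mu T X (pc (ob X) (?e r)) = pc X (?c r)" if "r \<in> set R" for r
    using mu_cl[OF X, of "fst r" "snd r"] R(2)[OF that] by (simp add: conc_def)
  then have eq: "map (mu T X) (map (pc (ob X)) Qs) = map (pc X) (map ?c R)" by (simp add: R(1))
  have "far (fn T) (ob (ob X)) (ob X) (mu T X) Q = cl (ob X) (map (pc X) (map ?c R)) t"
    unfolding Qs(3) using far_cl[OF X2 X1 mu_in[OF X] map_pc_pairs[OF X1 Qs(1,2)]] by (simp only: eq)
  then have 2: "mu T X (far (fn T) (ob (ob X)) (ob X) (mu T X) Q) = conc X (map ?c R) t"
    using mu_cl[OF X cs] t by simp
  have "opm A (map (\<lambda>r. sum_list (map (\<lambda>p. length (fst p)) (fst r))) R)
      (map (\<lambda>r. opm A (map (\<lambda>p. length (fst p)) (fst r)) (map snd (fst r)) (snd r)) R) t =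
    opm A (map (\<lambda>p. length (fst p)) ?ps) (map snd ?ps) ?s"
  proof (rule opm_assoc_list[OF _ t])
    fix r assume "r \<in> set R"
    note r = R(2)[OF this]
    have "snd p \<in> ops A (length (fst p))" if "p \<in> set (fst r)" for p
      using subsetD[OF conjunct1[OF r] that] by (auto simp: pairs_def)
    then show "snd r \<in> ops A (length (fst r)) \<and> (\<forall>p\<in>set (fst r). snd p \<in> ops A (length (fst p)))"
      using r by blast
  qed
  moreover have "concat (map fst ?ps) = concat (map (\<lambda>r. concat (map fst (fst r))) R)"
    by (induction R) auto
  ultimately have "conc X ?ps ?s = conc X (map ?c R) t"
    by (simp add: conc_def comp_def length_concat)
  with 1 2 show ?thesis by simp
qed

lemma is_monad_T: "is_monad U T"
  unfolding is_monad_def nat_trans_SET Let_def functor_id_simps functor_comp_simps fob_T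
proof (intro conjI ballI)
  fix X assume X: "X \<in> U"
  note X1 = ob_small[OF X] note X2 = ob_small[OF X1]
  show "compose (ob (ob (ob X))) (mu T X) (mu T (ob X)) =
    compose (ob (ob (ob X))) (mu T X) (far (fn T) (ob (ob X)) (ob X) (mu T X))"
    by (intro compose_eqI mu_assoc X)
  show "compose (ob X) (mu T X) (eta T (ob X)) = (\<lambda>q\<in>ob X. q)"
    by (rule PiE_eqI[OF compose_PiE[OF eta_in[OF X1] mu_in[OF X]] PiE_restrict_id]) (simp add: mu_eta X)
  show "compose (ob X) (mu T X) (far (fn T) X (ob X) (eta T X)) = (\<lambda>q\<in>ob X. q)"
    by (rule PiE_eqI[OF compose_PiE[OF far_in[OF X X1 eta_in[OF X]] mu_in[OF X]] PiE_restrict_id])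
      (simp add: mu_far_eta X)
qed (auto simp: set_functor_id set_functor_comp set_functor_T eta_in eta_natural mu_natural
      PiE_mem[OF mu_in] intro: mu_in extensional_arb[OF mu_ext])

end

section \<open>Preservation of filtered colimits\<close>

context tuple_monad
begin

text \<open>A pair mentions finitely many entries, which gives joint surjectivity. For merging,
  equality over \<open>L\<close> is a finite chain of gluings, and each of them is realized at some
  stage of the diagram.\<close>

lemma finitary_T: "finitary U (fn T)"
  unfolding finitary_def
proof (intro allI impI, elim conjE)
  fix J :: "('u, 'u) category" and D L l
  assume J: "filtered J" and D: "is_functor J (SET U) D" and col: "colimit J (SET U) D L l"
  have cat: "is_category J" using J unfolding filtered_def by blast
  note C = is_categoryD[OF cat] and DF = is_functor_to_SET[OF D]
  have coc: "cocone J (SET U) D L l" using col unfolding colimit_def by blast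
  have surj: "joint_surj J D L l"
    and mrg: "\<And>i j x y. i \<in> Ob J \<Longrightarrow> j \<in> Ob J \<Longrightarrow> x \<in> fob D i \<Longrightarrow> y \<in> fob D j \<Longrightarrow> l i x = l j y \<Longrightarrow>
      merges J D i x j y"
    using colimit_SET_iff[OF universe J D coc] col by blast+
  have L: "L \<in> U" and lL: "\<And>j. j \<in> Ob J \<Longrightarrow> l j \<in> fob D j \<rightarrow>\<^sub>E L"
    and ll: "\<And>i j f x. i \<in> Ob J \<Longrightarrow> j \<in> Ob J \<Longrightarrow> f \<in> Hom J i j \<Longrightarrow> x \<in> fob D i \<Longrightarrow> l j (far D i j f x) = l i x"
    using coc unfolding cocone_SET[OF D] by blast+
  note lift = filtered_lift_list[OF J D coc surj]
  note merge = filtered_merge_lists[where l = l, OF J D mrg]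
  have D_lists: "map (far D i j f) x \<in> lists (fob D j)"
    if "i \<in> Ob J" "j \<in> Ob J" "f \<in> Hom J i j" "x \<in> lists (fob D i)" for i j f x
    using PiE_mem[OF DF(2)[OF that(1-3)]] that(4) by (auto simp: in_lists_conv_set)
  have D_comp: "map (far D i k (Cmp J i j k g f)) x = map (far D j k g) (map (far D i j f) x)"
    if "i \<in> Ob J" "j \<in> Ob J" "k \<in> Ob J" "f \<in> Hom J i j" "g \<in> Hom J j k" "x \<in> lists (fob D i)" for i j k f g x
    using that(6) DF(4)[OF that(1-5)] by (simp add: in_lists_conv_set)
  have l_D: "map (l j) (map (far D i j f) x) = map (l i) x"
    if "i \<in> Ob J" "j \<in> Ob J" "f \<in> Hom J i j" "x \<in> lists (fob D i)" for i j f x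
    using that(4) ll[OF that(1-3)] by (simp add: in_lists_conv_set)
  have tcomp_lists: "x \<odot> \<phi> \<in> lists S" if "x \<in> lists S" "\<phi> \<in> H n (length x)" for x :: "'u list" and \<phi> n S
    using that(1) set_tcomp_subset[OF H_set[OF that(2)]] by (auto simp: in_lists_conv_set)

  \<comment> \<open>Invariant along a chain that starts at the image of \<open>(x, a)\<close>: the
    current pair \<open>p\<close> has a lift at some stage \<open>k\<close>, and at that stage the
    lift already represents the same element as \<open>(x, a)\<close>.\<close>
  have key: "\<exists>k\<in>Ob J. \<exists>f\<in>Hom J i k. \<exists>y\<in>lists (fob D k). map (l k) y = fst p \<and> snd p \<in> ops A (length y) \<and>
      cl (fob D k) (map (far D i k f) x) a = cl (fob D k) y (snd p)"
    if i: "i \<in> Ob J" and x: "x \<in> lists (fob D i)" and a: "a \<in> ops A (length x)"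
      and eq: "((map (l i) x, a), p) \<in> glue_eq A H (lists L)" for i x a p
    using eq
  proof (induction rule: glue_eq_induct)
    case refl
    have "map (far D i i (Idn J i)) x = x"
      using DF(3)[OF i] x by (intro map_idI) (simp add: in_lists_conv_set)
    then show ?case
      using i C(1)[OF i] x a by (intro bexI[of _ i] bexI[of _ "Idn J i"] bexI[of _ x]) simp_all
  next
    case (glue v \<phi> c n)
    from glue.IH obtain k f y where k: "k \<in> Ob J" "f \<in> Hom J i k" "y \<in> lists (fob D k)"
      "map (l k) y = v \<odot> \<phi>" "c \<in> ops A (length y)"
      "cl (fob D k) (map (far D i k f) x) a = cl (fob D k) y c" by auto
    \<comment> \<open>Entries of \<open>v\<close> may fail to occur in
      \<open>v \<odot> \<phi>\<close>, so \<open>v\<close> is lifted afresh, and its lift is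
      compared with \<open>y\<close> at a later stage.\<close>
    obtain j u where j: "j \<in> Ob J" "u \<in> lists (fob D j)" "map (l j) u = v"
      using lift[OF glue.hyps(1)] by blast
    have \<phi>u: "\<phi> \<in> H n (length u)" using glue.hyps(2) j(3) by auto
    have lu: "map (l k) y = map (l j) (u \<odot> \<phi>)" using k(4) j(3) H_set[OF \<phi>u] by (simp add: map_tcomp)
    obtain k' f' g where k': "k' \<in> Ob J" "f' \<in> Hom J k k'" "g \<in> Hom J j k'"
      "map (far D k k' f') y = map (far D j k' g) (u \<odot> \<phi>)"
      using merge[OF _ _ _ _ _ k(1) j(1) k(3) tcomp_lists[OF j(2) \<phi>u] lu] by blast
    let ?u = "map (far D j k' g) u"
    have u: "?u \<in> lists (fob D k')" by (rule D_lists[OF j(1) k'(1,3) j(2)])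
    have "cl (fob D k') (map (far D i k' (Cmp J i k k' f' f)) x) a =
        cl (fob D k') (map (far D k k' f') (map (far D i k f) x)) a"
      by (simp only: D_comp[OF i k(1) k'(1) k(2) k'(2) x])
    also have "\<dots> = cl (fob D k') (map (far D k k' f') y) c"
      using D_lists[OF i k(1,2) x] k(3,5,6) a
      by (intro map_wd[OF DF(1)[OF k(1)] DF(1)[OF k'(1)] DF(2)[OF k(1) k'(1,2)]])
        (auto simp: pairs_def)
    also have "map (far D k k' f') y = ?u \<odot> \<phi>"
      using k'(4) H_set[OF \<phi>u] by (simp add: map_tcomp)
    also have "cl (fob D k') (?u \<odot> \<phi>) c = cl (fob D k') ?u (act A (length ?u) \<phi> c)"
      using u \<phi>u glue.hyps(3) by (intro cl_tcomp[OF DF(1)[OF k'(1)]]) auto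
    finally have "cl (fob D k') (map (far D i k' (Cmp J i k k' f' f)) x) a =
      cl (fob D k') ?u (act A (length v) \<phi> c)" using j(3) by auto
    moreover have "Cmp J i k k' f' f \<in> Hom J i k'" by (rule C(2)[OF i k(1) k'(1) k(2) k'(2)])
    moreover have "map (l k') ?u = v" using l_D[OF j(1) k'(1,3) j(2)] j(3) by simp
    moreover have "act A (length v) \<phi> c \<in> ops A (length ?u)"
      using act_ops[OF \<phi>u glue.hyps(3)] j(3) by auto
    ultimately show ?case
      using k'(1) u by (intro bexI[of _ k'] bexI[of _ "Cmp J i k k' f' f"] bexI[of _ ?u]) simp_all
  next
    case (unglue v \<phi> c n)
    from unglue.IH obtain k f y where k: "k \<in> Ob J" "f \<in> Hom J i k" "y \<in> lists (fob D k)"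
      "map (l k) y = v"
      "cl (fob D k) (map (far D i k f) x) a = cl (fob D k) y (act A (length v) \<phi> c)" by auto
    have \<phi>y: "\<phi> \<in> H n (length y)" using unglue.hyps(2) k(4) by auto
    \<comment> \<open>In this direction \<open>y\<close> already lies over \<open>v\<close>, so the
      gluing is performed at stage \<open>k\<close> itself.\<close>
    have "cl (fob D k) (y \<odot> \<phi>) c = cl (fob D k) y (act A (length y) \<phi> c)"
      using k(3) \<phi>y unglue.hyps(3) by (intro cl_tcomp[OF DF(1)[OF k(1)]]) auto
    then have "cl (fob D k) (map (far D i k f) x) a = cl (fob D k) (y \<odot> \<phi>) c" using k(4,5) by auto
    moreover have "map (l k) (y \<odot> \<phi>) = v \<odot> \<phi>" using k(4) H_set[OF \<phi>y] by (simp add: map_tcomp)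
    moreover have "c \<in> ops A (length (y \<odot> \<phi>))" using H_length[OF \<phi>y] unglue.hyps(3) by simp
    ultimately show ?case
      using k(1,2) tcomp_lists[OF k(3) \<phi>y] by (intro bexI[of _ k] bexI[of _ f] bexI[of _ "y \<odot> \<phi>"]) simp_all
  qed

  let ?D = "functor_comp (fn T) D" and ?l = "\<lambda>j. far (fn T) (fob D j) L (l j)"
  have D': "is_functor J (SET U) ?D"
    using is_functor_comp[OF D] set_functor_T is_functor_SET by blast
  have coc': "cocone J (SET U) ?D (ob L) ?l"
    unfolding cocone_SET[OF D'] functor_comp_simps fob_T
  proof (intro conjI ballI)
    show "ob L \<in> U" by (rule ob_small[OF L])
    fix i assume i: "i \<in> Ob J"
    show "?l i \<in> ob (fob D i) \<rightarrow>\<^sub>E ob L" by (rule far_in[OF DF(1)[OF i] L lL[OF i]])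
    fix j f q assume j: "j \<in> Ob J" "f \<in> Hom J i j" and "q \<in> ob (fob D i)"
    then obtain x a where xa: "(x, a) \<in> pairs A (lists (fob D i))" "q = cl (fob D i) x a"
      using ob_cases DF(1)[OF i] by blast
    then have x: "x \<in> lists (fob D i)" by (simp add: pairs_def)
    have m: "(map (far D i j f) x, a) \<in> pairs A (lists (fob D j))"
      by (rule map_pairs[OF DF(2)[OF i j] xa(1)])
    have "?l j (far (fn T) (fob D i) (fob D j) (far D i j f) q) = cl L (map (l j) (map (far D i j f) x)) a"
      unfolding xa(2) far_cl[OF DF(1)[OF i] DF(1)[OF j(1)] DF(2)[OF i j] xa(1)]
      by (rule far_cl[OF DF(1)[OF j(1)] L lL[OF j(1)] m])
    also have "\<dots> = ?l i q"
      unfolding l_D[OF i j x] xa(2) by (rule far_cl[OF DF(1)[OF i] L lL[OF i] xa(1), symmetric])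
    finally show "?l j (far (fn T) (fob D i) (fob D j) (far D i j f) q) = ?l i q" .
  qed
  show "colimit J (SET U) ?D (fob (fn T) L) ?l"
    unfolding fob_T colimit_SET_iff[OF universe J D' coc']
  proof (intro conjI ballI impI)
    show "joint_surj J ?D (ob L) ?l"
      unfolding joint_surj_def functor_comp_simps fob_T
    proof
      fix q assume "q \<in> ob L"
      then obtain x a where xa: "(x, a) \<in> pairs A (lists L)" "q = cl L x a" using ob_cases L by blast
      then have "x \<in> lists L" by (simp add: pairs_def)
      then obtain j y where j: "j \<in> Ob J" "y \<in> lists (fob D j)" "map (l j) y = x" using lift by blast
      have ya: "(y, a) \<in> pairs A (lists (fob D j))" using xa(1) j(2) j(3)[symmetric] by (simp add: pairs_def)
      show "\<exists>j\<in>Ob J. \<exists>p\<in>ob (fob D j). ?l j p = q"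
        using j(1) cl_in_ob[OF DF(1)[OF j(1)] ya] far_cl[OF DF(1)[OF j(1)] L lL[OF j(1)] ya] xa(2) j(3)
        by (intro bexI[of _ j] bexI[of _ "cl (fob D j) y a"]) simp_all
    qed
  next
    fix i j p q assume i: "i \<in> Ob J" and j: "j \<in> Ob J" and p: "p \<in> fob ?D i" and q: "q \<in> fob ?D j"
      and eq: "?l i p = ?l j q"
    obtain x a where xa: "(x, a) \<in> pairs A (lists (fob D i))" "p = cl (fob D i) x a"
      using p by (auto simp: fob_T elim: ob_cases[OF _ DF(1)[OF i]])
    obtain y b where yb: "(y, b) \<in> pairs A (lists (fob D j))" "q = cl (fob D j) y b"
      using q by (auto simp: fob_T elim: ob_cases[OF _ DF(1)[OF j]])
    have x: "x \<in> lists (fob D i)" "a \<in> ops A (length x)" and y: "y \<in> lists (fob D j)" "b \<in> ops A (length y)"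
      using xa yb by (simp_all add: pairs_def)
    have "cl L (map (l i) x) a = cl L (map (l j) y) b"
      using eq far_cl[OF DF(1)[OF i] L lL[OF i] xa(1)] far_cl[OF DF(1)[OF j] L lL[OF j] yb(1)]
      unfolding xa(2) yb(2) by simp
    then have "((map (l i) x, a), (map (l j) y, b)) \<in> glue_eq A H (lists L)"
      using cl_eq_iff[OF L map_pairs[OF lL[OF i] xa(1)] map_pairs[OF lL[OF j] yb(1)]] by simp
    from key[OF i x this] obtain k f z where k: "k \<in> Ob J" "f \<in> Hom J i k" "z \<in> lists (fob D k)"
      "map (l k) z = map (l j) y" "b \<in> ops A (length z)"
      "cl (fob D k) (map (far D i k f) x) a = cl (fob D k) z b" by auto
    obtain k' f' g where k': "k' \<in> Ob J" "f' \<in> Hom J k k'" "g \<in> Hom J j k'"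
      "map (far D k k' f') z = map (far D j k' g) y"
      using merge[OF _ _ _ _ _ k(1) j k(3) y(1) k(4)] by blast
    have c: "Cmp J i k k' f' f \<in> Hom J i k'" by (rule C(2)[OF i k(1) k'(1) k(2) k'(2)])
    have "far (fn T) (fob D i) (fob D k') (far D i k' (Cmp J i k k' f' f)) p =
        cl (fob D k') (map (far D i k' (Cmp J i k k' f' f)) x) a"
      unfolding xa(2) by (rule far_cl[OF DF(1)[OF i] DF(1)[OF k'(1)] DF(2)[OF i k'(1) c] xa(1)])
    also have "\<dots> = cl (fob D k') (map (far D k k' f') (map (far D i k f) x)) a"
      by (simp only: D_comp[OF i k(1) k'(1) k(2) k'(2) x(1)])
    also have "\<dots> = cl (fob D k') (map (far D k k' f') z) b"
      using D_lists[OF i k(1,2) x(1)] k(3,5,6) x(2)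
      by (intro map_wd[OF DF(1)[OF k(1)] DF(1)[OF k'(1)] DF(2)[OF k(1) k'(1,2)]])
        (auto simp: pairs_def)
    also have "\<dots> = far (fn T) (fob D j) (fob D k') (far D j k' g) q"
      unfolding k'(4) yb(2) by (rule far_cl[OF DF(1)[OF j] DF(1)[OF k'(1)] DF(2)[OF j k'(1,3)] yb(1), symmetric])
    finally show "merges J ?D i p j q"
      unfolding merges_def functor_comp_simps using k'(1,3) c by blast
  qed
qed

end


section \<open>The categories of monads\<close>

lemma is_monadD:
  assumes "is_monad U T"
  shows "set_functor U (fn T)" "X \<in> U \<Longrightarrow> eta T X \<in> X \<rightarrow>\<^sub>E fob (fn T) X"
    "X \<in> U \<Longrightarrow> mu T X \<in> fob (fn T) (fob (fn T) X) \<rightarrow>\<^sub>E fob (fn T) X"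
proof -
  have "nat_trans (SET U) (SET U) functor_id (fn T) (eta T)"
    "nat_trans (SET U) (SET U) (functor_comp (fn T) (fn T)) (fn T) (mu T)"
    using assms unfolding is_monad_def by simp_all
  then show "set_functor U (fn T)" "X \<in> U \<Longrightarrow> eta T X \<in> X \<rightarrow>\<^sub>E fob (fn T) X"
    "X \<in> U \<Longrightarrow> mu T X \<in> fob (fn T) (fob (fn T) X) \<rightarrow>\<^sub>E fob (fn T) X"
    unfolding nat_trans_SET functor_comp_simps functor_id_simps by (elim conjE, simp)+
qed

lemma monad_morphism_iff:
  assumes S: "is_monad U S" and T: "is_monad U T"
  shows "monad_morphism U S T \<tau> \<longleftrightarrow> nat_trans (SET U) (SET U) (fn S) (fn T) \<tau> \<and>
    (\<forall>X\<in>U. (\<forall>x\<in>X. \<tau> X (eta S X x) = eta T X x) \<and>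
       (\<forall>Q\<in>fob (fn S) (fob (fn S) X). \<tau> X (mu S X Q) =
          mu T X (\<tau> (fob (fn T) X) (far (fn S) (fob (fn S) X) (fob (fn T) X) (\<tau> X) Q))))"
proof -
  have "compose X (\<tau> X) (eta S X) = eta T X \<longleftrightarrow> (\<forall>x\<in>X. \<tau> X (eta S X x) = eta T X x)"
    if X: "X \<in> U" and n: "nat_trans (SET U) (SET U) (fn S) (fn T) \<tau>" for X
  proof -
    have "\<tau> X \<in> fob (fn S) X \<rightarrow>\<^sub>E fob (fn T) X" using n X unfolding nat_trans_SET by simp
    note e = PiE_eqI[OF compose_PiE[OF is_monadD(2)[OF S X] this] is_monadD(2)[OF T X]]
    show ?thesis
    proof
      assume "compose X (\<tau> X) (eta S X) = eta T X"
      then show "\<forall>x\<in>X. \<tau> X (eta S X x) = eta T X x" by (metis compose_apply)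
    qed (rule e, simp)
  qed
  moreover have "compose Q a b = compose Q c (compose Q d e) \<longleftrightarrow> (\<forall>q\<in>Q. a (b q) = c (d (e q)))"
    for Q :: "'a set" and a b c d e :: "'a \<Rightarrow> 'a"
    by (simp add: compose_eq_iff)
  ultimately show ?thesis
    unfolding monad_morphism_def Let_def by (intro conj_cong refl ball_cong)
qed

definition mcomp :: "'u set set \<Rightarrow> 'u mnd \<Rightarrow> ('u set \<Rightarrow> 'u \<Rightarrow> 'u) \<Rightarrow> ('u set \<Rightarrow> 'u \<Rightarrow> 'u) \<Rightarrow> 'u set \<Rightarrow> 'u \<Rightarrow> 'u" where
  "mcomp U R \<sigma> \<tau> = (\<lambda>X\<in>U. compose (fob (fn R) X) (\<sigma> X) (\<tau> X))"

definition mid :: "'u set set \<Rightarrow> 'u mnd \<Rightarrow> 'u set \<Rightarrow> 'u \<Rightarrow> 'u" where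
  "mid U T = (\<lambda>X\<in>U. \<lambda>q\<in>fob (fn T) X. q)"

lemma Mnd_simps [simp]:
  "T \<in> Ob (Mnd U) \<longleftrightarrow> is_monad U T \<and> finitary U (fn T)"
  "\<tau> \<in> Hom (Mnd U) S T \<longleftrightarrow> \<tau> \<in> extensional U \<and> monad_morphism U S T \<tau>"
  "Idn (Mnd U) T = mid U T" "Cmp (Mnd U) R S T \<sigma> \<tau> = mcomp U R \<sigma> \<tau>"
  by (simp_all add: Mnd_def mid_def mcomp_def)

lemma SanMnd_simps [simp]:
  "T \<in> Ob (SanMnd U) \<longleftrightarrow> T \<in> Ob (Mnd U) \<and> semi_analytic U (fn T) \<and>
      semi_cartesian U functor_id (fn T) (eta T) \<and>
      semi_cartesian U (functor_comp (fn T) (fn T)) (fn T) (mu T)"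
  "\<tau> \<in> Hom (SanMnd U) S T \<longleftrightarrow> \<tau> \<in> Hom (Mnd U) S T \<and> semi_cartesian U (fn S) (fn T) \<tau>"
  "Idn (SanMnd U) T = mid U T" "Cmp (SanMnd U) R S T \<sigma> \<tau> = mcomp U R \<sigma> \<tau>"
  by (simp_all add: SanMnd_def)

lemma mcomp_apply [simp]: "X \<in> U \<Longrightarrow> q \<in> fob (fn R) X \<Longrightarrow> mcomp U R \<sigma> \<tau> X q = \<sigma> X (\<tau> X q)"
  by (simp add: mcomp_def)

lemma mid_apply [simp]: "X \<in> U \<Longrightarrow> q \<in> fob (fn T) X \<Longrightarrow> mid U T X q = q"
  by (simp add: mid_def)

lemma monad_morphismD:
  assumes "monad_morphism U S T \<tau>" "is_monad U S" "is_monad U T"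
  shows "X \<in> U \<Longrightarrow> \<tau> X \<in> fob (fn S) X \<rightarrow>\<^sub>E fob (fn T) X"
    "X \<in> U \<Longrightarrow> Y \<in> U \<Longrightarrow> f \<in> X \<rightarrow>\<^sub>E Y \<Longrightarrow> q \<in> fob (fn S) X \<Longrightarrow>
      \<tau> Y (far (fn S) X Y f q) = far (fn T) X Y f (\<tau> X q)"
    "X \<in> U \<Longrightarrow> x \<in> X \<Longrightarrow> \<tau> X (eta S X x) = eta T X x"
    "X \<in> U \<Longrightarrow> Q \<in> fob (fn S) (fob (fn S) X) \<Longrightarrow> \<tau> X (mu S X Q) =
      mu T X (\<tau> (fob (fn T) X) (far (fn S) (fob (fn S) X) (fob (fn T) X) (\<tau> X) Q))"
proof -
  have n: "nat_trans (SET U) (SET U) (fn S) (fn T) \<tau>"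
    using assms(1) unfolding monad_morphism_iff[OF assms(2,3)] by (rule conjunct1)
  have m: "\<forall>X\<in>U. (\<forall>x\<in>X. \<tau> X (eta S X x) = eta T X x) \<and>
       (\<forall>Q\<in>fob (fn S) (fob (fn S) X). \<tau> X (mu S X Q) =
          mu T X (\<tau> (fob (fn T) X) (far (fn S) (fob (fn S) X) (fob (fn T) X) (\<tau> X) Q)))"
    using assms(1) unfolding monad_morphism_iff[OF assms(2,3)] by (rule conjunct2)
  show "X \<in> U \<Longrightarrow> \<tau> X \<in> fob (fn S) X \<rightarrow>\<^sub>E fob (fn T) X"
    "X \<in> U \<Longrightarrow> Y \<in> U \<Longrightarrow> f \<in> X \<rightarrow>\<^sub>E Y \<Longrightarrow> q \<in> fob (fn S) X \<Longrightarrow>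
      \<tau> Y (far (fn S) X Y f q) = far (fn T) X Y f (\<tau> X q)"
    using n unfolding nat_trans_SET by simp_all
  show "X \<in> U \<Longrightarrow> x \<in> X \<Longrightarrow> \<tau> X (eta S X x) = eta T X x"
    "X \<in> U \<Longrightarrow> Q \<in> fob (fn S) (fob (fn S) X) \<Longrightarrow> \<tau> X (mu S X Q) =
      mu T X (\<tau> (fob (fn T) X) (far (fn S) (fob (fn S) X) (fob (fn T) X) (\<tau> X) Q))"
    using m by blast+
qed

lemma monad_morphismI:
  assumes "is_monad U S" "is_monad U T"
    and "\<And>X. X \<in> U \<Longrightarrow> \<tau> X \<in> fob (fn S) X \<rightarrow>\<^sub>E fob (fn T) X"
    and "\<And>X Y f q. X \<in> U \<Longrightarrow> Y \<in> U \<Longrightarrow> f \<in> X \<rightarrow>\<^sub>E Y \<Longrightarrow> q \<in> fob (fn S) X \<Longrightarrow>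
      \<tau> Y (far (fn S) X Y f q) = far (fn T) X Y f (\<tau> X q)"
    and "\<And>X x. X \<in> U \<Longrightarrow> x \<in> X \<Longrightarrow> \<tau> X (eta S X x) = eta T X x"
    and "\<And>X Q. X \<in> U \<Longrightarrow> Q \<in> fob (fn S) (fob (fn S) X) \<Longrightarrow> \<tau> X (mu S X Q) =
      mu T X (\<tau> (fob (fn T) X) (far (fn S) (fob (fn S) X) (fob (fn T) X) (\<tau> X) Q))"
  shows "monad_morphism U S T \<tau>"
  unfolding monad_morphism_iff[OF assms(1,2)] nat_trans_SET
  using assms(3-6) is_monadD(1)[OF assms(1)] is_monadD(1)[OF assms(2)] by (intro conjI ballI)

lemma monad_morphism_id:
  assumes T: "is_monad U T" shows "monad_morphism U T T (mid U T)"
proof (rule monad_morphismI[OF T T])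
  note F = set_functorD[OF is_monadD(1)[OF T]]
  show "mid U T X \<in> fob (fn T) X \<rightarrow>\<^sub>E fob (fn T) X" if "X \<in> U" for X
    using that by (simp add: mid_def)
  show "mid U T Y (far (fn T) X Y f q) = far (fn T) X Y f (mid U T X q)"
    if "X \<in> U" "Y \<in> U" "f \<in> X \<rightarrow>\<^sub>E Y" "q \<in> fob (fn T) X" for X Y f q
    using that PiE_mem[OF F(2)[OF that(1-3)]] by simp
  show "mid U T X (eta T X x) = eta T X x" if "X \<in> U" "x \<in> X" for X x
    using that PiE_mem[OF is_monadD(2)[OF T]] by simp
  fix X Q assume X: "X \<in> U" "Q \<in> fob (fn T) (fob (fn T) X)"
  have "far (fn T) (fob (fn T) X) (fob (fn T) X) (mid U T X) Q = Q"
    using F(3)[OF F(1)[OF X(1)] X(2)] X(1) by (simp add: mid_def)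
  then show "mid U T X (mu T X Q) =
    mu T X (mid U T (fob (fn T) X) (far (fn T) (fob (fn T) X) (fob (fn T) X) (mid U T X) Q))"
    using X F(1)[OF X(1)] PiE_mem[OF is_monadD(3)[OF T X(1)]] by simp
qed

lemma monad_morphism_comp:
  assumes R: "is_monad U R" and S: "is_monad U S" and T: "is_monad U T"
    and \<tau>: "monad_morphism U R S \<tau>" and \<sigma>: "monad_morphism U S T \<sigma>"
  shows "monad_morphism U R T (mcomp U R \<sigma> \<tau>)"
proof (rule monad_morphismI[OF R T])
  note FR = set_functorD[OF is_monadD(1)[OF R]] and FS = set_functorD[OF is_monadD(1)[OF S]]
    and FT = set_functorD[OF is_monadD(1)[OF T]]
  note t = monad_morphismD[OF \<tau> R S] and s = monad_morphismD[OF \<sigma> S T]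
  fix X assume X: "X \<in> U"
  show c: "mcomp U R \<sigma> \<tau> X \<in> fob (fn R) X \<rightarrow>\<^sub>E fob (fn T) X"
    using compose_PiE[OF t(1)[OF X] s(1)[OF X]] X by (simp add: mcomp_def)
  show "mcomp U R \<sigma> \<tau> X (eta R X x) = eta T X x" if "x \<in> X" for x
    using X that PiE_mem[OF is_monadD(2)[OF R X] that] t(3) s(3) by simp
  show "mcomp U R \<sigma> \<tau> Y (far (fn R) X Y f q) = far (fn T) X Y f (mcomp U R \<sigma> \<tau> X q)"
    if "Y \<in> U" "f \<in> X \<rightarrow>\<^sub>E Y" "q \<in> fob (fn R) X" for Y f q
    using X that PiE_mem[OF FR(2)[OF X that(1,2)] that(3)] t(2)[OF X that] 
      s(2)[OF X that(1,2) PiE_mem[OF t(1)[OF X] that(3)]] by simp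
  let ?R = "fob (fn R) X" and ?S = "fob (fn S) X" and ?T = "fob (fn T) X"
  have u: "?R \<in> U" "?S \<in> U" "?T \<in> U" using X FR(1) FS(1) FT(1) by blast+
  fix Q assume Q: "Q \<in> fob (fn R) ?R"
  let ?Q = "far (fn R) ?R ?S (\<tau> X) Q"
  have Q1: "?Q \<in> fob (fn R) ?S" using PiE_mem[OF FR(2)[OF u(1,2) t(1)[OF X]] Q] .
  have Q2: "\<tau> ?S ?Q \<in> fob (fn S) ?S" using PiE_mem[OF t(1)[OF u(2)] Q1] .
  have Q3: "far (fn R) ?R ?T (mcomp U R \<sigma> \<tau> X) Q = far (fn R) ?S ?T (\<sigma> X) ?Q"
    using FR(4)[OF u t(1)[OF X] s(1)[OF X] Q] X by (simp add: mcomp_def)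
  have Q4: "far (fn R) ?S ?T (\<sigma> X) ?Q \<in> fob (fn R) ?T" using PiE_mem[OF FR(2)[OF u(2,3) s(1)[OF X]] Q1] .
  have "mcomp U R \<sigma> \<tau> X (mu R X Q) = \<sigma> X (\<tau> X (mu R X Q))"
    using PiE_mem[OF is_monadD(3)[OF R X] Q] X by simp
  also have "\<dots> = \<sigma> X (mu S X (\<tau> ?S ?Q))" by (simp only: t(4)[OF X Q])
  also have "\<dots> = mu T X (\<sigma> ?T (far (fn S) ?S ?T (\<sigma> X) (\<tau> ?S ?Q)))" by (simp only: s(4)[OF X Q2])
  \<comment> \<open>Naturality of \<tau> at the arrow \<open>\<sigma> X\<close> exchanges the two
    transformations.\<close>
  also have "far (fn S) ?S ?T (\<sigma> X) (\<tau> ?S ?Q) = \<tau> ?T (far (fn R) ?S ?T (\<sigma> X) ?Q)"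
    by (rule t(2)[OF u(2,3) s(1)[OF X] Q1, symmetric])
  finally show "mcomp U R \<sigma> \<tau> X (mu R X Q) = mu T X (mcomp U R \<sigma> \<tau> ?T (far (fn R) ?R ?T (mcomp U R \<sigma> \<tau> X) Q))"
    using u(3) Q4 by (simp add: Q3)
qed

lemma transf_eqI:
  assumes "\<sigma> \<in> extensional U" "\<tau> \<in> extensional U"
    and "\<And>X. X \<in> U \<Longrightarrow> \<sigma> X \<in> F X \<rightarrow>\<^sub>E G X" "\<And>X. X \<in> U \<Longrightarrow> \<tau> X \<in> F X \<rightarrow>\<^sub>E G X"
    and "\<And>X q. X \<in> U \<Longrightarrow> q \<in> F X \<Longrightarrow> \<sigma> X q = \<tau> X q"
  shows "\<sigma> = \<tau>"
  by (rule extensionalityI[OF assms(1,2)]) (metis PiE_eqI assms(3-5))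

lemma mcomp_ext [simp]: "mcomp U R \<sigma> \<tau> \<in> extensional U"
  and mid_ext [simp]: "mid U T \<in> extensional U"
  by (simp_all add: mcomp_def mid_def)

lemma Mnd_category: "is_category (Mnd U)"
  unfolding is_category_def
proof (intro conjI ballI)
  fix R S \<tau> assume *: "R \<in> Ob (Mnd U)" "S \<in> Ob (Mnd U)" "\<tau> \<in> Hom (Mnd U) R S"
  then have R: "is_monad U R" and S: "is_monad U S" and \<tau>: "\<tau> \<in> extensional U" "monad_morphism U R S \<tau>" by simp_all
  note t = monad_morphismD[OF \<tau>(2) R S]
  have "mcomp U R \<tau> (mid U R) = \<tau>"
    by (rule transf_eqI[OF mcomp_ext \<tau>(1) _ t(1)])
      (simp_all add: monad_morphismD(1)[OF monad_morphism_comp[OF R R S monad_morphism_id[OF R] \<tau>(2)] R S])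
  then show "Cmp (Mnd U) R R S \<tau> (Idn (Mnd U) R) = \<tau>" by simp
  have "mcomp U R (mid U S) \<tau> = \<tau>"
    by (rule transf_eqI[OF mcomp_ext \<tau>(1) _ t(1)])
      (simp_all add: monad_morphismD(1)[OF monad_morphism_comp[OF R S S \<tau>(2) monad_morphism_id[OF S]] R S]
        PiE_mem[OF t(1)])
  then show "Cmp (Mnd U) R S S (Idn (Mnd U) S) \<tau> = \<tau>" by simp
next
  fix Q R S T \<rho> \<tau> \<sigma>
  assume "Q \<in> Ob (Mnd U)" "R \<in> Ob (Mnd U)" "S \<in> Ob (Mnd U)" "T \<in> Ob (Mnd U)"
    "\<rho> \<in> Hom (Mnd U) Q R" "\<tau> \<in> Hom (Mnd U) R S" "\<sigma> \<in> Hom (Mnd U) S T"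
  then have m: "is_monad U Q" "is_monad U R" "is_monad U S" "is_monad U T"
    and h: "monad_morphism U Q R \<rho>" "monad_morphism U R S \<tau>" "monad_morphism U S T \<sigma>" by simp_all
  note c1 = monad_morphism_comp[OF m(2-4) h(2,3)] and c2 = monad_morphism_comp[OF m(1-3) h(1,2)]
  note d1 = monad_morphism_comp[OF m(1,2,4) h(1) c1] and d2 = monad_morphism_comp[OF m(1,3,4) c2 h(3)]
  have "mcomp U Q (mcomp U R \<sigma> \<tau>) \<rho> = mcomp U Q \<sigma> (mcomp U Q \<tau> \<rho>)"
    by (rule transf_eqI[OF mcomp_ext mcomp_ext monad_morphismD(1)[OF d1 m(1,4)] monad_morphismD(1)[OF d2 m(1,4)]])
      (simp_all add: PiE_mem[OF monad_morphismD(1)[OF h(1) m(1,2)]])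
  then show "Cmp (Mnd U) Q R T (Cmp (Mnd U) R S T \<sigma> \<tau>) \<rho> = Cmp (Mnd U) Q S T \<sigma> (Cmp (Mnd U) Q R S \<tau> \<rho>)"
    by simp
qed (auto intro: monad_morphism_comp monad_morphism_id)

section \<open>Semi-cartesian transformations, and isomorphisms of monads\<close>

lemma semi_cartesian_iff:
  assumes U: "universe U" and n: "nat_trans (SET U) (SET U) F G \<tau>"
  shows "semi_cartesian U F G \<tau> \<longleftrightarrow> (\<forall>X\<in>U. \<forall>Y\<in>U. \<forall>f\<in>X \<rightarrow>\<^sub>E Y. inj_on f X \<longrightarrow>
    (\<forall>u\<in>fob F Y. \<forall>v\<in>fob G X. \<tau> Y u = far G X Y f v \<longrightarrow>
      (\<exists>!w. w \<in> fob F X \<and> far F X Y f w = u \<and> \<tau> X w = v)))"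
proof -
  have nt: "set_functor U F" "set_functor U G" "\<And>X. X \<in> U \<Longrightarrow> \<tau> X \<in> fob F X \<rightarrow>\<^sub>E fob G X"
    "\<And>X Y f q. X \<in> U \<Longrightarrow> Y \<in> U \<Longrightarrow> f \<in> X \<rightarrow>\<^sub>E Y \<Longrightarrow> q \<in> fob F X \<Longrightarrow> \<tau> Y (far F X Y f q) = far G X Y f (\<tau> X q)"
    using n unfolding nat_trans_SET by blast+
  have "pullback (SET U) (fob F X) (fob F Y) (fob G X) (fob G Y) (far F X Y f) (\<tau> X) (\<tau> Y) (far G X Y f) \<longleftrightarrow>
      (\<forall>u\<in>fob F Y. \<forall>v\<in>fob G X. \<tau> Y u = far G X Y f v \<longrightarrow>
        (\<exists>!w. w \<in> fob F X \<and> far F X Y f w = u \<and> \<tau> X w = v))"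
    if "X \<in> U" "Y \<in> U" "f \<in> X \<rightarrow>\<^sub>E Y" for X Y f
    using nt(4)[OF that]
    unfolding pullback_SET_iff[OF U set_functorD(2)[OF nt(1) that] nt(3)[OF that(1)] nt(3)[OF that(2)]
        set_functorD(2)[OF nt(2) that]] set_pullback_def by blast
  then show ?thesis
    unfolding semi_cartesian_def by (simp add: set_monic_iff[OF U] Ball_def imp_conjL)
qed

lemma semi_cartesian_id:
  assumes U: "universe U" and T: "is_monad U T" shows "semi_cartesian U (fn T) (fn T) (mid U T)"
proof -
  note F = set_functorD[OF is_monadD(1)[OF T]]
  have "nat_trans (SET U) (SET U) (fn T) (fn T) (mid U T)"
    using monad_morphism_id[OF T] unfolding monad_morphism_def by blast
  note iff = semi_cartesian_iff[OF U this]
  show ?thesis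
    unfolding iff
  proof (intro ballI impI)
    fix X Y f u v assume "X \<in> U" "Y \<in> U" "u \<in> fob (fn T) Y" "v \<in> fob (fn T) X"
      "mid U T Y u = far (fn T) X Y f v"
    then show "\<exists>!w. w \<in> fob (fn T) X \<and> far (fn T) X Y f w = u \<and> mid U T X w = v"
      by (intro ex1I[of _ v]) (simp, elim conjE, simp)
  qed
qed

text \<open>Pasting of pullback squares: lift first through the square of \<sigma>, then through
  that of \<tau>.\<close>

lemma semi_cartesian_comp:
  assumes U: "universe U" and m: "is_monad U R" "is_monad U S" "is_monad U T"
    and \<tau>: "monad_morphism U R S \<tau>" and \<sigma>: "monad_morphism U S T \<sigma>"
    and s\<tau>: "semi_cartesian U (fn R) (fn S) \<tau>" and s\<sigma>: "semi_cartesian U (fn S) (fn T) \<sigma>"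
  shows "semi_cartesian U (fn R) (fn T) (mcomp U R \<sigma> \<tau>)"
proof -
  have nt: "nat_trans (SET U) (SET U) (fn R) (fn S) \<tau>" "nat_trans (SET U) (SET U) (fn S) (fn T) \<sigma>"
    "nat_trans (SET U) (SET U) (fn R) (fn T) (mcomp U R \<sigma> \<tau>)"
    using \<tau> \<sigma> monad_morphism_comp[OF m \<tau> \<sigma>] unfolding monad_morphism_def by blast+
  note s1 = s\<tau>[unfolded semi_cartesian_iff[OF U nt(1)], rule_format]
    and s2 = s\<sigma>[unfolded semi_cartesian_iff[OF U nt(2)], rule_format]
  show ?thesis
    unfolding semi_cartesian_iff[OF U nt(3)]
  proof (intro ballI impI)
    fix X Y f u v assume *: "X \<in> U" "Y \<in> U" "f \<in> X \<rightarrow>\<^sub>E Y" "inj_on f X"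
      and u: "u \<in> fob (fn R) Y" and v: "v \<in> fob (fn T) X"
      and "mcomp U R \<sigma> \<tau> Y u = far (fn T) X Y f v"
    then have eq: "\<sigma> Y (\<tau> Y u) = far (fn T) X Y f v" by simp
    have tu: "\<tau> Y u \<in> fob (fn S) Y" using PiE_mem[OF monad_morphismD(1)[OF \<tau> m(1,2) *(2)] u] .
    from s2[OF * tu v eq] obtain w where w: "w \<in> fob (fn S) X" "far (fn S) X Y f w = \<tau> Y u" "\<sigma> X w = v"
      and wu: "\<And>w'. w' \<in> fob (fn S) X \<Longrightarrow> far (fn S) X Y f w' = \<tau> Y u \<Longrightarrow> \<sigma> X w' = v \<Longrightarrow> w' = w"
      by blast
    from s1[OF * u w(1) w(2)[symmetric]] obtain p where
      p: "p \<in> fob (fn R) X" "far (fn R) X Y f p = u" "\<tau> X p = w"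
      and pu: "\<And>p'. p' \<in> fob (fn R) X \<Longrightarrow> far (fn R) X Y f p' = u \<Longrightarrow> \<tau> X p' = w \<Longrightarrow> p' = p"
      by blast
    show "\<exists>!w. w \<in> fob (fn R) X \<and> far (fn R) X Y f w = u \<and> mcomp U R \<sigma> \<tau> X w = v"
    proof (rule ex1I[of _ p])
      show "p \<in> fob (fn R) X \<and> far (fn R) X Y f p = u \<and> mcomp U R \<sigma> \<tau> X p = v" using p w *(1) by simp
      fix p' assume p': "p' \<in> fob (fn R) X \<and> far (fn R) X Y f p' = u \<and> mcomp U R \<sigma> \<tau> X p' = v"
      then have "\<sigma> X (\<tau> X p') = v" by (elim conjE) (simp add: *(1))
      moreover have "far (fn S) X Y f (\<tau> X p') = \<tau> Y u"
        using monad_morphismD(2)[OF \<tau> m(1,2) *(1-3), of p'] p' by simp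
      moreover have "\<tau> X p' \<in> fob (fn S) X" using PiE_mem[OF monad_morphismD(1)[OF \<tau> m(1,2) *(1)]] p' by simp
      ultimately have "\<tau> X p' = w" using wu by blast
      then show "p' = p" using pu p' by blast
    qed
  qed
qed

lemma is_subcategory:
  assumes C: "is_category C" and ob: "Ob D \<subseteq> Ob C" and hom: "\<And>x y. Hom D x y \<subseteq> Hom C x y"
    and "Idn D = Idn C" "Cmp D = Cmp C"
    and id: "\<And>x. x \<in> Ob D \<Longrightarrow> Idn D x \<in> Hom D x x"
    and comp: "\<And>x y z f g. x \<in> Ob D \<Longrightarrow> y \<in> Ob D \<Longrightarrow> z \<in> Ob D \<Longrightarrow> f \<in> Hom D x y \<Longrightarrow> g \<in> Hom D y z \<Longrightarrow>
      Cmp D x y z g f \<in> Hom D x z"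
  shows "is_category D"
proof -
  note assoc = C[unfolded is_category_def, THEN conjunct2, THEN conjunct2, THEN conjunct2, rule_format]
  note unit = C[unfolded is_category_def, THEN conjunct2, THEN conjunct2, THEN conjunct1, rule_format]
  show ?thesis
    unfolding is_category_def
  proof (intro conjI ballI id comp)
    fix x y f assume "x \<in> Ob D" "y \<in> Ob D" "f \<in> Hom D x y"
    then have "x \<in> Ob C" "y \<in> Ob C" "f \<in> Hom C x y" using ob hom by blast+
    from unit[OF this] show "Cmp D x x y f (Idn D x) = f" "Cmp D x y y (Idn D y) f = f"
      unfolding assms(4,5) by blast+
  next
    fix w x y z f g h
    assume "w \<in> Ob D" "x \<in> Ob D" "y \<in> Ob D" "z \<in> Ob D" "f \<in> Hom D w x" "g \<in> Hom D x y" "h \<in> Hom D y z"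
    then have "w \<in> Ob C" "x \<in> Ob C" "y \<in> Ob C" "z \<in> Ob C" "f \<in> Hom C w x" "g \<in> Hom C x y" "h \<in> Hom C y z"
      using ob hom by blast+
    from assoc[OF this] show "Cmp D w x z (Cmp D x y z h g) f = Cmp D w y z h (Cmp D w x y g f)"
      unfolding assms(5) .
  qed
qed

lemma SanMnd_category:
  assumes U: "universe U" shows "is_category (SanMnd U)"
proof (rule is_subcategory[OF Mnd_category])
  show "Idn (SanMnd U) T \<in> Hom (SanMnd U) T T" if "T \<in> Ob (SanMnd U)" for T
    using that monad_morphism_id[of U T] semi_cartesian_id[OF U, of T] by simp
  show "Cmp (SanMnd U) R S T \<sigma> \<tau> \<in> Hom (SanMnd U) R T"
    if "R \<in> Ob (SanMnd U)" "S \<in> Ob (SanMnd U)" "T \<in> Ob (SanMnd U)"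
      "\<tau> \<in> Hom (SanMnd U) R S" "\<sigma> \<in> Hom (SanMnd U) S T" for R S T \<tau> \<sigma>
    using that monad_morphism_comp[of U R S T \<tau> \<sigma>] semi_cartesian_comp[OF U, of R S T \<tau> \<sigma>] by simp
qed (auto simp: SanMnd_def)

lemma Pm_functor:
  assumes U: "universe U" shows "is_functor (SanMnd U) (Mnd U) Pm"
  unfolding is_functor_def using Mnd_category SanMnd_category[OF U] by (simp add: Pm_def)

text \<open>The inverses of the components form a family, and cancelling the injective components of
  \<tau> reduces each law for this family to the same law for \<tau>.\<close>

lemma Mnd_isoI:
  assumes S: "S \<in> Ob (Mnd U)" and T: "T \<in> Ob (Mnd U)" and \<tau>: "\<tau> \<in> Hom (Mnd U) S T"
    and bij: "\<And>X. X \<in> U \<Longrightarrow> bij_betw (\<tau> X) (fob (fn S) X) (fob (fn T) X)"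
  shows "is_iso (Mnd U) S T \<tau>"
proof -
  have mS: "is_monad U S" and mT: "is_monad U T" and m\<tau>: "monad_morphism U S T \<tau>"
    using S T \<tau> by simp_all
  note t = monad_morphismD[OF m\<tau> mS mT]
  note FS = set_functorD[OF is_monadD(1)[OF mS]] and FT = set_functorD[OF is_monadD(1)[OF mT]]
  define \<theta> where "\<theta> = (\<lambda>X\<in>U. \<lambda>q\<in>fob (fn T) X. inv_into (fob (fn S) X) (\<tau> X) q)"
  have inj: "p = q" if "X \<in> U" "p \<in> fob (fn S) X" "q \<in> fob (fn S) X" "\<tau> X p = \<tau> X q" for X p q
    using bij[OF that(1)] that(2-4) unfolding bij_betw_def by (auto dest: inj_onD)
  have \<theta>S: "\<theta> X q \<in> fob (fn S) X" and \<tau>\<theta>: "\<tau> X (\<theta> X q) = q" if "X \<in> U" "q \<in> fob (fn T) X" for X q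
    using bij[OF that(1)] that unfolding bij_betw_def by (auto simp: \<theta>_def inv_into_into f_inv_into_f)
  have \<theta>\<tau>: "\<theta> X (\<tau> X q) = q" if "X \<in> U" "q \<in> fob (fn S) X" for X q
    using inj[OF that(1) \<theta>S[OF that(1)] that(2)] \<tau>\<theta>[OF that(1)] PiE_mem[OF t(1)[OF that(1)] that(2)] by simp
  have \<theta>E: "\<theta> X \<in> fob (fn T) X \<rightarrow>\<^sub>E fob (fn S) X" if "X \<in> U" for X
    using that \<theta>S by (auto simp: \<theta>_def intro!: PiE_I)
  have "monad_morphism U T S \<theta>"
  proof (rule monad_morphismI[OF mT mS \<theta>E])
    fix X Y f q assume *: "X \<in> U" "Y \<in> U" "f \<in> X \<rightarrow>\<^sub>E Y" and q: "q \<in> fob (fn T) X"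
    show "\<theta> Y (far (fn T) X Y f q) = far (fn S) X Y f (\<theta> X q)"
    proof (rule inj[OF *(2)])
      have fq: "far (fn T) X Y f q \<in> fob (fn T) Y" using PiE_mem[OF FT(2)[OF *] q] .
      then show "\<theta> Y (far (fn T) X Y f q) \<in> fob (fn S) Y" by (rule \<theta>S[OF *(2)])
      show "far (fn S) X Y f (\<theta> X q) \<in> fob (fn S) Y" using PiE_mem[OF FS(2)[OF *] \<theta>S[OF *(1) q]] .
      show "\<tau> Y (\<theta> Y (far (fn T) X Y f q)) = \<tau> Y (far (fn S) X Y f (\<theta> X q))"
        using t(2)[OF * \<theta>S[OF *(1) q]] \<tau>\<theta>[OF *(1) q] \<tau>\<theta>[OF *(2) fq] by simp
    qed
  next
    fix X x assume X: "X \<in> U" "x \<in> X"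
    show "\<theta> X (eta T X x) = eta S X x"
      using \<theta>\<tau>[OF X(1) PiE_mem[OF is_monadD(2)[OF mS X(1)] X(2)]] t(3)[OF X] by simp
  next
    fix X Q assume X: "X \<in> U" and Q: "Q \<in> fob (fn T) (fob (fn T) X)"
    let ?S = "fob (fn S) X" and ?T = "fob (fn T) X"
    have u: "?S \<in> U" "?T \<in> U" using X FS(1) FT(1) by blast+
    let ?Q = "far (fn T) ?T ?S (\<theta> X) Q"
    have Q1: "?Q \<in> fob (fn T) ?S" using PiE_mem[OF FT(2)[OF u(2,1) \<theta>E[OF X]] Q] .
    have Q2: "\<theta> ?S ?Q \<in> fob (fn S) ?S" by (rule \<theta>S[OF u(1) Q1])
    \<comment> \<open>The functor applied to \<tau> after \<theta> is the identity, so
      \<open>Q\<close> is recovered from \<open>?Q\<close>.\<close>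
    have "compose ?T (\<tau> X) (\<theta> X) = (\<lambda>q\<in>?T. q)"
      by (rule PiE_eqI[OF compose_PiE[OF \<theta>E[OF X] t(1)[OF X]] PiE_restrict_id]) (simp add: \<tau>\<theta> X)
    then have Q3: "far (fn T) ?S ?T (\<tau> X) ?Q = Q"
      using FT(4)[OF u(2,1,2) \<theta>E[OF X] t(1)[OF X] Q] FT(3)[OF u(2) Q] by simp
    have "\<tau> X (mu S X (\<theta> ?S ?Q)) = mu T X (\<tau> ?T (far (fn S) ?S ?T (\<tau> X) (\<theta> ?S ?Q)))" by (rule t(4)[OF X Q2])
    also have "\<dots> = mu T X Q"
      using t(2)[OF u t(1)[OF X] Q2] \<tau>\<theta>[OF u(1) Q1] Q3 by simp
    finally have "\<tau> X (mu S X (\<theta> ?S ?Q)) = mu T X Q" .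
    then show "\<theta> X (mu T X Q) = mu S X (\<theta> ?S ?Q)"
      using \<theta>\<tau>[OF X PiE_mem[OF is_monadD(3)[OF mS X] Q2]] by simp
  qed
  then have \<theta>: "\<theta> \<in> Hom (Mnd U) T S" by (simp add: \<theta>_def)
  have "mcomp U S \<theta> \<tau> = mid U S"
    by (rule transf_eqI[OF mcomp_ext mid_ext, where F = "fob (fn S)" and G = "fob (fn S)"])
      (simp_all add: \<theta>\<tau>, simp_all add: mcomp_def mid_def compose_PiE[OF t(1) \<theta>E])
  moreover have "mcomp U T \<tau> \<theta> = mid U T"
    by (rule transf_eqI[OF mcomp_ext mid_ext, where F = "fob (fn T)" and G = "fob (fn T)"])
      (simp_all add: \<tau>\<theta>, simp_all add: mcomp_def mid_def compose_PiE[OF \<theta>E t(1)])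
  ultimately show ?thesis
    unfolding is_iso_def using \<tau> \<theta> by (simp del: Mnd_simps(2)) blast
qed

text \<open>The comparison is built from the regular side to the full side, opposite to the
  direction in which the isomorphism is finally stated.\<close>

lemma nat_iso_inverse:
  assumes C: "is_category C" and D: "is_category D" and "nat_iso C D F G \<theta>"
  shows "\<exists>\<tau>. nat_iso C D G F \<tau>"
proof -
  have n: "nat_trans C D F G \<theta>" and iso: "\<And>x. x \<in> Ob C \<Longrightarrow> is_iso D (fob F x) (fob G x) (\<theta> x)"
    using assms(3) unfolding nat_iso_def by blast+
  have FG: "is_functor C D F" "is_functor C D G" using n unfolding nat_trans_def by blast+
  note assoc = D[unfolded is_category_def, THEN conjunct2, THEN conjunct2, THEN conjunct2, rule_format]
  note unit = D[unfolded is_category_def, THEN conjunct2, THEN conjunct2, THEN conjunct1, rule_format]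
  have th: "\<theta> x \<in> Hom D (fob F x) (fob G x)" if "x \<in> Ob C" for x
    using n that unfolding nat_trans_def by blast
  have nat: "Cmp D (fob F x) (fob F y) (fob G y) (\<theta> y) (far F x y f) =
      Cmp D (fob F x) (fob G x) (fob G y) (far G x y f) (\<theta> x)"
    if "x \<in> Ob C" "y \<in> Ob C" "f \<in> Hom C x y" for x y f
    using n that unfolding nat_trans_def by blast
  have "\<exists>g. g \<in> Hom D (fob G x) (fob F x) \<and>
      Cmp D (fob F x) (fob G x) (fob F x) g (\<theta> x) = Idn D (fob F x) \<and>
      Cmp D (fob G x) (fob F x) (fob G x) (\<theta> x) g = Idn D (fob G x)" if "x \<in> Ob C" for x
    using iso[OF that] unfolding is_iso_def by blast
  then obtain \<tau> where \<tau>: "\<And>x. x \<in> Ob C \<Longrightarrow> \<tau> x \<in> Hom D (fob G x) (fob F x)"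
    "\<And>x. x \<in> Ob C \<Longrightarrow> Cmp D (fob F x) (fob G x) (fob F x) (\<tau> x) (\<theta> x) = Idn D (fob F x)"
    "\<And>x. x \<in> Ob C \<Longrightarrow> Cmp D (fob G x) (fob F x) (fob G x) (\<theta> x) (\<tau> x) = Idn D (fob G x)"
    by metis
  have "Cmp D (fob G x) (fob G y) (fob F y) (\<tau> y) (far G x y f) =
      Cmp D (fob G x) (fob F x) (fob F y) (far F x y f) (\<tau> x)"
    if x: "x \<in> Ob C" and y: "y \<in> Ob C" and f: "f \<in> Hom C x y" for x y f
  proof -
    have o: "fob F x \<in> Ob D" "fob F y \<in> Ob D" "fob G x \<in> Ob D" "fob G y \<in> Ob D"
      and m: "far F x y f \<in> Hom D (fob F x) (fob F y)" "far G x y f \<in> Hom D (fob G x) (fob G y)"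
      using FG x y f unfolding is_functor_def by blast+
    note c = is_categoryD(2)[OF D]
    have Gt: "Cmp D (fob F x) (fob G x) (fob G y) (far G x y f) (\<theta> x) \<in> Hom D (fob F x) (fob G y)"
      by (rule c[OF o(1,3,4) th[OF x] m(2)])
    have "Cmp D (fob G x) (fob G y) (fob F y) (\<tau> y) (far G x y f) =
        Cmp D (fob G x) (fob G y) (fob F y) (\<tau> y)
          (Cmp D (fob G x) (fob G x) (fob G y) (far G x y f)
            (Cmp D (fob G x) (fob F x) (fob G x) (\<theta> x) (\<tau> x)))"
      by (simp only: \<tau>(3)[OF x] conjunct1[OF unit[OF o(3,4) m(2)]])
    also have "Cmp D (fob G x) (fob G x) (fob G y) (far G x y f)
        (Cmp D (fob G x) (fob F x) (fob G x) (\<theta> x) (\<tau> x)) =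
      Cmp D (fob G x) (fob F x) (fob G y)
        (Cmp D (fob F x) (fob F y) (fob G y) (\<theta> y) (far F x y f)) (\<tau> x)"
      by (simp only: nat[OF x y f] assoc[OF o(3,1,3,4) \<tau>(1)[OF x] th[OF x] m(2)])
    also have "\<dots> = Cmp D (fob G x) (fob F y) (fob G y) (\<theta> y) (Cmp D (fob G x) (fob F x) (fob F y) (far F x y f) (\<tau> x))"
      by (rule assoc[OF o(3,1,2,4) \<tau>(1)[OF x] m(1) th[OF y]])
    also have "Cmp D (fob G x) (fob G y) (fob F y) (\<tau> y) \<dots> =
      Cmp D (fob G x) (fob F y) (fob F y) (Cmp D (fob F y) (fob G y) (fob F y) (\<tau> y) (\<theta> y))
        (Cmp D (fob G x) (fob F x) (fob F y) (far F x y f) (\<tau> x))"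
      by (rule assoc[OF o(3,2,4,2) c[OF o(3,1,2) \<tau>(1)[OF x] m(1)] th[OF y] \<tau>(1)[OF y], symmetric])
    also have "\<dots> = Cmp D (fob G x) (fob F x) (fob F y) (far F x y f) (\<tau> x)"
      by (simp only: \<tau>(2)[OF y] conjunct2[OF unit[OF o(3,2) c[OF o(3,1,2) \<tau>(1)[OF x] m(1)]]])
    finally show ?thesis .
  qed
  then have "nat_iso C D G F \<tau>"
    unfolding nat_iso_def nat_trans_def is_iso_def using FG \<tau> th by blast
  then show ?thesis by (rule exI[of "nat_iso C D G F"])
qed

section \<open>Operad morphisms\<close>

lemma Operads_simps [simp]:
  "A \<in> Ob (Operads U H) \<longleftrightarrow> is_operad U H A"
  "h \<in> Hom (Operads U H) A B \<longleftrightarrow> operad_morphism H A B h"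
  "Idn (Operads U H) A = (\<lambda>n. \<lambda>a\<in>ops A n. a)"
  "Cmp (Operads U H) A B C g h = (\<lambda>n. compose (ops A n) (g n) (h n))"
  by (simp_all add: Operads_def)

lemma operad_morphismD:
  assumes "operad_morphism H A B h"
  shows "h n \<in> ops A n \<rightarrow>\<^sub>E ops B n" "h (Suc 0) (iota A) = iota B"
    "\<phi> \<in> H n m \<Longrightarrow> a \<in> ops A n \<Longrightarrow> h m (act A m \<phi> a) = act B m \<phi> (h n a)"
  using assms unfolding operad_morphism_def by simp_all

lemma operad_morphism_opm:
  assumes "operad_morphism H A B h" "\<And>p. p \<in> set L \<Longrightarrow> b p \<in> ops A (k p)" "a \<in> ops A (length L)"
  shows "h (sum_list (map k L)) (opm A (map k L) (map b L) a) =
    opm B (map k L) (map (\<lambda>p. h (k p) (b p)) L) (h (length L) a)"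
proof -
  have "has_arities A (map k L) (map b L) \<and> a \<in> ops A (length (map k L))"
    using assms(2,3) by (simp add: has_arities_map)
  then have "h (sum_list (map k L)) (opm A (map k L) (map b L) a) =
      opm B (map k L) (map2 h (map k L) (map b L)) (h (length (map k L)) a)"
    using assms(1) unfolding operad_morphism_def by blast
  moreover have "map2 h (map k L) (map b L) = map (\<lambda>p. h (k p) (b p)) L"
    by (induction L) simp_all
  ultimately show ?thesis by simp
qed

lemma operad_morphismI:
  assumes "\<And>n. h n \<in> ops A n \<rightarrow>\<^sub>E ops B n" "h (Suc 0) (iota A) = iota B"
    and "\<And>n m \<phi> a. \<phi> \<in> H n m \<Longrightarrow> a \<in> ops A n \<Longrightarrow> h m (act A m \<phi> a) = act B m \<phi> (h n a)"
    and "\<And>L a. (\<And>n b. (n, b) \<in> set L \<Longrightarrow> b \<in> ops A n) \<Longrightarrow> a \<in> ops A (length L) \<Longrightarrow>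
      h (sum_list (map fst L)) (opm A (map fst L) (map snd L) a) =
      opm B (map fst L) (map (\<lambda>(n, b). h n b) L) (h (length L) a)"
  shows "operad_morphism H A B h"
proof -
  have "h (sum_list ns) (opm A ns bs a) = opm B ns (map2 h ns bs) (h (length ns) a)"
    if "has_arities A ns bs" "a \<in> ops A (length ns)" for ns bs a
  proof -
    have len: "length ns = length bs" using that(1) by (auto simp: has_arities_def list_all2_lengthD)
    have "b \<in> ops A n" if "(n, b) \<in> set (zip ns bs)" for n b
      using that \<open>has_arities A ns bs\<close> by (auto simp: has_arities_def list_all2_iff)
    from assms(4)[of "zip ns bs" a, OF this] that(2) len show ?thesis by simp
  qed
  then show ?thesis unfolding operad_morphism_def using assms(1-3) by simp
qed

lemma operad_morphism_id:
  assumes "small_operad U H A" shows "operad_morphism H A A (\<lambda>n. \<lambda>a\<in>ops A n. a)"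
proof -
  interpret small_operad U H A by fact
  show ?thesis
  proof (rule operad_morphismI)
    fix L a assume L: "\<And>n b. (n, b) \<in> set L \<Longrightarrow> b \<in> ops A n" and a: "a \<in> ops A (length L)"
    have "opm A (map fst L) (map snd L) a \<in> ops A (sum_list (map fst L))"
      using L a by (intro opm_ops_list) auto
    moreover have L': "map (\<lambda>(n, b). (\<lambda>a\<in>ops A n. a) b) L = map snd L" using L by auto
    ultimately show "(\<lambda>a\<in>ops A (sum_list (map fst L)). a) (opm A (map fst L) (map snd L) a) =
      opm A (map fst L) (map (\<lambda>(n, b). (\<lambda>a\<in>ops A n. a) b) L) ((\<lambda>a\<in>ops A (length L). a) a)"
      unfolding L' using a by simp
  qed (simp_all add: iota_ops act_ops)
qed

lemma operad_morphism_comp: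
  assumes "small_operad U H A" and h: "operad_morphism H A B h" and g: "operad_morphism H B C g"
  shows "operad_morphism H A C (\<lambda>n. compose (ops A n) (g n) (h n))"
proof -
  interpret small_operad U H A by fact
  note hD = operad_morphismD[OF h] and gD = operad_morphismD[OF g]
  have hB: "h n a \<in> ops B n" if "a \<in> ops A n" for n a using PiE_mem[OF hD(1) that] .
  show ?thesis
  proof (rule operad_morphismI)
    show "compose (ops A n) (g n) (h n) \<in> ops A n \<rightarrow>\<^sub>E ops C n" for n
      by (rule compose_PiE[OF hD(1) gD(1)])
    show "compose (ops A (Suc 0)) (g (Suc 0)) (h (Suc 0)) (iota A) = iota C"
      by (simp add: iota_ops hD gD)
    show "compose (ops A m) (g m) (h m) (act A m \<phi> a) = act C m \<phi> (compose (ops A n) (g n) (h n) a)"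
      if "\<phi> \<in> H n m" "a \<in> ops A n" for n m \<phi> a
      using that by (simp add: act_ops hD(3) gD(3) hB)
    fix L a assume L: "\<And>n b. (n, b) \<in> set L \<Longrightarrow> b \<in> ops A n" and a: "a \<in> ops A (length L)"
    have L': "snd p \<in> ops A (fst p)" if "p \<in> set L" for p using L[of "fst p" "snd p"] that by simp
    have "opm A (map fst L) (map snd L) a \<in> ops A (sum_list (map fst L))"
      by (rule opm_ops_list[OF L' a])
    then have "compose (ops A (sum_list (map fst L))) (g (sum_list (map fst L))) (h (sum_list (map fst L)))
        (opm A (map fst L) (map snd L) a) =
        g (sum_list (map fst L)) (opm B (map fst L) (map (\<lambda>p. h (fst p) (snd p)) L) (h (length L) a))"
      by (simp add: operad_morphism_opm[OF h L' a])
    also have "\<dots> = opm C (map fst L) (map (\<lambda>p. g (fst p) (h (fst p) (snd p))) L) (g (length L) (h (length L) a))"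
      by (rule operad_morphism_opm[OF g hB[OF L'] hB[OF a]])
    also have "map (\<lambda>p. g (fst p) (h (fst p) (snd p))) L = map (\<lambda>(n, b). compose (ops A n) (g n) (h n) b) L"
      using L' by (auto simp: case_prod_beta)
    finally show "compose (ops A (sum_list (map fst L))) (g (sum_list (map fst L))) (h (sum_list (map fst L)))
        (opm A (map fst L) (map snd L) a) = opm C (map fst L) (map (\<lambda>(n, b). compose (ops A n) (g n) (h n) b) L)
        (compose (ops A (length L)) (g (length L)) (h (length L)) a)"
      using a by simp
  qed
qed

lemma Operads_category:
  assumes U: "universe U" and H: "ordinal_cat H" shows "is_category (Operads U H)"
proof -
  have so: "small_operad U H A" if "is_operad U H A" for A :: "'a operad"
    using that U H by unfold_locales
  show ?thesis
    unfolding is_category_def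
  proof (intro conjI ballI)
    fix A B h assume "A \<in> Ob (Operads U H)" "B \<in> Ob (Operads U H)" "h \<in> Hom (Operads U H) A B"
    then have h: "h n \<in> ops A n \<rightarrow>\<^sub>E ops B n" for n using operad_morphismD(1)[of H A B h n] by simp
    show "Cmp (Operads U H) A A B h (Idn (Operads U H) A) = h"
      "Cmp (Operads U H) A B B (Idn (Operads U H) B) h = h"
      using compose_restrict_id[OF h] by (simp_all add: fun_eq_iff)
  next
    fix A B C D f g h
    assume "A \<in> Ob (Operads U H)" "f \<in> Hom (Operads U H) A B"
    then have f: "f n \<in> ops A n \<rightarrow>\<^sub>E ops B n" for n using operad_morphismD(1)[of H A B f n] by simp
    show "Cmp (Operads U H) A B D (Cmp (Operads U H) B C D h g) f =
      Cmp (Operads U H) A C D h (Cmp (Operads U H) A B C g f)"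
      using PiE_mem[OF f] by (auto intro!: compose_eqI)
  qed (auto intro: operad_morphism_id[OF so] operad_morphism_comp[OF so])
qed

text \<open>\<open>H\<close> may be properly contained in \<open>K\<close>: the comparison leads
  from \<open>SS\<close> to \<open>FF\<close> along a map that is required to respect
  surjections.\<close>

locale tuple_quotient_hom = S: tuple_quotient U H A obS clS + T: tuple_quotient U K B obT clT
  for U :: "'u set set" and H A obS clS K B obT clT +
  fixes h :: "nat \<Rightarrow> 'u \<Rightarrow> 'u"
  assumes sub: "\<phi> \<in> H n m \<Longrightarrow> \<phi> \<in> K n m" and hom: "operad_morphism H A B h"
begin

lemma hom_ops: "a \<in> ops A n \<Longrightarrow> h n a \<in> ops B n"
  using PiE_mem[OF operad_morphismD(1)[OF hom]] .

lemma hom_pairs: "(x, a) \<in> pairs A P \<Longrightarrow> (x, h (length x) a) \<in> pairs B P"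
  using hom_ops by (simp add: pairs_def)

lemma hom_wd:
  assumes X: "X \<in> U" and p: "(x, a) \<in> pairs A (lists X)" "(y, b) \<in> pairs A (lists X)"
    and eq: "clS X x a = clS X y b"
  shows "clT X x (h (length x) a) = clT X y (h (length y) b)"
proof (rule S.cl_lift[OF X p eq])
  fix x \<phi> a n assume x: "set x \<subseteq> X" "\<phi> \<in> H n (length x)" "a \<in> ops A n"
  show "clT X (x \<odot> \<phi>) (h (length (x \<odot> \<phi>)) a) = clT X x (h (length x) (act A (length x) \<phi> a))"
    using T.cl_tcomp[OF X x(1) sub[OF x(2)] hom_ops[OF x(3)]] operad_morphismD(3)[OF hom x(2,3)]
      S.H_length[OF x(2)] by simp
qed

end

text \<open>One pattern for the maps induced by operad morphisms on either side and for the
  comparison: the tuple stays, the operation is sent through \<open>h\<close>.\<close>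

locale tuple_monad_hom = tuple_quotient_hom U H A obS clS K B obT clT h +
    S: tuple_monad U H A obS clS M + T: tuple_monad U K B obT clT N
  for U :: "'u set set" and H A obS clS K B obT clT h M N +
  fixes \<sigma> :: "'u set \<Rightarrow> 'u \<Rightarrow> 'u"
  assumes \<sigma>_cl: "X \<in> U \<Longrightarrow> (x, a) \<in> pairs A (lists X) \<Longrightarrow> \<sigma> X (clS X x a) = clT X x (h (length x) a)"
    and \<sigma>_ext: "X \<in> U \<Longrightarrow> \<sigma> X \<in> extensional (obS X)"
begin

lemma \<sigma>_in: "X \<in> U \<Longrightarrow> \<sigma> X \<in> obS X \<rightarrow>\<^sub>E obT X"
proof (rule PiE_I)
  fix q assume X: "X \<in> U" and "q \<in> obS X"
  from this(2,1) obtain x a where "(x, a) \<in> pairs A (lists X)" "q = clS X x a" by (rule S.ob_cases)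
  with X show "\<sigma> X q \<in> obT X" by (simp add: \<sigma>_cl T.cl_in_ob hom_pairs)
qed (rule extensional_arb[OF \<sigma>_ext])

text \<open>Tuples are concatenated in the same way on both sides, so compatibility with
  multiplication comes down to \<open>h\<close> preserving \<open>opm\<close>.\<close>

lemma monad_morphism_\<sigma>: "monad_morphism U M N \<sigma>"
proof (rule monad_morphismI[OF S.is_monad_T T.is_monad_T], unfold S.fob_T T.fob_T)
  fix X assume X: "X \<in> U"
  show "\<sigma> X \<in> obS X \<rightarrow>\<^sub>E obT X" by (rule \<sigma>_in[OF X])
  show "\<sigma> X (eta M X x) = eta N X x" if "x \<in> X" for x
    using that X operad_morphismD(2)[OF hom] \<sigma>_cl[OF X, of "[x]" "iota A"] S.iota_ops
    by (simp add: S.eta_T T.eta_T pairs_lists_iff)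
  show "\<sigma> Y (far (fn M) X Y f q) = far (fn N) X Y f (\<sigma> X q)"
    if *: "Y \<in> U" "f \<in> X \<rightarrow>\<^sub>E Y" "q \<in> obS X" for Y f q
  proof -
    from *(3) X obtain x a where xa: "(x, a) \<in> pairs A (lists X)" "q = clS X x a" by (rule S.ob_cases)
    show ?thesis
      using S.far_cl[OF X *(1,2) xa(1)] T.far_cl[OF X *(1,2) hom_pairs[OF xa(1)]]
        \<sigma>_cl[OF X xa(1)] \<sigma>_cl[OF *(1) S.map_pairs[OF *(2) xa(1)]] by (simp add: xa(2))
  qed
  fix Q assume Q: "Q \<in> obS (obS X)"
  from Q X obtain ps t where ps: "set ps \<subseteq> pairs A (lists X)" "t \<in> ops A (length ps)"
    "Q = clS (obS X) (map (S.pc X) ps) t" by (rule S.ob_ob_cases)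
  let ?qs = "map (\<lambda>p. (fst p, h (length (fst p)) (snd p))) ps"
  have p: "(fst p, snd p) \<in> pairs A (lists X)" if "p \<in> set ps" for p using ps(1) that by auto
  have qs: "set ?qs \<subseteq> pairs B (lists X)" using hom_pairs[OF p] by auto
  have m: "(map (S.pc X) ps, t) \<in> pairs A (lists (obS X))" by (rule S.map_pc_pairs[OF X ps(1,2)])
  have "\<sigma> X (S.pc X p) = T.pc X (fst p, h (length (fst p)) (snd p))" if "p \<in> set ps" for p
    using \<sigma>_cl[OF X p[OF that]] by (simp add: S.pc_def T.pc_def case_prod_beta)
  then have eq: "map (\<sigma> X) (map (S.pc X) ps) = map (T.pc X) ?qs" by simp
  have m': "(map (T.pc X) ?qs, t) \<in> pairs A (lists (obT X))"
    using S.map_pairs[OF \<sigma>_in[OF X] m] unfolding eq .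
  have "\<sigma> (obT X) (far (fn M) (obS X) (obT X) (\<sigma> X) Q) = clT (obT X) (map (T.pc X) ?qs) (h (length ?qs) t)"
    using S.far_cl[OF S.ob_small[OF X] T.ob_small[OF X] \<sigma>_in[OF X] m] \<sigma>_cl[OF T.ob_small[OF X] m']
    by (simp only: ps(3) eq length_map)
  then have "mu N X (\<sigma> (obT X) (far (fn M) (obS X) (obT X) (\<sigma> X) Q)) = T.conc X ?qs (h (length ps) t)"
    using T.mu_cl[OF X qs] hom_ops[OF ps(2)] by (simp only: length_map)
  also have "\<dots> = clT X (concat (map fst ps)) (opm B (map (\<lambda>p. length (fst p)) ps)
      (map (\<lambda>p. h (length (fst p)) (snd p)) ps) (h (length ps) t))"
    by (simp add: T.conc_def comp_def)
  also have "opm B (map (\<lambda>p. length (fst p)) ps) (map (\<lambda>p. h (length (fst p)) (snd p)) ps) (h (length ps) t) =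
      h (length (concat (map fst ps))) (opm A (map (\<lambda>p. length (fst p)) ps) (map snd ps) t)"
  proof -
    have "snd p \<in> ops A (length (fst p))" if "p \<in> set ps" for p
      using p[OF that] unfolding pairs_lists_iff by blast
    from operad_morphism_opm[OF hom this ps(2)] show ?thesis
      by (simp add: length_concat comp_def)
  qed
  also have "clT X (concat (map fst ps)) \<dots> = \<sigma> X (S.conc X ps t)"
    unfolding S.conc_def by (rule \<sigma>_cl[OF X S.conc_pairs[OF ps(1,2)], symmetric])
  finally show "\<sigma> X (mu M X Q) = mu N X (\<sigma> (obT X) (far (fn M) (obS X) (obT X) (\<sigma> X) Q))"
    using S.mu_cl[OF X ps(1,2)] ps(3) by simp
qed

end

text \<open>A transformation of this pattern is determined by \<open>h\<close>; preservation of
  identities and composites, for the full and for the regular side, follows from this and the next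
  lemma.\<close>

lemma tuple_monad_hom_id:
  assumes hom: "tuple_monad_hom U H A ob cl H A ob cl (\<lambda>n. \<lambda>a\<in>ops A n. a) M M \<sigma>"
    and ext: "\<sigma> \<in> extensional U"
  shows "\<sigma> = mid U M"
proof -
  interpret tuple_monad_hom U H A ob cl H A ob cl "\<lambda>n. \<lambda>a\<in>ops A n. a" M M \<sigma> by (rule hom)
  show ?thesis
  proof (rule transf_eqI[OF ext mid_ext \<sigma>_in])
    show "mid U M X \<in> ob X \<rightarrow>\<^sub>E ob X" if "X \<in> U" for X
      using that by (simp add: mid_def S.fob_T)
    fix X q assume X: "X \<in> U" and q: "q \<in> ob X"
    from q X obtain x a where xa: "(x, a) \<in> pairs A (lists X)" "q = cl X x a" by (rule S.ob_cases)
    have "\<sigma> X q = q" unfolding xa(2) \<sigma>_cl[OF X xa(1)] using xa(1) by (simp add: pairs_def)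
    then show "\<sigma> X q = mid U M X q" using X q by (simp add: S.fob_T)
  qed
qed

lemma tuple_monad_hom_comp:
  assumes h: "tuple_monad_hom U H A obA clA K B obB clB h L M \<sigma>"
    and g: "tuple_monad_hom U K B obB clB G C obC clC g M N \<tau>"
    and gh: "tuple_monad_hom U H A obA clA G C obC clC (\<lambda>n. compose (ops A n) (g n) (h n)) L N \<rho>"
    and ext: "\<rho> \<in> extensional U"
  shows "\<rho> = mcomp U L \<tau> \<sigma>"
proof -
  interpret h: tuple_monad_hom U H A obA clA K B obB clB h L M \<sigma> by (rule h)
  interpret g: tuple_monad_hom U K B obB clB G C obC clC g M N \<tau> by (rule g)
  interpret gh: tuple_monad_hom U H A obA clA G C obC clC "\<lambda>n. compose (ops A n) (g n) (h n)" L N \<rho>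
    by (rule gh)
  show ?thesis
  proof (rule transf_eqI[OF ext mcomp_ext gh.\<sigma>_in])
    show "mcomp U L \<tau> \<sigma> X \<in> obA X \<rightarrow>\<^sub>E obC X" if "X \<in> U" for X
      using compose_PiE[OF h.\<sigma>_in[OF that] g.\<sigma>_in[OF that]] that by (simp add: mcomp_def h.S.fob_T)
    fix X q assume X: "X \<in> U" and q: "q \<in> obA X"
    from q X obtain x a where xa: "(x, a) \<in> pairs A (lists X)" "q = clA X x a" by (rule h.S.ob_cases)
    have "\<rho> X q = \<tau> X (\<sigma> X q)"
      unfolding xa(2) gh.\<sigma>_cl[OF X xa(1)] h.\<sigma>_cl[OF X xa(1)] g.\<sigma>_cl[OF X h.hom_pairs[OF xa(1)]]
      using xa(1) by (simp add: pairs_def)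
    then show "\<rho> X q = mcomp U L \<tau> \<sigma> X q" using X q by (simp add: h.S.fob_T)
  qed
qed

section \<open>The monad of a full operad\<close>

text \<open>Merges the parallel lists in the definitions of the multiplications into one list of
  decorated tuples, the form in which \<open>conc\<close> is stated.\<close>

lemma list_all2_pairs:
  "list_all2 (\<lambda>x s. (x, s) \<in> P) xs ss \<longleftrightarrow> (\<exists>ps. set ps \<subseteq> P \<and> xs = map fst ps \<and> ss = map snd ps)"
proof
  assume *: "list_all2 (\<lambda>x s. (x, s) \<in> P) xs ss"
  then show "\<exists>ps. set ps \<subseteq> P \<and> xs = map fst ps \<and> ss = map snd ps"
    by (intro exI[of _ "zip xs ss"]) (auto simp: list_all2_iff)
next
  assume "\<exists>ps. set ps \<subseteq> P \<and> xs = map fst ps \<and> ss = map snd ps"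
  then show "list_all2 (\<lambda>x s. (x, s) \<in> P) xs ss"
    by (auto simp: list_all2_map1 list_all2_map2 list_all2_same)
qed

lemma ex_list_all2_pairs:
  "(\<exists>xs ss t. list_all2 (\<lambda>x s. (x, s) \<in> P) xs ss \<and> Q xs ss t) \<longleftrightarrow>
    (\<exists>ps t. set ps \<subseteq> P \<and> Q (map fst ps) (map snd ps) t)"
  unfolding list_all2_pairs by blast

lemma map2_pairs: "map2 f (map fst ps) (map snd ps) = map (\<lambda>(x, a). f x a) ps"
  by (induction ps) auto

lemma Mf_quotient:
  assumes "universe U" "is_operad U FF A"
  shows "tuple_quotient U FF A (Mf_ob A) (Mf_cls A)"
proof -
  interpret small_operad U FF A using assms ordinal_cat_FF by unfold_locales
  show ?thesis
  proof
    fix X assume X: "X \<in> U"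
    show "Mf_ob A X = (\<lambda>(x, a). Mf_cls A X x a) ` pairs A (lists X)"
      by (auto simp: Mf_ob_def Mf_cls_def tensor_eq)
    show "Mf_ob A X \<in> U"
      unfolding Mf_ob_def by (rule tensor_small[OF small_member[OF X] order_refl])
    show "Mf_cls A X x a = Mf_cls A X y b \<longleftrightarrow> ((x, a), (y, b)) \<in> glue_eq A FF (lists X)"
      if "(x, a) \<in> pairs A (lists X)" "(y, b) \<in> pairs A (lists X)" for x a y b
      unfolding Mf_cls_def by (rule cls_eq_iff[OF small_member[OF X] order_refl that])
  qed
qed

lemma Mf_simps [simp]:
  "fob (fn (fob (Mf U) A)) = Mf_ob A" "far (fn (fob (Mf U) A)) = Mf_far A"
  "eta (fob (Mf U) A) = Mf_eta A" "mu (fob (Mf U) A) = Mf_mu A" "far (Mf U) A B h = Mf_map U A B h"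
  by (simp_all add: Mf_def)

lemma Mf_monad:
  assumes "universe U" "is_operad U FF A"
  shows "tuple_monad U FF A (Mf_ob A) (Mf_cls A) (fob (Mf U) A)"
proof -
  interpret tuple_quotient U FF A "Mf_ob A" "Mf_cls A" by (rule Mf_quotient[OF assms])
  show ?thesis
  proof (unfold_locales, unfold Mf_simps)
    show "Mf_ob A = Mf_ob A" by (rule refl)
    show "Mf_far A X Y f \<in> extensional (Mf_ob A X)" for X Y f by (simp add: Mf_far_def)
    show "Mf_eta A X = (\<lambda>x\<in>X. Mf_cls A X [x] (iota A))" if "X \<in> U" for X by (rule Mf_eta_def)
    show "Mf_mu A X \<in> extensional (Mf_ob A (Mf_ob A X))" for X by (simp add: Mf_mu_def)
  next
    fix X Y f x a
    assume *: "X \<in> U" "Y \<in> U" "f \<in> X \<rightarrow>\<^sub>E Y" and xa: "(x, a) \<in> pairs A (lists X)"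
    have "(THE q'. \<exists>y t. (y, t) \<in> pairs A (lists X) \<and> Mf_cls A X x a = Mf_cls A X y t \<and>
        q' = Mf_cls A Y (map f y) t) = Mf_cls A Y (map f x) a"
      by (rule the_equality) (use xa map_wd[OF * xa] in blast, use map_wd[OF * xa] in metis)
    then show "Mf_far A X Y f (Mf_cls A X x a) = Mf_cls A Y (map f x) a"
      using cl_in_ob[OF *(1) xa] by (simp add: Mf_far_def)
  next
    fix X ps t assume X: "X \<in> U" and ps: "set ps \<subseteq> pairs A (lists X)" "t \<in> ops A (length ps)"
    let ?Q = "Mf_cls A (Mf_ob A X) (map (pc X) ps) t"
    \<comment> \<open>The predicate under the description in \<open>Mf_mu\<close>; rephrased with a
      list of pairs, its uniqueness is \<open>conc_wd\<close>.\<close>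
    define P where "P q' \<longleftrightarrow> (\<exists>xs ss t. list_all2 (\<lambda>x s. (x, s) \<in> pairs A (lists X)) xs ss \<and>
      t \<in> ops A (length xs) \<and> ?Q = Mf_cls A (Mf_ob A X) (map2 (Mf_cls A X) xs ss) t \<and>
      q' = Mf_cls A X (concat xs) (opm A (map length xs) ss t))" for q'
    have P: "P q' \<longleftrightarrow> (\<exists>rs u. set rs \<subseteq> pairs A (lists X) \<and> u \<in> ops A (length rs) \<and>
        ?Q = Mf_cls A (Mf_ob A X) (map (pc X) rs) u \<and> q' = conc X rs u)" for q'
      unfolding P_def ex_list_all2_pairs map2_pairs pc_def[symmetric]
      by (simp only: conc_def map_map comp_def length_map zip_map_fst_snd)
    have "(THE q'. P q') = conc X ps t"
    proof (rule the_equality)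
      show "P (conc X ps t)" unfolding P using ps by blast
      show "q' = conc X ps t" if "P q'" for q'
        using that conc_wd[OF X ps] unfolding P by metis
    qed
    then show "Mf_mu A X ?Q = conc X ps t"
      using cl_in_ob[OF ob_small[OF X] map_pc_pairs[OF X ps]] by (simp add: Mf_mu_def P_def)
  qed
qed

lemma Mf_hom:
  assumes U: "universe U" and A: "is_operad U FF A" and B: "is_operad U FF B"
    and h: "operad_morphism FF A B h"
  shows "tuple_monad_hom U FF A (Mf_ob A) (Mf_cls A) FF B (Mf_ob B) (Mf_cls B) h
    (fob (Mf U) A) (fob (Mf U) B) (Mf_map U A B h)"
proof -
  interpret S: tuple_monad U FF A "Mf_ob A" "Mf_cls A" "fob (Mf U) A" by (rule Mf_monad[OF U A])
  interpret T: tuple_monad U FF B "Mf_ob B" "Mf_cls B" "fob (Mf U) B" by (rule Mf_monad[OF U B])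
  interpret tuple_quotient_hom U FF A "Mf_ob A" "Mf_cls A" FF B "Mf_ob B" "Mf_cls B" h
    using h by unfold_locales
  show ?thesis
  proof unfold_locales
    fix X x a assume X: "X \<in> U" and xa: "(x, a) \<in> pairs A (lists X)"
    have "(THE q'. \<exists>y t. (y, t) \<in> pairs A (lists X) \<and> Mf_cls A X x a = Mf_cls A X y t \<and>
        q' = Mf_cls B X y (h (length y) t)) = Mf_cls B X x (h (length x) a)"
      by (rule the_equality) (use xa in blast, use hom_wd[OF X xa] in metis)
    then show "Mf_map U A B h X (Mf_cls A X x a) = Mf_cls B X x (h (length x) a)"
      using X S.cl_in_ob[OF X xa] by (simp add: Mf_map_def)
  qed (simp add: Mf_map_def)
qed

lemma Mf_functor:
  assumes U: "universe U" shows "is_functor (FOp U) (Mnd U) (Mf U)"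
  unfolding is_functor_def
proof (intro conjI ballI)
  show "is_category (FOp U)" by (rule Operads_category[OF U ordinal_cat_FF])
  show "is_category (Mnd U)" by (rule Mnd_category)
next
  fix A assume "A \<in> Ob (FOp U)"
  then have A: "is_operad U FF A" by simp
  interpret S: tuple_monad U FF A "Mf_ob A" "Mf_cls A" "fob (Mf U) A" by (rule Mf_monad[OF U A])
  show "fob (Mf U) A \<in> Ob (Mnd U)" using S.is_monad_T S.finitary_T by simp
  let ?i = "\<lambda>n. \<lambda>a\<in>ops A n. a"
  have "operad_morphism FF A A ?i" by (rule operad_morphism_id[of U]) unfold_locales
  from tuple_monad_hom_id[OF Mf_hom[OF U A A this]]
  have "Mf_map U A A ?i = mid U (fob (Mf U) A)" by (simp add: Mf_map_def)
  then show "far (Mf U) A A (Idn (FOp U) A) = Idn (Mnd U) (fob (Mf U) A)" by simp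
next
  fix A B h assume "A \<in> Ob (FOp U)" "B \<in> Ob (FOp U)" "h \<in> Hom (FOp U) A B"
  then have *: "is_operad U FF A" "is_operad U FF B" "operad_morphism FF A B h" by simp_all
  interpret tuple_monad_hom U FF A "Mf_ob A" "Mf_cls A" FF B "Mf_ob B" "Mf_cls B" h
    "fob (Mf U) A" "fob (Mf U) B" "Mf_map U A B h"
    by (rule Mf_hom[OF U *])
  show "far (Mf U) A B h \<in> Hom (Mnd U) (fob (Mf U) A) (fob (Mf U) B)"
    using monad_morphism_\<sigma> by (simp add: Mf_map_def)
next
  fix A B C h g
  assume "A \<in> Ob (FOp U)" "B \<in> Ob (FOp U)" "C \<in> Ob (FOp U)" "h \<in> Hom (FOp U) A B" "g \<in> Hom (FOp U) B C"
  then have *: "is_operad U FF A" "is_operad U FF B" "is_operad U FF C"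
    and h: "operad_morphism FF A B h" and g: "operad_morphism FF B C g" by simp_all
  let ?gh = "\<lambda>n. compose (ops A n) (g n) (h n)"
  have "small_operad U FF A" using U *(1) ordinal_cat_FF by unfold_locales
  from tuple_monad_hom_comp[OF Mf_hom[OF U *(1,2) h] Mf_hom[OF U *(2,3) g]
      Mf_hom[OF U *(1,3) operad_morphism_comp[OF this h g]]]
  have "Mf_map U A C ?gh = mcomp U (fob (Mf U) A) (Mf_map U B C g) (Mf_map U A B h)"
    by (simp add: Mf_map_def)
  then show "far (Mf U) A C (Cmp (FOp U) A B C g h) =
    Cmp (Mnd U) (fob (Mf U) A) (fob (Mf U) B) (fob (Mf U) C) (far (Mf U) B C g) (far (Mf U) A B h)"
    by simp
qed

section \<open>The monad of a regular operad\<close>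

lemma regular_operadI: "universe U \<Longrightarrow> is_operad U SS A \<Longrightarrow> regular_operad U A"
  using ordinal_cat_SS by unfold_locales

text \<open>Equality of classes of injective tuples and gluing along surjections on all tuples both
  reduce to \<open>req\<close>. This makes the regular monad the \<open>SS\<close> case of the
  general construction, with \<open>rc\<close> as class map.\<close>

lemma Mr_quotient:
  assumes "universe U" "is_operad U SS A"
  shows "tuple_quotient U SS A (Mr_ob A) (rc A)"
proof -
  interpret regular_operad U A by (rule regular_operadI[OF assms])
  show ?thesis
  proof
    fix X assume X: "X \<in> U"
    show "Mr_ob A X = (\<lambda>(x, a). rc A X x a) ` pairs A (lists X)"
      unfolding Mr_ob_def tensor_rc[OF small_member[OF X]]
      by (auto simp: image_iff pairs_def in_lists_conv_set subset_iff)
    show "Mr_ob A X \<in> U"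
      unfolding Mr_ob_def by (rule tensor_small[OF small_member[OF X] inj_lists_subset])
    show "rc A X x a = rc A X y b \<longleftrightarrow> ((x, a), (y, b)) \<in> glue_eq A SS (lists X)"
      if "(x, a) \<in> pairs A (lists X)" "(y, b) \<in> pairs A (lists X)" for x a y b
      unfolding rc_eq_iff[OF small_member[OF X] that] glue_eq_SS_iff[OF that] by (rule refl)
  qed
qed

lemma Mr_simps [simp]:
  "fob (fn (fob (Mr U) A)) = Mr_ob A" "far (fn (fob (Mr U) A)) = Mr_far A"
  "eta (fob (Mr U) A) = Mr_eta A" "mu (fob (Mr U) A) = Mr_mu A" "far (Mr U) A B h = Mr_map U A B h"
  by (simp_all add: Mr_def)

locale regular_monad = regular_operad U A + tuple_monad U SS A ob "rc A" T
  for U :: "'u set set" and A :: "'u operad" and ob and T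

lemma (in regular_operad) Mr_cls_eq:
  "X \<in> U \<Longrightarrow> (x, a) \<in> pairs A (inj_lists X) \<Longrightarrow> Mr_cls A X x a = rc A X x a"
  unfolding Mr_cls_def using rc_distinct[OF small_member] by simp

text \<open>Any factorization computes \<open>rc\<close>, not just the chosen one; the descriptions
  in \<open>Mr_far\<close> and \<open>Mr_mu\<close> range over all of them.\<close>

lemma (in regular_operad) Mr_cls_factor:
  assumes X: "X \<in> U" and "z \<in> inj_lists X" "x = z \<odot> \<alpha>" "\<alpha> \<in> SS (length x) (length z)" "a \<in> ops A (length x)"
  shows "Mr_cls A X z (act A (length z) \<alpha> a) = rc A X x a"
proof -
  have "(z, act A (length z) \<alpha> a) \<in> pairs A (inj_lists X)"
    using assms(2) act_ops[OF assms(4,5)] by (simp add: pairs_def)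
  moreover have "set z \<subseteq> X" using assms(2) by (simp add: inj_lists_iff)
  ultimately show ?thesis
    using Mr_cls_eq[OF X] rc_tcomp[OF small_member[OF X] _ assms(4,5)] assms(3) by simp
qed

lemma Mr_monad:
  assumes U: "universe U" and A: "is_operad U SS A"
  shows "regular_monad U A (Mr_ob A) (fob (Mr U) A)"
proof -
  interpret regular_operad U A by (rule regular_operadI[OF assms])
  interpret tuple_quotient U SS A "Mr_ob A" "rc A" by (rule Mr_quotient[OF assms])
  have repr: "\<exists>x a. (x, a) \<in> pairs A (inj_lists X) \<and> q = Mr_cls A X x a" if "q \<in> Mr_ob A X" for q X
    using that unfolding Mr_ob_def Mr_cls_def tensor_eq by blast
  have inj_pairs: "(x, a) \<in> pairs A (lists X)" if "(x, a) \<in> pairs A (inj_lists X)" for x :: "'a list" and a X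
    using that by (simp add: pairs_inj_lists_iff pairs_lists_iff)
  have factor: "remdups x \<in> inj_lists X \<and> surj_part x \<in> SS (length x) (length (remdups x)) \<and>
      x = remdups x \<odot> surj_part x" if "set x \<subseteq> X" for x :: "'a list" and X
    using that by (intro conjI surj_part_SS surj_part_eq[symmetric]) (simp add: inj_lists_iff)
  show ?thesis
  proof (unfold_locales, unfold Mr_simps)
    show "Mr_ob A = Mr_ob A" by (rule refl)
    show "Mr_far A X Y f \<in> extensional (Mr_ob A X)" for X Y f by (simp add: Mr_far_def)
    show "Mr_eta A X = (\<lambda>x\<in>X. rc A X [x] (iota A))" if "X \<in> U" for X
      using Mr_cls_eq[OF that] iota_ops by (auto simp: Mr_eta_def pairs_inj_lists_iff)
    show "Mr_mu A X \<in> extensional (Mr_ob A (Mr_ob A X))" for X by (simp add: Mr_mu_def)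
  next
    fix X Y f x a
    assume *: "X \<in> U" "Y \<in> U" "f \<in> X \<rightarrow>\<^sub>E Y" and xa: "(x, a) \<in> pairs A (lists X)"
    have q: "rc A X x a \<in> Mr_ob A X" by (rule cl_in_ob[OF *(1) xa])
    define P where "P q' \<longleftrightarrow> (\<exists>z b y \<alpha>. (z, b) \<in> pairs A (inj_lists X) \<and> rc A X x a = Mr_cls A X z b \<and>
      map f z = y \<odot> \<alpha> \<and> \<alpha> \<in> SS (length z) (length y) \<and> y \<in> inj_lists Y \<and>
      q' = Mr_cls A Y y (act A (length y) \<alpha> b))" for q'
    have wd: "Mr_cls A Y y (act A (length y) \<alpha> b) = rc A Y (map f x) a"
      if h: "(z, b) \<in> pairs A (inj_lists X)" "rc A X x a = Mr_cls A X z b"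
        "map f z = y \<odot> \<alpha>" "\<alpha> \<in> SS (length z) (length y)" "y \<in> inj_lists Y" for z b y \<alpha>
    proof -
      have "Mr_cls A Y y (act A (length y) \<alpha> b) = rc A Y (map f z) b"
        using Mr_cls_factor[OF *(2) h(5,3)] h(1,4) by (simp add: pairs_inj_lists_iff)
      also have "\<dots> = rc A Y (map f x) a"
        using map_wd[OF * inj_pairs[OF h(1)] xa] h(2) Mr_cls_eq[OF *(1) h(1)] by simp
      finally show ?thesis .
    qed
    have "(THE q'. P q') = rc A Y (map f x) a"
    proof (rule the_equality)
      obtain z b where zb: "(z, b) \<in> pairs A (inj_lists X)" "rc A X x a = Mr_cls A X z b"
        using repr[OF q] by blast
      have "set (map f z) \<subseteq> Y" using zb(1) *(3) by (auto simp: pairs_inj_lists_iff dest: PiE_mem)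
      from factor[OF this] show "P (rc A Y (map f x) a)"
        unfolding P_def using zb wd[OF zb]
        by (intro exI[of _ z] exI[of _ b] exI[of _ "remdups (map f z)"] exI[of _ "surj_part (map f z)"]) simp
      show "q' = rc A Y (map f x) a" if "P q'" for q'
        using that wd unfolding P_def by blast
    qed
    then show "Mr_far A X Y f (rc A X x a) = rc A Y (map f x) a"
      using q by (simp add: Mr_far_def P_def)
  next
    fix X ps t assume X: "X \<in> U" and ps: "set ps \<subseteq> pairs A (lists X)" "t \<in> ops A (length ps)"
    let ?Q = "rc A (Mr_ob A X) (map (pc X) ps) t"
    note X1 = ob_small[OF X]
    have Q: "?Q \<in> Mr_ob A (Mr_ob A X)" by (rule cl_in_ob[OF X1 map_pc_pairs[OF X ps]])
    define P where "P q' \<longleftrightarrow> (\<exists>xs bs a z \<alpha>. list_all2 (\<lambda>x b. (x, b) \<in> pairs A (inj_lists X)) xs bs \<and>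
      a \<in> ops A (length xs) \<and> distinct (map2 (Mr_cls A X) xs bs) \<and>
      ?Q = Mr_cls A (Mr_ob A X) (map2 (Mr_cls A X) xs bs) a \<and>
      concat xs = z \<odot> \<alpha> \<and> \<alpha> \<in> SS (length (concat xs)) (length z) \<and> z \<in> inj_lists X \<and>
      q' = Mr_cls A X z (act A (length z) \<alpha> (opm A (map length xs) bs a)))" for q'
    have cls_pc: "map2 (Mr_cls A X) (map fst rs) (map snd rs) = map (pc X) rs"
      if "set rs \<subseteq> pairs A (inj_lists X)" for rs
      using that Mr_cls_eq[OF X] unfolding map2_pairs by (auto simp: pc_def)
    have rs_pairs: "set rs \<subseteq> pairs A (lists X)" if "set rs \<subseteq> pairs A (inj_lists X)" for rs
      using that inj_pairs by auto
    have wd: "Mr_cls A X z (act A (length z) \<alpha> (opm A (map length (map fst rs)) (map snd rs) a)) = conc X ps t"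
      if rs: "set rs \<subseteq> pairs A (inj_lists X)" and a: "a \<in> ops A (length rs)"
        and d: "distinct (map (pc X) rs)" and eq: "?Q = Mr_cls A (Mr_ob A X) (map (pc X) rs) a"
        and z: "concat (map fst rs) = z \<odot> \<alpha>" "\<alpha> \<in> SS (length (concat (map fst rs))) (length z)"
          "z \<in> inj_lists X" for rs a z \<alpha>
    proof -
      note rs' = rs_pairs[OF rs]
      have "(map (pc X) rs, a) \<in> pairs A (inj_lists (Mr_ob A X))"
        using map_pc_pairs[OF X rs' a] d by (simp add: pairs_lists_iff pairs_inj_lists_iff)
      then have "?Q = rc A (Mr_ob A X) (map (pc X) rs) a" using eq Mr_cls_eq[OF X1] by simp
      from conc_wd[OF X ps rs' a this] have "conc X ps t = conc X rs a" .
      moreover have "opm A (map (\<lambda>p. length (fst p)) rs) (map snd rs) a \<in> ops A (length (concat (map fst rs)))"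
        using conc_pairs[OF rs' a] by (simp add: pairs_lists_iff)
      from Mr_cls_factor[OF X z(3,1,2) this]
      have "Mr_cls A X z (act A (length z) \<alpha> (opm A (map length (map fst rs)) (map snd rs) a)) = conc X rs a"
        by (simp add: conc_def comp_def)
      ultimately show ?thesis by simp
    qed
    have "(THE q'. P q') = conc X ps t"
    proof (rule the_equality)
      \<comment> \<open>\<open>Mr_mu\<close> admits only pairwise distinct inner classes. An
        injective representative of \<open>?Q\<close> provides them, and each entry of
        \<open>qs\<close> has an injective representative in turn.\<close>
      obtain qs a where qa: "(qs, a) \<in> pairs A (inj_lists (Mr_ob A X))" "?Q = Mr_cls A (Mr_ob A X) qs a"
        using repr[OF Q] by blast
      have "set qs \<subseteq> (\<lambda>(x, a). Mr_cls A X x a) ` pairs A (inj_lists X)"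
      proof
        fix q assume "q \<in> set qs"
        then have "q \<in> Mr_ob A X" using qa(1) by (auto simp: pairs_inj_lists_iff)
        from repr[OF this] show "q \<in> (\<lambda>(x, a). Mr_cls A X x a) ` pairs A (inj_lists X)" by auto
      qed
      then have "qs \<in> lists ((\<lambda>(x, a). Mr_cls A X x a) ` pairs A (inj_lists X))" by auto
      then obtain rs where rs: "set rs \<subseteq> pairs A (inj_lists X)" "qs = map (\<lambda>(x, a). Mr_cls A X x a) rs"
        unfolding lists_image by auto
      have qs: "qs = map2 (Mr_cls A X) (map fst rs) (map snd rs)" unfolding map2_pairs rs(2) by (rule refl)
      have a: "a \<in> ops A (length rs)" "distinct qs"
        using qa(1) rs(2) by (simp_all add: pairs_inj_lists_iff)
      have "set (concat (map fst rs)) \<subseteq> X"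
        using conc_pairs[OF rs_pairs[OF rs(1)] a(1)] by (simp add: pairs_lists_iff)
      note f = factor[OF this]
      have "Mr_cls A X (remdups (concat (map fst rs))) (act A (length (remdups (concat (map fst rs))))
          (surj_part (concat (map fst rs))) (opm A (map length (map fst rs)) (map snd rs) a)) = conc X ps t"
        using wd[OF rs(1) a(1)] a(2) qa(2) f unfolding qs cls_pc[OF rs(1)] by metis
      then show "P (conc X ps t)"
        unfolding P_def using rs(1) a qa(2) f
        by (intro exI[of _ "map fst rs"] exI[of _ "map snd rs"] exI[of _ a]
            exI[of _ "remdups (concat (map fst rs))"] exI[of _ "surj_part (concat (map fst rs))"])
          (auto simp only: list_all2_pairs qs length_map)
    next
      fix q' assume "P q'"
      then obtain xs bs a z \<alpha> where h: "list_all2 (\<lambda>x b. (x, b) \<in> pairs A (inj_lists X)) xs bs"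
        "a \<in> ops A (length xs)" "distinct (map2 (Mr_cls A X) xs bs)"
        "?Q = Mr_cls A (Mr_ob A X) (map2 (Mr_cls A X) xs bs) a"
        "concat xs = z \<odot> \<alpha>" "\<alpha> \<in> SS (length (concat xs)) (length z)" "z \<in> inj_lists X"
        "q' = Mr_cls A X z (act A (length z) \<alpha> (opm A (map length xs) bs a))"
        unfolding P_def by blast
      from h(1) obtain rs where rs: "set rs \<subseteq> pairs A (inj_lists X)" "xs = map fst rs" "bs = map snd rs"
        unfolding list_all2_pairs by blast
      show "q' = conc X ps t"
        using wd[OF rs(1), of a z \<alpha>] h(2-8) unfolding rs(2,3) cls_pc[OF rs(1)] by simp
    qed
    then show "Mr_mu A X ?Q = conc X ps t"
      using Q by (simp add: Mr_mu_def P_def)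
  qed
qed

lemma Mr_hom:
  assumes U: "universe U" and A: "is_operad U SS A" and B: "is_operad U SS B"
    and h: "operad_morphism SS A B h"
  shows "tuple_monad_hom U SS A (Mr_ob A) (rc A) SS B (Mr_ob B) (rc B) h
    (fob (Mr U) A) (fob (Mr U) B) (Mr_map U A B h)"
proof -
  interpret S: regular_monad U A "Mr_ob A" "fob (Mr U) A" by (rule Mr_monad[OF U A])
  interpret T: regular_monad U B "Mr_ob B" "fob (Mr U) B" by (rule Mr_monad[OF U B])
  interpret tuple_quotient_hom U SS A "Mr_ob A" "rc A" SS B "Mr_ob B" "rc B" h
    using h by unfold_locales
  show ?thesis
  proof unfold_locales
    fix X x a assume X: "X \<in> U" and xa: "(x, a) \<in> pairs A (lists X)"
    have q: "rc A X x a \<in> Mr_ob A X" by (rule S.cl_in_ob[OF X xa])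
    have wd: "Mr_cls B X y (h (length y) b) = rc B X x (h (length x) a)"
      if "(y, b) \<in> pairs A (inj_lists X)" "rc A X x a = Mr_cls A X y b" for y b
    proof -
      have "(y, b) \<in> pairs A (lists X)" using that(1) by (simp add: pairs_inj_lists_iff pairs_lists_iff)
      from hom_wd[OF X this xa] show ?thesis
        using that(2) S.Mr_cls_eq[OF X that(1)] T.Mr_cls_eq[OF X hom_pairs[OF that(1)]] by simp
    qed
    obtain y b where yb: "(y, b) \<in> pairs A (inj_lists X)" "rc A X x a = Mr_cls A X y b"
      using q unfolding Mr_ob_def Mr_cls_def tensor_eq by blast
    have "(THE q'. \<exists>y b. (y, b) \<in> pairs A (inj_lists X) \<and> rc A X x a = Mr_cls A X y b \<and>
        q' = Mr_cls B X y (h (length y) b)) = rc B X x (h (length x) a)"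
      by (rule the_equality) (use yb wd[OF yb] in metis, use wd in blast)
    then show "Mr_map U A B h X (rc A X x a) = rc B X x (h (length x) a)"
      using X q by (simp add: Mr_map_def)
  qed (simp add: Mr_map_def)
qed

section \<open>Supports, pullbacks and semi-analyticity\<close>

context regular_monad
begin

text \<open>Equality after applying \<open>f\<close> is \<open>req\<close> for relabelled tuples,
  and an injective relabelling can be cancelled.\<close>

lemma far_inj:
  assumes *: "X \<in> U" "Y \<in> U" "f \<in> X \<rightarrow>\<^sub>E Y" and f: "inj_on f X"
  shows "inj_on (far (fn T) X Y f) (ob X)"
proof (rule inj_onI)
  fix q r assume "q \<in> ob X" "r \<in> ob X" and eq: "far (fn T) X Y f q = far (fn T) X Y f r"
  from this(1) *(1) obtain x a where xa: "(x, a) \<in> pairs A (lists X)" "q = rc A X x a" by (rule ob_cases)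
  from \<open>r \<in> ob X\<close> *(1) obtain y b where yb: "(y, b) \<in> pairs A (lists X)" "r = rc A X y b" by (rule ob_cases)
  have "rc A Y (map f x) a = rc A Y (map f y) b"
    using eq unfolding xa(2) yb(2) far_cl[OF * xa(1)] far_cl[OF * yb(1)] .
  then have "req A (map f x) a (map f y) b"
    using rc_eq_iff[OF small_member[OF *(2)] map_pairs[OF *(3) xa(1)] map_pairs[OF *(3) yb(1)]] by simp
  moreover have "inj_on f (set x \<union> set y)"
    using f xa(1) yb(1) by (auto simp: pairs_lists_iff elim: inj_on_subset)
  ultimately have "req A x a y b" by (rule req_map_cancel)
  then show "q = r" using rc_eq_iff[OF small_member[OF *(1)] xa(1) yb(1)] xa(2) yb(2) by simp
qed

lemma rc_set_eq:
  assumes "X \<in> U" "(x, a) \<in> pairs A (lists X)" "(y, b) \<in> pairs A (lists X)" "rc A X x a = rc A X y b"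
  shows "set x = set y"
  using assms rc_eq_iff[OF small_member[OF assms(1)] assms(2,3)] req_set by metis

text \<open>By \<open>rc_set_eq\<close> all representatives of an element have the same entries, and
  one of them here is of the form \<open>map f x\<close>.\<close>

lemma far_support:
  assumes *: "X \<in> U" "Y \<in> U" "f \<in> X \<rightarrow>\<^sub>E Y" and "q \<in> ob X" and "(y, b) \<in> pairs A (lists Y)"
    and "rc A Y y b = far (fn T) X Y f q"
  shows "set y \<subseteq> f ` X"
proof -
  from assms(4) *(1) obtain x a where xa: "(x, a) \<in> pairs A (lists X)" "q = rc A X x a" by (rule ob_cases)
  have "set y = set (map f x)"
    using rc_set_eq[OF *(2) assms(5) map_pairs[OF *(3) xa(1)]] assms(6) far_cl[OF * xa(1)] xa(2) by simp
  then show ?thesis using xa(1) by (auto simp: pairs_lists_iff)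
qed

end

lemma list_in_image:
  assumes "set y \<subseteq> f ` X" obtains x where "set x \<subseteq> X" "map f x = y"
proof -
  have "y \<in> map f ` lists X" using assms by (auto simp: lists_image[symmetric])
  then show ?thesis by (auto intro: that)
qed

context regular_monad
begin

text \<open>Supports do the work: the tuple behind \<open>u\<close> is forced into the image of the
  projection \<open>p\<close> and is lifted entry by entry. The value under the other projection and
  uniqueness follow because the functor keeps injective maps injective.\<close>

lemma semi_analytic_T: "semi_analytic U (fn T)"
  unfolding semi_analytic_def
proof (intro conjI finitary_T ballI allI impI, elim conjE, unfold fob_T)
  fix P X Y Z p q f g
  assume U: "P \<in> U" "X \<in> U" "Y \<in> U" "Z \<in> U" and g: "monic (SET U) Y Z g"
    and pb: "pullback (SET U) P X Y Z p q f g"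
  note S = set_functorD[OF set_functor_T, unfolded fob_T]
  have arr: "p \<in> P \<rightarrow>\<^sub>E X" "q \<in> P \<rightarrow>\<^sub>E Y" "f \<in> X \<rightarrow>\<^sub>E Z" "g \<in> Y \<rightarrow>\<^sub>E Z"
    and fp: "compose P f p = compose P g q"
    using pb unfolding pullback_def SET_simps by simp_all
  have ginj: "inj_on g Y" using g set_monic_iff[OF universe U(3)] by blast
  have spb: "set_pullback P X Y p q f g" using pb pullback_SET_iff[OF universe arr] by simp
  have lift: "\<exists>!w. w \<in> P \<and> p w = u \<and> q w = v" if "u \<in> X" "v \<in> Y" "f u = g v" for u v
    using spb that unfolding set_pullback_def by simp
  have comm: "f (p w) = g (q w)" if "w \<in> P" for w using spb that unfolding set_pullback_def by simp
  \<comment> \<open>A pullback of a monomorphism is a monomorphism; injectivity of \<open>p\<close>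
    will give uniqueness of the lifted element.\<close>
  have pinj: "inj_on p P"
  proof (rule inj_onI)
    fix w w' assume w: "w \<in> P" "w' \<in> P" "p w = p w'"
    then have "g (q w) = g (q w')" using comm[OF w(1)] comm[OF w(2)] by simp
    then have "q w = q w'" using inj_onD[OF ginj _ PiE_mem[OF arr(2) w(1)] PiE_mem[OF arr(2) w(2)]] by simp
    then show "w = w'"
      using lift[OF PiE_mem[OF arr(1) w(1)] PiE_mem[OF arr(2) w(1)] comm[OF w(1)]] w by metis
  qed
  have Fcomm: "far (fn T) X Z f (far (fn T) P X p w) = far (fn T) Y Z g (far (fn T) P Y q w)"
    if "w \<in> ob P" for w
    using S(4)[OF U(1,2,4) arr(1,3) that] S(4)[OF U(1,3,4) arr(2,4) that] fp by simp
  show "pullback (SET U) (ob P) (ob X) (ob Y) (ob Z) (far (fn T) P X p) (far (fn T) P Y q)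
      (far (fn T) X Z f) (far (fn T) Y Z g)"
    unfolding pullback_SET_iff[OF universe S(2)[OF U(1,2) arr(1)] S(2)[OF U(1,3) arr(2)]
        S(2)[OF U(2,4) arr(3)] S(2)[OF U(3,4) arr(4)]] set_pullback_def
  proof (intro conjI ballI impI Fcomm)
    fix u v assume u: "u \<in> ob X" and v: "v \<in> ob Y" and eq: "far (fn T) X Z f u = far (fn T) Y Z g v"
    from u U(2) obtain x a where xa: "(x, a) \<in> pairs A (lists X)" "u = rc A X x a" by (rule ob_cases)
    \<comment> \<open>The relabelled tuple represents an element that comes from \<open>Y\<close>
      along \<open>g\<close>, so its support lies in the image of \<open>g\<close>.\<close>
    have "set (map f x) \<subseteq> g ` Y"
      using far_support[OF U(3,4) arr(4) v map_pairs[OF arr(3) xa(1)]] eq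
      unfolding xa(2) far_cl[OF U(2,4) arr(3) xa(1)] by simp
    then have fx: "f ` set x \<subseteq> g ` Y" by simp
    have "set x \<subseteq> p ` P"
    proof
      fix e assume e: "e \<in> set x"
      then obtain y where "y \<in> Y" "f e = g y" using fx by blast
      with lift[of e y] e xa(1) show "e \<in> p ` P" unfolding pairs_lists_iff by blast
    qed
    then obtain z where z: "set z \<subseteq> P" "map p z = x" by (rule list_in_image)
    have za: "(z, a) \<in> pairs A (lists P)" using z xa(1) by (auto simp: pairs_lists_iff)
    let ?w = "rc A P z a"
    have w: "?w \<in> ob P" by (rule cl_in_ob[OF U(1) za])
    have pw: "far (fn T) P X p ?w = u" using far_cl[OF U(1,2) arr(1) za] z(2) xa(2) by simp
    have "far (fn T) Y Z g (far (fn T) P Y q ?w) = far (fn T) Y Z g v"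
      using Fcomm[OF w] pw eq by simp
    then have "far (fn T) P Y q ?w = v"
      using inj_onD[OF far_inj[OF U(3,4) arr(4) ginj] _ PiE_mem[OF S(2)[OF U(1,3) arr(2)] w] v] by simp
    with w pw show "\<exists>!w. w \<in> ob P \<and> far (fn T) P X p w = u \<and> far (fn T) P Y q w = v"
      using inj_onD[OF far_inj[OF U(1,2) arr(1) pinj]] by metis
  qed
qed

text \<open>The unit at \<open>u\<close> has support \<open>{u}\<close>, so it comes from
  \<open>X\<close> only if \<open>u\<close> does.\<close>

lemma semi_cartesian_eta: "semi_cartesian U functor_id (fn T) (eta T)"
proof -
  have "nat_trans (SET U) (SET U) functor_id (fn T) (eta T)"
    using is_monad_T unfolding is_monad_def by simp
  note iff = semi_cartesian_iff[OF universe this, unfolded functor_id_simps fob_T]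
  show ?thesis
    unfolding iff
  proof (intro ballI impI)
    fix X Y f u v assume *: "X \<in> U" "Y \<in> U" "f \<in> X \<rightarrow>\<^sub>E Y" and f: "inj_on f X"
      and u: "u \<in> Y" and v: "v \<in> ob X" and eq: "eta T Y u = far (fn T) X Y f v"
    have "set [u] \<subseteq> f ` X"
      using far_support[OF * v, of "[u]" "iota A"] u eq by (simp add: eta_T[OF *(2)] pairs_lists_iff iota_ops)
    then obtain e where e: "e \<in> X" "f e = u" by auto
    have "far (fn T) X Y f (eta T X e) = far (fn T) X Y f v"
      using eta_natural[OF * e(1)] e(2) eq by simp
    then have "eta T X e = v"
      using inj_onD[OF far_inj[OF * f] _ PiE_mem[OF eta_in[OF *(1)] e(1)] v] by simp
    with e show "\<exists>!w. w \<in> X \<and> f w = u \<and> eta T X w = v" using inj_onD[OF f] by metis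
  qed
qed

text \<open>The support of a product of nested tuples consists of the entries of all inner tuples.
  If the product comes from \<open>X\<close>, every inner tuple therefore lifts along
  \<open>f\<close>, and with them the nested element.\<close>

lemma semi_cartesian_mu: "semi_cartesian U (functor_comp (fn T) (fn T)) (fn T) (mu T)"
proof -
  have "nat_trans (SET U) (SET U) (functor_comp (fn T) (fn T)) (fn T) (mu T)"
    using is_monad_T unfolding is_monad_def by simp
  note iff = semi_cartesian_iff[OF universe this, unfolded functor_comp_simps fob_T]
  show ?thesis
    unfolding iff
  proof (intro ballI impI)
    fix X Y f u v assume *: "X \<in> U" "Y \<in> U" "f \<in> X \<rightarrow>\<^sub>E Y" and f: "inj_on f X"
      and u: "u \<in> ob (ob Y)" and v: "v \<in> ob X" and eq: "mu T Y u = far (fn T) X Y f v"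
    let ?F = "far (fn T) X Y f"
    from u *(2) obtain ps t where ps: "set ps \<subseteq> pairs A (lists Y)" "t \<in> ops A (length ps)"
      "u = rc A (ob Y) (map (pc Y) ps) t" by (rule ob_ob_cases)
    have "set (concat (map fst ps)) \<subseteq> f ` X"
      using far_support[OF * v conc_pairs[OF ps(1,2)]] eq mu_cl[OF *(2) ps(1,2)] ps(3)
      unfolding conc_def by simp
    then have sub: "set (fst p) \<subseteq> f ` X" if "p \<in> set ps" for p using that by auto
    have "\<exists>r\<in>pairs A (lists X). (map f (fst r), snd r) = p" if p: "p \<in> set ps" for p
    proof -
      obtain x where "set x \<subseteq> X" "map f x = fst p" using list_in_image[OF sub[OF p]] by blast
      moreover have "snd p \<in> ops A (length (fst p))" using ps(1) p by (auto simp: pairs_def)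
      ultimately show ?thesis
        by (intro bexI[of _ "(x, snd p)"]) (auto simp: pairs_lists_iff prod_eq_iff dest: arg_cong[of _ _ length])
    qed
    then have "set ps \<subseteq> (\<lambda>r. (map f (fst r), snd r)) ` pairs A (lists X)" by force
    then obtain rs where rs: "set rs \<subseteq> pairs A (lists X)" "map (\<lambda>r. (map f (fst r), snd r)) rs = ps"
      by (rule list_in_image)
    have t: "t \<in> ops A (length rs)" using ps(2) rs(2) by auto
    let ?w = "rc A (ob X) (map (pc X) rs) t"
    have r: "(fst r, snd r) \<in> pairs A (lists X)" if "r \<in> set rs" for r using rs(1) that by auto
    have "?F (pc X r) = pc Y (map f (fst r), snd r)" if "r \<in> set rs" for r
      using far_cl[OF * r[OF that]] by (simp add: pc_def case_prod_beta)
    then have "map ?F (map (pc X) rs) = map (pc Y) ps" unfolding rs(2)[symmetric] by simp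
    then have w: "far (fn T) (ob X) (ob Y) ?F ?w = u"
      using far_cl[OF ob_small[OF *(1)] ob_small[OF *(2)] far_in[OF *] map_pc_pairs[OF *(1) rs(1) t]]
      unfolding ps(3) by simp
    have wX: "?w \<in> ob (ob X)" by (rule cl_in_ob[OF ob_small[OF *(1)] map_pc_pairs[OF *(1) rs(1) t]])
    have "?F (mu T X ?w) = ?F v" using mu_natural[OF * wX] w eq by simp
    then have "mu T X ?w = v"
      using inj_onD[OF far_inj[OF * f] _ PiE_mem[OF mu_in[OF *(1)] wX] v] by simp
    moreover have "inj_on (far (fn T) (ob X) (ob Y) ?F) (ob (ob X))"
      by (rule far_inj[OF ob_small[OF *(1)] ob_small[OF *(2)] far_in[OF *] far_inj[OF * f]])
    ultimately show "\<exists>!w. w \<in> ob (ob X) \<and> far (fn T) (ob X) (ob Y) ?F w = u \<and> mu T X w = v"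
      using w wX inj_onD by metis
  qed
qed

end

text \<open>The induced map leaves tuples, hence supports, unchanged; a representative of
  \<open>u\<close> therefore lifts along \<open>f\<close> with the same operation.\<close>

lemma Mr_map_semi_cartesian:
  assumes U: "universe U" and A: "is_operad U SS A" and B: "is_operad U SS B"
    and h: "operad_morphism SS A B h"
  shows "semi_cartesian U (fn (fob (Mr U) A)) (fn (fob (Mr U) B)) (Mr_map U A B h)"
proof -
  interpret S: regular_monad U A "Mr_ob A" "fob (Mr U) A" by (rule Mr_monad[OF U A])
  interpret T: regular_monad U B "Mr_ob B" "fob (Mr U) B" by (rule Mr_monad[OF U B])
  interpret tuple_monad_hom U SS A "Mr_ob A" "rc A" SS B "Mr_ob B" "rc B" h
    "fob (Mr U) A" "fob (Mr U) B" "Mr_map U A B h" by (rule Mr_hom[OF assms])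
  have "nat_trans (SET U) (SET U) (fn (fob (Mr U) A)) (fn (fob (Mr U) B)) (Mr_map U A B h)"
    using monad_morphism_\<sigma> unfolding monad_morphism_def by blast
  note iff = semi_cartesian_iff[OF U this]
  note nat = monad_morphismD(2)[OF monad_morphism_\<sigma> S.is_monad_T T.is_monad_T, unfolded S.fob_T]
  show ?thesis
    unfolding iff S.fob_T T.fob_T
  proof (intro ballI impI)
    fix X Y f u v assume *: "X \<in> U" "Y \<in> U" "f \<in> X \<rightarrow>\<^sub>E Y" and f: "inj_on f X"
      and u: "u \<in> Mr_ob A Y" and v: "v \<in> Mr_ob B X"
      and eq: "Mr_map U A B h Y u = far (fn (fob (Mr U) B)) X Y f v"
    from u *(2) obtain y a where ya: "(y, a) \<in> pairs A (lists Y)" "u = rc A Y y a" by (rule S.ob_cases)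
    have "set y \<subseteq> f ` X"
      using T.far_support[OF * v hom_pairs[OF ya(1)]] eq \<sigma>_cl[OF *(2) ya(1)] ya(2) by simp
    then obtain x where x: "set x \<subseteq> X" "map f x = y" by (rule list_in_image)
    have xa: "(x, a) \<in> pairs A (lists X)" using x ya(1) by (auto simp: pairs_lists_iff)
    let ?w = "rc A X x a"
    have w: "?w \<in> Mr_ob A X" by (rule S.cl_in_ob[OF *(1) xa])
    have fw: "far (fn (fob (Mr U) A)) X Y f ?w = u" using S.far_cl[OF * xa] x(2) ya(2) by simp
    have "far (fn (fob (Mr U) B)) X Y f (Mr_map U A B h X ?w) = far (fn (fob (Mr U) B)) X Y f v"
      using nat[OF * w] fw eq by simp
    then have "Mr_map U A B h X ?w = v"
      using inj_onD[OF T.far_inj[OF * f] _ PiE_mem[OF \<sigma>_in[OF *(1)] w] v] by simp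
    with w fw show "\<exists>!w. w \<in> Mr_ob A X \<and> far (fn (fob (Mr U) A)) X Y f w = u \<and> Mr_map U A B h X w = v"
      using inj_onD[OF S.far_inj[OF * f]] by metis
  qed
qed

lemma Mr_functor:
  assumes U: "universe U" shows "is_functor (RegOp U) (SanMnd U) (Mr U)"
  unfolding is_functor_def
proof (intro conjI ballI)
  show "is_category (RegOp U)" by (rule Operads_category[OF U ordinal_cat_SS])
  show "is_category (SanMnd U)" by (rule SanMnd_category[OF U])
next
  fix A assume "A \<in> Ob (RegOp U)"
  then have A: "is_operad U SS A" by simp
  interpret S: regular_monad U A "Mr_ob A" "fob (Mr U) A" by (rule Mr_monad[OF U A])
  show "fob (Mr U) A \<in> Ob (SanMnd U)"
    using S.is_monad_T S.finitary_T S.semi_analytic_T S.semi_cartesian_eta S.semi_cartesian_mu by simp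
  let ?i = "\<lambda>n. \<lambda>a\<in>ops A n. a"
  have "operad_morphism SS A A ?i" by (rule operad_morphism_id[of U]) unfold_locales
  from tuple_monad_hom_id[OF Mr_hom[OF U A A this]]
  have "Mr_map U A A ?i = mid U (fob (Mr U) A)" by (simp add: Mr_map_def)
  then show "far (Mr U) A A (Idn (RegOp U) A) = Idn (SanMnd U) (fob (Mr U) A)" by simp
next
  fix A B h assume "A \<in> Ob (RegOp U)" "B \<in> Ob (RegOp U)" "h \<in> Hom (RegOp U) A B"
  then have *: "is_operad U SS A" "is_operad U SS B" "operad_morphism SS A B h" by simp_all
  interpret tuple_monad_hom U SS A "Mr_ob A" "rc A" SS B "Mr_ob B" "rc B" h
    "fob (Mr U) A" "fob (Mr U) B" "Mr_map U A B h"
    by (rule Mr_hom[OF U *])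
  show "far (Mr U) A B h \<in> Hom (SanMnd U) (fob (Mr U) A) (fob (Mr U) B)"
    using monad_morphism_\<sigma> Mr_map_semi_cartesian[OF U *] by (simp add: Mr_map_def)
next
  fix A B C h g
  assume "A \<in> Ob (RegOp U)" "B \<in> Ob (RegOp U)" "C \<in> Ob (RegOp U)" "h \<in> Hom (RegOp U) A B" "g \<in> Hom (RegOp U) B C"
  then have *: "is_operad U SS A" "is_operad U SS B" "is_operad U SS C"
    and h: "operad_morphism SS A B h" and g: "operad_morphism SS B C g" by simp_all
  let ?gh = "\<lambda>n. compose (ops A n) (g n) (h n)"
  have "small_operad U SS A" using U *(1) ordinal_cat_SS by unfold_locales
  from tuple_monad_hom_comp[OF Mr_hom[OF U *(1,2) h] Mr_hom[OF U *(2,3) g]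
      Mr_hom[OF U *(1,3) operad_morphism_comp[OF this h g]]]
  have "Mr_map U A C ?gh = mcomp U (fob (Mr U) A) (Mr_map U B C g) (Mr_map U A B h)"
    by (simp add: Mr_map_def)
  then show "far (Mr U) A C (Cmp (RegOp U) A B C g h) =
    Cmp (SanMnd U) (fob (Mr U) A) (fob (Mr U) B) (fob (Mr U) C) (far (Mr U) B C g) (far (Mr U) A B h)"
    by simp
qed

section \<open>The full operad of a regular operad\<close>

text \<open>\<open>star\<close> with the family given as a function on indices, so that reindexed
  and nested families are plain abstractions.\<close>

definition stars :: "nat list \<Rightarrow> (nat \<Rightarrow> nat list) \<Rightarrow> nat list \<Rightarrow> nat list" where
  "stars ls \<psi> \<phi> = concat (map (\<lambda>j. map (\<lambda>r. sum_list (take j ls) + r) (\<psi> j)) \<phi>)"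

lemma star_stars: "star \<psi>s ls \<phi> = stars ls ((!) \<psi>s) \<phi>"
  by (simp add: star_def stars_def)

lemma stars_cong: "(\<And>j. j \<in> set \<phi> \<Longrightarrow> \<psi> j = \<psi>' j) \<Longrightarrow> stars ls \<psi> \<phi> = stars ls \<psi>' \<phi>"
  unfolding stars_def by (intro arg_cong[where f = concat] map_cong) auto

lemma stars_star:
  assumes "set \<phi> \<subseteq> {..<n}" shows "stars ls \<psi> \<phi> = star (map \<psi> [0..<n]) ls \<phi>"
  unfolding star_stars using assms by (intro stars_cong) auto

lemma length_stars: "length (stars ls \<psi> \<phi>) = sum_list (map (\<lambda>j. length (\<psi> j)) \<phi>)"
  by (simp add: stars_def length_concat comp_def)

lemma set_stars_subset:
  assumes "set \<phi> \<subseteq> {..<length ls}" "\<And>j. j < length ls \<Longrightarrow> set (\<psi> j) \<subseteq> {..<ls ! j}"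
  shows "set (stars ls \<psi> \<phi>) \<subseteq> {..<sum_list ls}"
  unfolding stars_star[OF assms(1)] using assms by (intro set_star_subset) auto

lemma concat_stars:
  assumes "set \<phi> \<subseteq> {..<length ws}" "\<And>j. j < length ws \<Longrightarrow> set (\<psi> j) \<subseteq> {..<length (ws ! j)}"
    and "ls = map length ws"
  shows "concat ws \<odot> stars ls \<psi> \<phi> = concat (map (\<lambda>j. ws ! j \<odot> \<psi> j) \<phi>)"
proof -
  have "concat ws \<odot> stars ls \<psi> \<phi> =
      concat (map (\<lambda>j. ws ! j \<odot> map \<psi> [0..<length ws] ! j) \<phi>)"
    unfolding stars_star[OF assms(1)] using assms by (intro concat_star) auto
  also have "\<dots> = concat (map (\<lambda>j. ws ! j \<odot> \<psi> j) \<phi>)"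
    using assms(1) by (auto simp: subset_iff intro!: arg_cong[where f = concat])
  finally show ?thesis .
qed

text \<open>Identity blocks concatenate to an identity; this makes the unit of the adjunction
  compatible with composition.\<close>

lemma stars_upt: "stars ns (\<lambda>i. [0..<ns ! i]) [0..<length ns] = [0..<sum_list ns]"
proof (induction ns rule: rev_induct)
  case (snoc n ns)
  have "stars (ns @ [n]) (\<lambda>i. [0..<(ns @ [n]) ! i]) [0..<length ns] = stars ns (\<lambda>i. [0..<ns ! i]) [0..<length ns]"
    unfolding stars_def by (intro arg_cong[where f = concat] map_cong) (auto simp: nth_append)
  moreover have "map (\<lambda>r. sum_list ns + r) [0..<n] = [sum_list ns..<sum_list ns + n]"
    by (simp add: map_add_upt add.commute)
  moreover have "stars ls \<psi> (\<phi> @ [j]) = stars ls \<psi> \<phi> @ map (\<lambda>r. sum_list (take j ls) + r) (\<psi> j)" for ls \<psi> \<phi> j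
    by (simp add: stars_def)
  ultimately show ?case
    using snoc upt_add_eq_append[of 0 "sum_list ns" n] by simp
qed (simp add: stars_def)

text \<open>An offset in the flattened list splits into the offset of the outer block and the offset
  inside it; the index maps in the associativity law nest accordingly.\<close>

lemma sum_take_concat:
  assumes "i < length nss" "j \<le> length (nss ! i)"
  shows "sum_list (take (sum_list (take i (map length nss)) + j) (concat nss)) =
    sum_list (take i (map sum_list nss)) + sum_list (take j (nss ! i :: nat list))"
  using assms
proof (induction nss arbitrary: i)
  case (Cons ns nss)
  then show ?case by (cases i) (auto simp: add.assoc)
qed simp

lemma has_arities_nth: "has_arities A ns bs \<longleftrightarrow> length bs = length ns \<and> (\<forall>i<length ns. bs ! i \<in> ops A (ns ! i))"
  by (auto simp: has_arities_def list_all2_conv_all_nth)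

section \<open>Action and composition of the generated full operad on arbitrary
  representatives\<close>

context regular_operad
begin

text \<open>The counterpart of \<open>cl_lift\<close> for \<open>req\<close>: both pairs are
  compared through their common injective tuple. That tuple has the same entries as
  \<open>x\<close>, so \<open>G\<close> has to be compatible with gluing only there.\<close>

lemma req_lift:
  assumes "req A x a y b" "a \<in> ops A (length x)" "b \<in> ops A (length y)"
    and G: "\<And>z \<alpha> n c. set z = set x \<Longrightarrow> \<alpha> \<in> SS n (length z) \<Longrightarrow> c \<in> ops A n \<Longrightarrow>
      G (z \<odot> \<alpha>) c = G z (act A (length z) \<alpha> c)"
  shows "G x a = G y b"
proof -
  obtain z \<alpha> \<beta> where z: "x = z \<odot> \<alpha>" "y = z \<odot> \<beta>"
    "\<alpha> \<in> SS (length x) (length z)" "\<beta> \<in> SS (length y) (length z)"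
    "act A (length z) \<alpha> a = act A (length z) \<beta> b" using assms(1) unfolding req_def by blast
  have sz: "set z = set x" using z(1,3) set_tcomp_surj[of \<alpha> z] by (simp add: SS_iff)
  have "G x a = G z (act A (length z) \<alpha> a)" using G[OF sz z(3) assms(2)] z(1) by simp
  also have "\<dots> = G y b" using G[OF sz z(4) assms(3)] z(2,5) by simp
  finally show ?thesis .
qed

text \<open>Repetitions in \<open>x\<close> are allowed, so that action and composition can be
  computed without factorizing.\<close>

abbreviation po :: "nat \<Rightarrow> nat list \<Rightarrow> 'u \<Rightarrow> 'u" where
  "po n x a \<equiv> rc A {..<n} x a"

lemma small_ordinal: "small U {..<n::nat}"
  by (rule small_finite[OF universe]) simp

lemma po_eq_iff:
  assumes "set x \<subseteq> {..<n}" "a \<in> ops A (length x)" "set y \<subseteq> {..<n}" "b \<in> ops A (length y)"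
  shows "po n x a = po n y b \<longleftrightarrow> req A x a y b"
  using assms by (intro rc_eq_iff[OF small_ordinal]) (simp_all add: pairs_lists_iff)

lemma po_tcomp:
  "set x \<subseteq> {..<n} \<Longrightarrow> \<phi> \<in> SS k (length x) \<Longrightarrow> a \<in> ops A k \<Longrightarrow>
    po n (x \<odot> \<phi>) a = po n x (act A (length x) \<phi> a)"
  by (rule rc_tcomp[OF small_ordinal])

lemma Po_ops_eq: "Po_ops A n = {po n x a | x a. set x \<subseteq> {..<n} \<and> a \<in> ops A (length x)}"
  unfolding Po_ops_def Inj_eq by (rule tensor_rc[OF small_ordinal])

lemma po_in: "set x \<subseteq> {..<n} \<Longrightarrow> a \<in> ops A (length x) \<Longrightarrow> po n x a \<in> Po_ops A n"
  unfolding Po_ops_eq by blast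

lemma Po_cls_eq: "(f, a) \<in> pairs A (Inj n) \<Longrightarrow> Po_cls A n f a = po n f a"
  unfolding Po_cls_def Inj_eq using rc_distinct[OF small_ordinal] by simp

lemma pairs_Inj_iff: "(f, a) \<in> pairs A (Inj n) \<longleftrightarrow> set f \<subseteq> {..<n} \<and> distinct f \<and> a \<in> ops A (length f)"
  unfolding Inj_eq by (rule pairs_inj_lists_iff)

lemma Po_repr:
  assumes "set x \<subseteq> {..<n}" "a \<in> ops A (length x)"
  obtains f b where "(f, b) \<in> pairs A (Inj n)" "po n x a = Po_cls A n f b"
  using po_in[OF assms] that unfolding Po_ops_def Po_cls_def tensor_eq by blast

lemma po_act_wd:
  assumes "length \<phi> = n" "set \<phi> \<subseteq> {..<m}" "set x \<subseteq> {..<n}" "a \<in> ops A (length x)"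
    "set y \<subseteq> {..<n}" "b \<in> ops A (length y)" "po n x a = po n y b"
  shows "po m (\<phi> \<odot> x) a = po m (\<phi> \<odot> y) b"
proof -
  have "req A x a y b" using assms po_eq_iff[OF assms(3-6)] by simp
  then show ?thesis
  proof (rule req_lift[OF _ assms(4,6)])
    fix z \<alpha> k c assume z: "set z = set x" "\<alpha> \<in> SS k (length z)" "c \<in> ops A k"
    have "\<phi> \<odot> (z \<odot> \<alpha>) = (\<phi> \<odot> z) \<odot> \<alpha>" using z(2) by (intro tcomp_assoc) (simp add: SS_iff)
    moreover have "set (\<phi> \<odot> z) \<subseteq> {..<m}" using set_tcomp_subset[of z \<phi>] z(1) assms(1-3) by auto
    ultimately show "po m (\<phi> \<odot> (z \<odot> \<alpha>)) c = po m (\<phi> \<odot> z) (act A (length z) \<alpha> c)"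
      using po_tcomp[of "\<phi> \<odot> z" m \<alpha> k c] z(2,3) by simp
  qed
qed

text \<open>On arbitrary tuples the action is composition; the factorization prescribed by
  \<open>Po_act\<close> is absorbed by \<open>po_tcomp\<close>.\<close>

lemma Po_act_eq:
  assumes \<phi>: "\<phi> \<in> FF n m" and x: "set x \<subseteq> {..<n}" "a \<in> ops A (length x)"
  shows "Po_act A m \<phi> (po n x a) = po m (\<phi> \<odot> x) a"
proof -
  have \<phi>': "length \<phi> = n" "set \<phi> \<subseteq> {..<m}" using \<phi> by (simp_all add: FF_iff)
  have wd: "Po_cls A m f' (act A (length f') \<phi>' b) = po m (\<phi> \<odot> x) a"
    if "(f, b) \<in> pairs A (Inj n)" "po n x a = Po_cls A n f b" "\<phi> \<odot> f = f' \<odot> \<phi>'"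
      "\<phi>' \<in> SS (length f) (length f')" "f' \<in> Inj m" for f b f' \<phi>'
  proof -
    have f: "set f \<subseteq> {..<n}" "b \<in> ops A (length f)" using that(1) by (simp_all add: pairs_Inj_iff)
    have f': "set f' \<subseteq> {..<m}" "distinct f'" using that(5) unfolding Inj_eq inj_lists_iff by simp_all
    have "(f', act A (length f') \<phi>' b) \<in> pairs A (Inj m)"
      using f' act_ops[OF that(4) f(2)] by (simp add: pairs_Inj_iff)
    then have "Po_cls A m f' (act A (length f') \<phi>' b) = po m (f' \<odot> \<phi>') b"
      using Po_cls_eq po_tcomp[OF f'(1) that(4) f(2)] by simp
    also have "\<dots> = po m (\<phi> \<odot> x) a"
      using po_act_wd[OF \<phi>' f x] that(2,3) Po_cls_eq[OF that(1)] by simp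
    finally show ?thesis .
  qed
  show ?thesis unfolding Po_act_def \<phi>'
  proof (rule the_equality)
    obtain f b where f: "(f, b) \<in> pairs A (Inj n)" "po n x a = Po_cls A n f b"
      by (rule Po_repr[OF x])
    let ?f = "remdups (\<phi> \<odot> f)" and ?s = "surj_part (\<phi> \<odot> f)"
    have s: "?s \<in> SS (length f) (length ?f)" using surj_part_SS[of "\<phi> \<odot> f"] by simp
    have "set (\<phi> \<odot> f) \<subseteq> {..<m}"
      using set_tcomp_subset[of f \<phi>] f(1) \<phi>' by (auto simp: pairs_Inj_iff)
    then have f': "?f \<in> Inj m" unfolding Inj_eq inj_lists_iff by simp
    from wd[OF f _ s f'] show "\<exists>f b f' \<phi>'. (f, b) \<in> pairs A (Inj n) \<and> po n x a = Po_cls A n f b \<and>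
      \<phi> \<odot> f = f' \<odot> \<phi>' \<and> \<phi>' \<in> SS (length f) (length f') \<and> f' \<in> Inj m \<and>
      po m (\<phi> \<odot> x) a = Po_cls A m f' (act A (length f') \<phi>' b)"
      using f s f' surj_part_eq[of "\<phi> \<odot> f"] by metis
  next
    fix q' assume "\<exists>f b f' \<phi>'. (f, b) \<in> pairs A (Inj n) \<and> po n x a = Po_cls A n f b \<and>
      \<phi> \<odot> f = f' \<odot> \<phi>' \<and> \<phi>' \<in> SS (length f) (length f') \<and> f' \<in> Inj m \<and>
      q' = Po_cls A m f' (act A (length f') \<phi>' b)"
    then show "q' = po m (\<phi> \<odot> x) a" using wd by blast
  qed
qed

lemma stars_ops:
  assumes "set J \<subseteq> {..<m}" "\<And>i. i < m \<Longrightarrow> b i \<in> ops A (k i)" "a \<in> ops A (length J)"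
  shows "opm A (map k J) (map b J) a \<in> ops A (sum_list (map k J))"
  using assms by (intro opm_ops_list) auto

text \<open>As in \<open>conc_glue\<close>, the inner surjections and the outer one combine into a
  single surjection \<open>star\<close>, here applied to index maps shifted into the summands of the
  codomain.\<close>

lemma po_opm_glue:
  assumes z: "\<And>i. i < length ns \<Longrightarrow> set (z i) \<subseteq> {..<ns ! i} \<and> \<psi> i \<in> SS (k i) (length (z i)) \<and> b i \<in> ops A (k i)"
    and J: "set J \<subseteq> {..<length ns}" and \<alpha>: "\<alpha> \<in> SS n (length J)" and a: "a \<in> ops A n"
  shows "po (sum_list ns) (stars ns (\<lambda>i. z i \<odot> \<psi> i) (J \<odot> \<alpha>)) (opm A (map k (J \<odot> \<alpha>)) (map b (J \<odot> \<alpha>)) a) =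
    po (sum_list ns) (stars ns z J) (opm A (map (\<lambda>i. length (z i)) J)
      (map (\<lambda>i. act A (length (z i)) (\<psi> i) (b i)) J) (act A (length J) \<alpha> a))"
proof -
  have zJ: "set (z i) \<subseteq> {..<ns ! i}" "\<psi> i \<in> SS (k i) (length (z i))" "b i \<in> ops A (k i)"
    "set (\<psi> i) = {..<length (z i)}" if "i \<in> set J" for i
    using z[of i] that J by (auto simp: SS_iff)
  have \<alpha>J: "length \<alpha> = n" "set \<alpha> = {..<length J}" using \<alpha> by (simp_all add: SS_iff)
  let ?W = "\<lambda>j. map (\<lambda>r. sum_list (take j ns) + r) (z j)"
  let ?st = "star (map \<psi> J) (map (\<lambda>i. length (z i)) J) \<alpha>"
  have "stars ns z J \<odot> ?st = concat (map (\<lambda>j. ?W j \<odot> \<psi> j) J \<odot> \<alpha>)"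
    using concat_star_list[of \<alpha> J \<psi> ?W] \<alpha>J zJ(4) unfolding stars_def by simp
  also have "map (\<lambda>j. ?W j \<odot> \<psi> j) J = map (\<lambda>j. map (\<lambda>r. sum_list (take j ns) + r) (z j \<odot> \<psi> j)) J"
    using zJ(4) by (simp add: map_tcomp)
  also have "concat (\<dots> \<odot> \<alpha>) = stars ns (\<lambda>i. z i \<odot> \<psi> i) (J \<odot> \<alpha>)"
    unfolding stars_def using \<alpha>J(2) by (simp add: map_tcomp)
  finally have st: "stars ns z J \<odot> ?st = stars ns (\<lambda>i. z i \<odot> \<psi> i) (J \<odot> \<alpha>)" .
  have "map k J \<odot> \<alpha> = map k (J \<odot> \<alpha>)" "map b J \<odot> \<alpha> = map b (J \<odot> \<alpha>)" using \<alpha>J(2) by (simp_all add: map_tcomp)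
  then have "opm A (map (\<lambda>i. length (z i)) J) (map (\<lambda>i. act A (length (z i)) (\<psi> i) (b i)) J) (act A (length J) \<alpha> a) =
    act A (length (stars ns z J)) ?st (opm A (map k (J \<odot> \<alpha>)) (map b (J \<odot> \<alpha>)) a)"
    using opm_act_list[OF \<alpha> a, where \<psi> = \<psi> and k = k and l = "\<lambda>i. length (z i)" and b = b] zJ
    by (simp add: length_stars)
  moreover have "?st \<in> SS (sum_list (map k (J \<odot> \<alpha>))) (length (stars ns z J))"
    using H_star[OF \<alpha>, of "map \<psi> J" "map k J" "map (\<lambda>i. length (z i)) J"] zJ \<alpha>J(2)
    by (simp add: length_stars map_tcomp)
  moreover have "set (J \<odot> \<alpha>) \<subseteq> {..<length ns}" using J set_tcomp_surj[of \<alpha> J] \<alpha>J by simp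
  then have "opm A (map k (J \<odot> \<alpha>)) (map b (J \<odot> \<alpha>)) a \<in> ops A (sum_list (map k (J \<odot> \<alpha>)))"
    using z a \<alpha>J(1) by (intro stars_ops[of _ "length ns"]) auto
  moreover have "set (stars ns z J) \<subseteq> {..<sum_list ns}" using J z by (intro set_stars_subset) auto
  ultimately show ?thesis using po_tcomp[of "stars ns z J" "sum_list ns" ?st] st by simp
qed

text \<open>Common factorizations are chosen for every inner pair and for the outer one; by
  \<open>po_opm_glue\<close> both sides then equal the same expression over \<open>z\<close> and
  \<open>J\<close>.\<close>

lemma po_opm_wd:
  assumes x: "\<And>i. i < length ns \<Longrightarrow> set (x i) \<subseteq> {..<ns ! i} \<and> b i \<in> ops A (length (x i))"
    and y: "\<And>i. i < length ns \<Longrightarrow> set (y i) \<subseteq> {..<ns ! i} \<and> c i \<in> ops A (length (y i))"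
    and xy: "\<And>i. i < length ns \<Longrightarrow> po (ns ! i) (x i) (b i) = po (ns ! i) (y i) (c i)"
    and f: "set f \<subseteq> {..<length ns}" "a \<in> ops A (length f)"
    and g: "set g \<subseteq> {..<length ns}" "d \<in> ops A (length g)"
    and fg: "po (length ns) f a = po (length ns) g d"
  shows "po (sum_list ns) (stars ns x f) (opm A (map (\<lambda>i. length (x i)) f) (map b f) a) =
    po (sum_list ns) (stars ns y g) (opm A (map (\<lambda>i. length (y i)) g) (map c g) d)"
proof -
  have "\<exists>z \<alpha> \<beta>. x i = z \<odot> \<alpha> \<and> y i = z \<odot> \<beta> \<and> \<alpha> \<in> SS (length (x i)) (length z) \<and>
      \<beta> \<in> SS (length (y i)) (length z) \<and> act A (length z) \<alpha> (b i) = act A (length z) \<beta> (c i)"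
    if "i < length ns" for i
  proof -
    have "req A (x i) (b i) (y i) (c i)"
      using xy[OF that] x[OF that] y[OF that] po_eq_iff[of "x i" "ns ! i" "b i" "y i" "c i"] by simp
    then show ?thesis unfolding req_def by blast
  qed
  then obtain z \<alpha> \<beta> where z: "\<And>i. i < length ns \<Longrightarrow> x i = z i \<odot> \<alpha> i \<and> y i = z i \<odot> \<beta> i \<and>
      \<alpha> i \<in> SS (length (x i)) (length (z i)) \<and> \<beta> i \<in> SS (length (y i)) (length (z i)) \<and>
      act A (length (z i)) (\<alpha> i) (b i) = act A (length (z i)) (\<beta> i) (c i)"
    by metis
  have "req A f a g d" using fg po_eq_iff[OF f g] by simp
  then obtain J \<gamma> \<delta> where J: "f = J \<odot> \<gamma>" "g = J \<odot> \<delta>" "\<gamma> \<in> SS (length f) (length J)"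
    "\<delta> \<in> SS (length g) (length J)" "act A (length J) \<gamma> a = act A (length J) \<delta> d"
    unfolding req_def by blast
  have sJ: "set J \<subseteq> {..<length ns}" using f(1) J(1,3) set_tcomp_surj[of \<gamma> J] by (simp add: SS_iff)
  have sz: "set (z i) \<subseteq> {..<ns ! i}" if "i < length ns" for i
  proof -
    have "set (\<alpha> i) = {..<length (z i)}"
      using z[OF that, THEN conjunct2, THEN conjunct2, THEN conjunct1] by (simp add: SS_iff)
    then have "set (x i) = set (z i)"
      by (subst z[OF that, THEN conjunct1]) (rule set_tcomp_surj)
    then show ?thesis using x[OF that] by simp
  qed
  have h1: "set (z i) \<subseteq> {..<ns ! i} \<and> \<alpha> i \<in> SS (length (x i)) (length (z i)) \<and> b i \<in> ops A (length (x i))"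
    and h2: "set (z i) \<subseteq> {..<ns ! i} \<and> \<beta> i \<in> SS (length (y i)) (length (z i)) \<and> c i \<in> ops A (length (y i))"
    if "i < length ns" for i
    by (intro conjI sz[OF that] conjunct2[OF x[OF that]] conjunct2[OF y[OF that]]
        z[OF that, THEN conjunct2, THEN conjunct2, THEN conjunct1]
        z[OF that, THEN conjunct2, THEN conjunct2, THEN conjunct2, THEN conjunct1])+
  note 1 = po_opm_glue[OF h1 sJ J(3) f(2), folded J(1)]
    and 2 = po_opm_glue[OF h2 sJ J(4) g(2), folded J(2)]
  have "map (\<lambda>i. act A (length (z i)) (\<alpha> i) (b i)) J = map (\<lambda>i. act A (length (z i)) (\<beta> i) (c i)) J"
    using z sJ by (intro map_cong) auto
  moreover have "stars ns (\<lambda>i. z i \<odot> \<alpha> i) f = stars ns x f"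
    using z f(1) by (intro stars_cong) auto
  moreover have "stars ns (\<lambda>i. z i \<odot> \<beta> i) g = stars ns y g"
    using z g(1) by (intro stars_cong) auto
  ultimately show ?thesis using 1 2 J(5) by (simp only:)
qed

text \<open>The definition speaks of injective representatives, and \<open>distinct_star\<close>
  keeps their composite injective; by \<open>po_opm_wd\<close> arbitrary representatives give the
  same result.\<close>

lemma Po_opm_eq:
  assumes x: "\<And>i. i < length ns \<Longrightarrow> set (x i) \<subseteq> {..<ns ! i} \<and> b i \<in> ops A (length (x i)) \<and>
      qs ! i = po (ns ! i) (x i) (b i)"
    and f: "set f \<subseteq> {..<length ns}" "a \<in> ops A (length f)"
  shows "Po_opm A ns qs (po (length ns) f a) =
    po (sum_list ns) (stars ns x f) (opm A (map (\<lambda>i. length (x i)) f) (map b f) a)"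
    (is "_ = ?rhs")
proof -
  define P where "P q' \<longleftrightarrow> (\<exists>fs bs g d. length fs = length ns \<and> length bs = length ns \<and>
     (\<forall>i<length ns. (fs ! i, bs ! i) \<in> pairs A (Inj (ns ! i)) \<and> qs ! i = Po_cls A (ns ! i) (fs ! i) (bs ! i)) \<and>
     (g, d) \<in> pairs A (Inj (length ns)) \<and> po (length ns) f a = Po_cls A (length ns) g d \<and>
     q' = Po_cls A (sum_list ns) (star fs ns g) (opm A (map length (fs \<odot> g)) (bs \<odot> g) d))" for q'
  have wd: "Po_cls A (sum_list ns) (star fs ns g) (opm A (map length (fs \<odot> g)) (bs \<odot> g) d) = ?rhs"
    if fs: "\<And>i. i < length ns \<Longrightarrow> (fs ! i, bs ! i) \<in> pairs A (Inj (ns ! i)) \<and>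
        qs ! i = Po_cls A (ns ! i) (fs ! i) (bs ! i)"
      and g: "(g, d) \<in> pairs A (Inj (length ns))" "po (length ns) f a = Po_cls A (length ns) g d" for fs bs g d
  proof -
    have fs': "set (fs ! i) \<subseteq> {..<ns ! i}" "distinct (fs ! i)" "bs ! i \<in> ops A (length (fs ! i))"
      "qs ! i = po (ns ! i) (fs ! i) (bs ! i)" if "i < length ns" for i
      using fs[OF that] Po_cls_eq[of "fs ! i" "bs ! i" "ns ! i"] by (simp_all add: pairs_Inj_iff)
    have g': "set g \<subseteq> {..<length ns}" "distinct g" "d \<in> ops A (length g)"
      using g(1) by (simp_all add: pairs_Inj_iff)
    have e: "map length (fs \<odot> g) = map (\<lambda>i. length (fs ! i)) g" "bs \<odot> g = map ((!) bs) g"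
      by (simp_all add: tcomp_def)
    have "(star fs ns g, opm A (map length (fs \<odot> g)) (bs \<odot> g) d) \<in> pairs A (Inj (sum_list ns))"
      unfolding pairs_Inj_iff
    proof (intro conjI)
      show "set (star fs ns g) \<subseteq> {..<sum_list ns}" using g'(1) fs'(1) by (rule set_star_subset)
      show "distinct (star fs ns g)" using fs'(1,2) by (intro distinct_star g') blast
      show "opm A (map length (fs \<odot> g)) (bs \<odot> g) d \<in> ops A (length (star fs ns g))"
        unfolding e star_stars length_stars using g' fs'(3) by (intro stars_ops[of _ "length ns"])
    qed
    then have "Po_cls A (sum_list ns) (star fs ns g) (opm A (map length (fs \<odot> g)) (bs \<odot> g) d) =
      po (sum_list ns) (stars ns ((!) fs) g) (opm A (map (\<lambda>i. length (fs ! i)) g) (map ((!) bs) g) d)"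
      unfolding e star_stars by (rule Po_cls_eq)
    also have "\<dots> = ?rhs"
    proof (rule po_opm_wd)
      show "po (ns ! i) (fs ! i) (bs ! i) = po (ns ! i) (x i) (b i)" if "i < length ns" for i
        using fs'(4)[OF that] x[OF that] by simp
      show "po (length ns) g d = po (length ns) f a" using g(2) Po_cls_eq[OF g(1)] by simp
    qed (use x f g' fs' in auto)
    finally show ?thesis .
  qed
  have "(THE q'. P q') = ?rhs"
  proof (rule the_equality)
    have "\<exists>h c. (h, c) \<in> pairs A (Inj (ns ! i)) \<and> qs ! i = Po_cls A (ns ! i) h c" if "i < length ns" for i
      using Po_repr[of "x i" "ns ! i" "b i"] x[OF that] by metis
    then obtain h c where hc: "\<And>i. i < length ns \<Longrightarrow> (h i, c i) \<in> pairs A (Inj (ns ! i)) \<and>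
        qs ! i = Po_cls A (ns ! i) (h i) (c i)" by metis
    obtain g d where g: "(g, d) \<in> pairs A (Inj (length ns))" "po (length ns) f a = Po_cls A (length ns) g d"
      by (rule Po_repr[OF f])
    let ?fs = "map h [0..<length ns]" and ?bs = "map c [0..<length ns]"
    have fs: "(?fs ! i, ?bs ! i) \<in> pairs A (Inj (ns ! i)) \<and> qs ! i = Po_cls A (ns ! i) (?fs ! i) (?bs ! i)"
      if "i < length ns" for i using hc[OF that] that by simp
    show "P ?rhs" unfolding P_def using fs g wd[OF fs g]
      by (intro exI[of _ ?fs] exI[of _ ?bs] exI[of _ g] exI[of _ d]) simp
    show "q' = ?rhs" if "P q'" for q' using that wd unfolding P_def by blast
  qed
  then show ?thesis unfolding Po_opm_def P_def .
qed

end

lemma Po_simps [simp]: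
  "ops (fob Po A) = Po_ops A" "iota (fob Po A) = Po_cls A 1 [0] (iota A)"
  "opm (fob Po A) = Po_opm A" "act (fob Po A) = Po_act A" "far Po A B h = Po_map A B h"
  by (simp_all add: Po_def)

section \<open>The laws of a full operad\<close>

context regular_operad
begin

lemma Po_ops_cases:
  assumes "q \<in> Po_ops A n"
  obtains x a where "set x \<subseteq> {..<n}" "a \<in> ops A (length x)" "q = po n x a"
  using assms unfolding Po_ops_eq by blast

lemma Po_iota: "Po_cls A 1 [0] (iota A) = po 1 [0] (iota A)"
  by (rule Po_cls_eq) (simp add: pairs_Inj_iff iota_ops)

lemma Po_arities_cases:
  assumes "has_arities (fob Po A) ns qs"
  obtains x b where "\<forall>i<length ns. set (x i) \<subseteq> {..<ns ! i} \<and> b i \<in> ops A (length (x i)) \<and>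
    qs ! i = po (ns ! i) (x i) (b i)"
proof -
  have q: "\<And>i. i < length ns \<Longrightarrow> qs ! i \<in> Po_ops A (ns ! i)"
    using assms by (simp add: has_arities_nth)
  have "\<exists>x b. set x \<subseteq> {..<ns ! i} \<and> b \<in> ops A (length x) \<and> qs ! i = po (ns ! i) x b"
    if "i < length ns" for i
    by (rule Po_ops_cases[OF q[OF that]]) blast
  then have "\<exists>x b. \<forall>i<length ns. set (x i) \<subseteq> {..<ns ! i} \<and> b i \<in> ops A (length (x i)) \<and>
    qs ! i = po (ns ! i) (x i) (b i)" by metis
  with that show ?thesis by blast
qed

lemma Po_opm_pairs:
  assumes x: "\<And>i. i < length ns \<Longrightarrow> set (x i) \<subseteq> {..<ns ! i} \<and> b i \<in> ops A (length (x i))"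
    and f: "set f \<subseteq> {..<length ns}" "a \<in> ops A (length f)"
  shows "set (stars ns x f) \<subseteq> {..<sum_list ns}"
    "opm A (map (\<lambda>i. length (x i)) f) (map b f) a \<in> ops A (length (stars ns x f))"
  using set_stars_subset[OF f(1), of x] stars_ops[OF f(1), of b "\<lambda>i. length (x i)" a] x f(2)
  by (simp_all add: length_stars)

lemma Po_opm_in:
  assumes "has_arities (fob Po A) ns qs" "q \<in> Po_ops A (length ns)"
  shows "Po_opm A ns qs q \<in> Po_ops A (sum_list ns)"
proof -
  from assms(1) obtain x b where "\<forall>i<length ns. set (x i) \<subseteq> {..<ns ! i} \<and>
    b i \<in> ops A (length (x i)) \<and> qs ! i = po (ns ! i) (x i) (b i)" by (rule Po_arities_cases)
  note x = this[rule_format]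
  from x have x': "\<And>i. i < length ns \<Longrightarrow> set (x i) \<subseteq> {..<ns ! i} \<and> b i \<in> ops A (length (x i))" by blast
  from assms(2) obtain f a where f: "set f \<subseteq> {..<length ns}" "a \<in> ops A (length f)" "q = po (length ns) f a"
    by (rule Po_ops_cases)
  have "Po_opm A ns qs q = po (sum_list ns) (stars ns x f) (opm A (map (\<lambda>i. length (x i)) f) (map b f) a)"
    unfolding f(3) by (rule Po_opm_eq[OF x f(1,2)])
  then show ?thesis using po_in[OF Po_opm_pairs[OF x' f(1,2)]] by simp
qed

lemma Po_act_in:
  assumes "\<phi> \<in> FF n m" "q \<in> Po_ops A n" shows "Po_act A m \<phi> q \<in> Po_ops A m"
proof -
  from assms(2) obtain x a where x: "set x \<subseteq> {..<n}" "a \<in> ops A (length x)" "q = po n x a" by (rule Po_ops_cases)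
  have "set (\<phi> \<odot> x) \<subseteq> {..<m}" using set_tcomp_subset[of x \<phi>] x(1) assms(1) by (auto simp: FF_iff)
  then show ?thesis unfolding x(3) Po_act_eq[OF assms(1) x(1,2)] using x(2) by (intro po_in) simp_all
qed

text \<open>Associativity in \<open>A\<close> settles the operations. The index maps are compared
  block by block: a position in \<open>concat nss\<close> is an offset \<open>off i\<close> plus a
  position \<open>j\<close> inside \<open>nss ! i\<close>.\<close>

lemma Po_assoc:
  assumes css: "list_all2 (has_arities (fob Po A)) nss css" and bs: "has_arities (fob Po A) (map length nss) bs"
    and q: "q \<in> Po_ops A (length nss)"
  shows "Po_opm A (map sum_list nss) (map (\<lambda>i. Po_opm A (nss ! i) (css ! i) (bs ! i)) [0..<length nss]) q =
    Po_opm A (concat nss) (concat css) (Po_opm A (map length nss) bs q)"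
proof -
  define m where "m = length nss"
  have lcss: "length css = m" and cssi: "\<And>i. i < m \<Longrightarrow> has_arities (fob Po A) (nss ! i) (css ! i)"
    using css by (auto simp: list_all2_conv_all_nth m_def)
  have "\<exists>y c. \<forall>j<length (nss ! i). set (y j) \<subseteq> {..<nss ! i ! j} \<and> c j \<in> ops A (length (y j)) \<and>
      css ! i ! j = po (nss ! i ! j) (y j) (c j)" if "i < m" for i
    by (rule Po_arities_cases[OF cssi[OF that]]) blast
  then obtain y c where y: "\<And>i j. i < m \<Longrightarrow> j < length (nss ! i) \<Longrightarrow> set (y i j) \<subseteq> {..<nss ! i ! j} \<and>
      c i j \<in> ops A (length (y i j)) \<and> css ! i ! j = po (nss ! i ! j) (y i j) (c i j)" by metis
  have lcssi: "length (css ! i) = length (nss ! i)" if "i < m" for i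
    using cssi[OF that] by (simp add: has_arities_nth)
  from bs obtain x b where "\<forall>i<length (map length nss). set (x i) \<subseteq> {..<map length nss ! i} \<and>
    b i \<in> ops A (length (x i)) \<and> bs ! i = po (map length nss ! i) (x i) (b i)" by (rule Po_arities_cases)
  note x0 = this[rule_format]
  then have x: "set (x i) \<subseteq> {..<length (nss ! i)}" "b i \<in> ops A (length (x i))"
    "bs ! i = po (length (nss ! i)) (x i) (b i)" if "i < m" for i
    using that by (simp_all add: m_def)
  from q obtain f a where f: "set f \<subseteq> {..<m}" "a \<in> ops A (length f)" "q = po m f a"
    unfolding m_def by (rule Po_ops_cases)
  have fm: "i < m" if "i \<in> set f" for i using that f(1) by auto
  have xj: "j < length (nss ! i)" if "i < m" "j \<in> set (x i)" for i j using that x(1) by auto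

  define inner where "inner i = opm A (map (\<lambda>j. length (y i j)) (x i)) (map (c i) (x i)) (b i)" for i
  have inner: "Po_opm A (nss ! i) (css ! i) (bs ! i) = po (sum_list (nss ! i)) (stars (nss ! i) (y i) (x i)) (inner i)"
    "set (stars (nss ! i) (y i) (x i)) \<subseteq> {..<sum_list (nss ! i)}"
    "inner i \<in> ops A (length (stars (nss ! i) (y i) (x i)))" if "i < m" for i
    using Po_opm_eq[of "nss ! i" "y i" "c i" "css ! i" "x i" "b i"]
      Po_opm_pairs[of "nss ! i" "y i" "c i" "x i" "b i"] y[OF that] x[OF that]
    by (simp_all add: inner_def)
  have lhs: "Po_opm A (map sum_list nss) (map (\<lambda>i. Po_opm A (nss ! i) (css ! i) (bs ! i)) [0..<length nss]) q =
    po (sum_list (map sum_list nss)) (stars (map sum_list nss) (\<lambda>i. stars (nss ! i) (y i) (x i)) f)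
      (opm A (map (\<lambda>i. length (stars (nss ! i) (y i) (x i))) f) (map inner f) a)"
    using Po_opm_eq[of "map sum_list nss" "\<lambda>i. stars (nss ! i) (y i) (x i)" inner
        "map (\<lambda>i. Po_opm A (nss ! i) (css ! i) (bs ! i)) [0..<length nss]" f a] inner f
    by (simp add: m_def)

  define F where "F = stars (map length nss) x f"
  define e where "e = opm A (map (\<lambda>i. length (x i)) f) (map b f) a"
  have Fe: "set F \<subseteq> {..<length (concat nss)}" "e \<in> ops A (length F)"
    and mid: "Po_opm A (map length nss) bs q = po (length (concat nss)) F e"
    using Po_opm_pairs[of "map length nss" x b f a] Po_opm_eq[of "map length nss" x b bs f a] x0 f
    by (simp_all add: F_def e_def m_def length_concat)
  \<comment> \<open>\<open>Y\<close> and \<open>C\<close> are the doubly indexed families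
    \<open>y\<close> and \<open>c\<close> read along the flattened list of arities.\<close>
  define Y where "Y t = concat (map (\<lambda>i. map (y i) [0..<length (nss ! i)]) [0..<m]) ! t" for t
  define C where "C t = concat (map (\<lambda>i. map (c i) [0..<length (nss ! i)]) [0..<m]) ! t" for t
  define off where "off i = sum_list (take i (map length nss))" for i
  have lens: "map length (map (\<lambda>i. map (g i) [0..<length (nss ! i)]) [0..<m]) = map length nss"
    for g :: "nat \<Rightarrow> nat \<Rightarrow> 'c"
    by (rule nth_equalityI) (simp_all add: m_def)
  have block: "Y (off i + j) = y i j" "C (off i + j) = c i j"
    "concat nss ! (off i + j) = nss ! i ! j" "concat css ! (off i + j) = css ! i ! j"
    if "i < m" "j < length (nss ! i)" for i j
  proof -
    have "map length css = map length nss"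
      using lcss lcssi by (intro nth_equalityI) (simp_all add: m_def)
    then show "concat css ! (off i + j) = css ! i ! j"
      using concat_nth_block[of i css j] that lcss lcssi by (simp add: off_def)
    show "concat nss ! (off i + j) = nss ! i ! j"
      using concat_nth_block[of i nss j] that by (simp add: off_def m_def)
    show "Y (off i + j) = y i j" "C (off i + j) = c i j"
      using concat_nth_block[of i "map (\<lambda>i. map (y i) [0..<length (nss ! i)]) [0..<m]" j]
        concat_nth_block[of i "map (\<lambda>i. map (c i) [0..<length (nss ! i)]) [0..<m]" j] that
      unfolding lens Y_def C_def off_def by simp_all
  qed
  have YC: "set (Y t) \<subseteq> {..<concat nss ! t} \<and> C t \<in> ops A (length (Y t)) \<and>
      concat css ! t = po (concat nss ! t) (Y t) (C t)" if "t < length (concat nss)" for t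
  proof -
    have "t < sum_list (map length nss)" using that by (simp add: length_concat)
    then obtain i j where "i < m" "j < length (nss ! i)" "t = off i + j"
      by (rule offset_cases) (simp add: off_def m_def)
    with y block show ?thesis by metis
  qed
  have rhs: "Po_opm A (concat nss) (concat css) (Po_opm A (map length nss) bs q) =
    po (sum_list (concat nss)) (stars (concat nss) Y F) (opm A (map (\<lambda>t. length (Y t)) F) (map C F) e)"
    unfolding mid by (rule Po_opm_eq[OF YC Fe])

  have mapF: "map g F = concat (map (\<lambda>i. map (\<lambda>j. g (off i + j)) (x i)) f)" for g :: "nat \<Rightarrow> 'd"
    by (simp add: F_def stars_def map_concat comp_def off_def)
  \<comment> \<open>The pairs \<open>(i, j)\<close> keep the outer index at hand, which brings the
    flattened families into the form of \<open>opm_assoc_list\<close>.\<close>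
  let ?qs = "\<lambda>i. map (Pair i) (x i)"
  have mapqs: "map g F = map g' (concat (map ?qs f))"
    if "\<And>i j. i \<in> set f \<Longrightarrow> j \<in> set (x i) \<Longrightarrow> g (off i + j) = g' (i, j)" for g :: "nat \<Rightarrow> 'd" and g'
    unfolding mapF using that by (simp add: map_concat comp_def cong: map_cong)
  have "map (\<lambda>t. length (Y t)) F = map (\<lambda>(i, j). length (y i j)) (concat (map ?qs f))"
    using block(1) fm xj by (intro mapqs) simp
  moreover have "map C F = map (\<lambda>(i, j). c i j) (concat (map ?qs f))"
    using block(2) fm xj by (intro mapqs) simp
  moreover have "opm A (map (\<lambda>i. sum_list (map (\<lambda>(i, j). length (y i j)) (?qs i))) f)
      (map (\<lambda>i. opm A (map (\<lambda>(i, j). length (y i j)) (?qs i)) (map (\<lambda>(i, j). c i j) (?qs i)) (b i)) f) a =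
    opm A (map (\<lambda>(i, j). length (y i j)) (concat (map ?qs f))) (map (\<lambda>(i, j). c i j) (concat (map ?qs f)))
      (opm A (map (\<lambda>i. length (?qs i)) f) (map b f) a)"
  proof (rule opm_assoc_list[OF _ f(2)])
    fix i assume i: "i \<in> set f"
    have "c i j \<in> ops A (length (y i j))" if "j \<in> set (x i)" for j
      using y[OF fm[OF i] xj[OF fm[OF i] that]] by blast
    then show "b i \<in> ops A (length (?qs i)) \<and>
      (\<forall>q\<in>set (?qs i). (case q of (i, j) \<Rightarrow> c i j) \<in> ops A (case q of (i, j) \<Rightarrow> length (y i j)))"
      using x(2)[OF fm[OF i]] by auto
  qed
  ultimately have ops: "opm A (map (\<lambda>i. length (stars (nss ! i) (y i) (x i))) f) (map inner f) a =
      opm A (map (\<lambda>t. length (Y t)) F) (map C F) e"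
    by (simp add: e_def inner_def[abs_def] length_stars comp_def)

  have st: "sum_list (take (off i + j) (concat nss)) = sum_list (take i (map sum_list nss)) + sum_list (take j (nss ! i))"
    if "i \<in> set f" "j \<in> set (x i)" for i j
    using sum_take_concat[of i nss j] fm[OF that(1)] xj[OF fm[OF that(1)] that(2)]
    by (simp add: off_def m_def)
  have "stars (concat nss) Y F = concat (map (\<lambda>t. map (\<lambda>r. sum_list (take t (concat nss)) + r) (Y t)) F)"
    by (simp add: stars_def)
  also have "\<dots> = concat (concat (map (\<lambda>i. map (\<lambda>j. map (\<lambda>r. sum_list (take i (map sum_list nss)) +
      sum_list (take j (nss ! i)) + r) (y i j)) (x i)) f))"
    unfolding mapF using st block(1) fm xj by (simp cong: map_cong)
  also have "\<dots> = concat (map (\<lambda>i. concat (map (\<lambda>j. map (\<lambda>r. sum_list (take i (map sum_list nss)) +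
      sum_list (take j (nss ! i)) + r) (y i j)) (x i))) f)"
    by (induction f) simp_all
  also have "\<dots> = stars (map sum_list nss) (\<lambda>i. stars (nss ! i) (y i) (x i)) f"
    by (simp add: stars_def map_concat comp_def add.assoc)
  finally have "stars (concat nss) Y F = stars (map sum_list nss) (\<lambda>i. stars (nss ! i) (y i) (x i)) f" .
  moreover have "sum_list (concat nss) = sum_list (map sum_list nss)" by (induction nss) simp_all
  ultimately show ?thesis
    unfolding lhs rhs ops by simp
qed

text \<open>Both sides carry the same composite in \<open>A\<close>, so the law becomes an equation
  of index maps: composing \<open>stars\<close> with \<open>star\<close> relocates blocks, by
  \<open>concat_stars\<close>.\<close>

lemma Po_opm_act:
  assumes \<phi>: "\<phi> \<in> FF n m" and len: "length \<psi>s = m" "length ks = m" "length ls = m"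
    and \<psi>: "\<And>i. i < m \<Longrightarrow> \<psi>s ! i \<in> FF (ks ! i) (ls ! i)"
    and bs: "has_arities (fob Po A) ks bs" and q: "q \<in> Po_ops A n"
  shows "Po_opm A ls (map (\<lambda>i. Po_act A (ls ! i) (\<psi>s ! i) (bs ! i)) [0..<m]) (Po_act A m \<phi> q) =
    Po_act A (sum_list ls) (star \<psi>s ls \<phi>) (Po_opm A (ks \<odot> \<phi>) (bs \<odot> \<phi>) q)"
proof -
  have \<phi>': "length \<phi> = n" "set \<phi> \<subseteq> {..<m}" using \<phi> by (simp_all add: FF_iff)
  have \<psi>': "length (\<psi>s ! i) = ks ! i" "set (\<psi>s ! i) \<subseteq> {..<ls ! i}" if "i < m" for i
    using \<psi>[OF that] by (simp_all add: FF_iff)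
  from bs obtain x b where "\<forall>i<length ks. set (x i) \<subseteq> {..<ks ! i} \<and>
    b i \<in> ops A (length (x i)) \<and> bs ! i = po (ks ! i) (x i) (b i)"
    by (rule Po_arities_cases)
  note x0 = this[rule_format]
  have x: "set (x i) \<subseteq> {..<ks ! i}" "b i \<in> ops A (length (x i))" "bs ! i = po (ks ! i) (x i) (b i)"
    if "i < m" for i using x0 that len by simp_all
  from q obtain f a where f: "set f \<subseteq> {..<n}" "a \<in> ops A (length f)" "q = po n f a" by (rule Po_ops_cases)
  have \<phi>f: "set (\<phi> \<odot> f) \<subseteq> {..<m}" using set_tcomp_subset[of f \<phi>] f(1) \<phi>' by auto
  have \<phi>j: "\<phi> ! j < m" if "j < n" for j using that \<phi>' nth_mem by fastforce
  have 1: "set (\<psi>s ! i \<odot> x i) \<subseteq> {..<ls ! i} \<and> b i \<in> ops A (length (\<psi>s ! i \<odot> x i)) \<and>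
      map (\<lambda>i. Po_act A (ls ! i) (\<psi>s ! i) (bs ! i)) [0..<m] ! i = po (ls ! i) (\<psi>s ! i \<odot> x i) (b i)"
    if "i < length ls" for i
  proof -
    have i: "i < m" using that len by simp
    have "set (\<psi>s ! i \<odot> x i) \<subseteq> {..<ls ! i}"
      using set_tcomp_subset[of "x i" "\<psi>s ! i"] x(1)[OF i] \<psi>'[OF i] by auto
    then show ?thesis using Po_act_eq[OF \<psi>[OF i] x(1,2)[OF i]] x[OF i] i by simp
  qed
  have lhs: "Po_opm A ls (map (\<lambda>i. Po_act A (ls ! i) (\<psi>s ! i) (bs ! i)) [0..<m]) (Po_act A m \<phi> q) =
    po (sum_list ls) (stars ls (\<lambda>i. \<psi>s ! i \<odot> x i) (\<phi> \<odot> f))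
      (opm A (map (\<lambda>i. length (x i)) (\<phi> \<odot> f)) (map b (\<phi> \<odot> f)) a)"
    using Po_opm_eq[OF 1, of "\<phi> \<odot> f" a] \<phi>f f(2) len(3)
    unfolding f(3) Po_act_eq[OF \<phi> f(1,2)] by simp
  let ?x = "\<lambda>j. x (\<phi> ! j)" and ?b = "\<lambda>j. b (\<phi> ! j)"
  have 2: "set (?x j) \<subseteq> {..<(ks \<odot> \<phi>) ! j} \<and> ?b j \<in> ops A (length (?x j)) \<and>
      (bs \<odot> \<phi>) ! j = po ((ks \<odot> \<phi>) ! j) (?x j) (?b j)" if "j < length (ks \<odot> \<phi>)" for j
    using x[OF \<phi>j[of j]] that \<phi>' by simp
  have opm: "Po_opm A (ks \<odot> \<phi>) (bs \<odot> \<phi>) q =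
    po (sum_list (ks \<odot> \<phi>)) (stars (ks \<odot> \<phi>) ?x f) (opm A (map (\<lambda>j. length (?x j)) f) (map ?b f) a)"
    using Po_opm_eq[OF 2, of f a] f \<phi>' by simp
  have p: "set (stars (ks \<odot> \<phi>) ?x f) \<subseteq> {..<sum_list (ks \<odot> \<phi>)}"
    "opm A (map (\<lambda>j. length (?x j)) f) (map ?b f) a \<in> ops A (length (stars (ks \<odot> \<phi>) ?x f))"
    using Po_opm_pairs[of "ks \<odot> \<phi>" ?x ?b f a] 2 f \<phi>' by simp_all
  have st: "star \<psi>s ls \<phi> \<in> FF (sum_list (ks \<odot> \<phi>)) (sum_list ls)"
    by (rule ordinal_cat_star[OF ordinal_cat_FF \<phi> len \<psi>])
  \<comment> \<open>The blocks of \<open>star \<psi>s ls \<phi>\<close>; their lengths are the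
    arities \<open>ks \<odot> \<phi>\<close>, as \<open>concat_stars\<close> demands.\<close>
  let ?ws = "map (\<lambda>j. map (\<lambda>r. sum_list (take j ls) + r) (\<psi>s ! j)) \<phi>"
  have lws: "map length ?ws = ks \<odot> \<phi>" using \<phi>' \<psi>'(1) by (auto simp: tcomp_def)
  have "star \<psi>s ls \<phi> \<odot> stars (ks \<odot> \<phi>) ?x f = concat (map (\<lambda>j. ?ws ! j \<odot> ?x j) f)"
    unfolding star_def
  proof (rule concat_stars[OF _ _ lws[symmetric]])
    show "set f \<subseteq> {..<length ?ws}" using f(1) \<phi>' by simp
    show "set (?x j) \<subseteq> {..<length (?ws ! j)}" if "j < length ?ws" for j
      using that x(1)[OF \<phi>j[of j]] \<psi>'(1)[OF \<phi>j[of j]] \<phi>' by simp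
  qed
  also have "\<dots> = concat (map (\<lambda>j. map (\<lambda>r. sum_list (take (\<phi> ! j) ls) + r) (\<psi>s ! (\<phi> ! j) \<odot> ?x j)) f)"
  proof (intro arg_cong[where f = concat] map_cong refl)
    fix j assume "j \<in> set f"
    then have j: "j < n" using f(1) by auto
    then show "?ws ! j \<odot> ?x j = map (\<lambda>r. sum_list (take (\<phi> ! j) ls) + r) (\<psi>s ! (\<phi> ! j) \<odot> ?x j)"
      using x(1)[OF \<phi>j[OF j]] \<psi>'(1)[OF \<phi>j[OF j]] \<phi>' by (simp add: map_tcomp)
  qed
  also have "\<dots> = stars ls (\<lambda>i. \<psi>s ! i \<odot> x i) (\<phi> \<odot> f)"
    by (simp add: stars_def tcomp_def comp_def)
  finally have "star \<psi>s ls \<phi> \<odot> stars (ks \<odot> \<phi>) ?x f = stars ls (\<lambda>i. \<psi>s ! i \<odot> x i) (\<phi> \<odot> f)" .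
  moreover have "map g (\<phi> \<odot> f) = map (\<lambda>j. g (\<phi> ! j)) f" for g :: "nat \<Rightarrow> 'd"
    by (simp add: tcomp_def)
  ultimately show ?thesis
    unfolding lhs opm Po_act_eq[OF st p] by (simp add: tcomp_def comp_def)
qed

lemma Po_operad: "is_operad U FF (fob Po A)"
  unfolding is_operad_def Po_simps
proof (intro conjI allI ballI impI)
  show "Po_ops A n \<in> U" for n
    unfolding Po_ops_def Inj_eq by (rule tensor_small[OF small_ordinal inj_lists_subset])
  show "Po_cls A 1 [0] (iota A) \<in> Po_ops A 1"
    unfolding Po_iota by (rule po_in) (simp_all add: iota_ops)
  show "Po_opm A ns bs a \<in> Po_ops A (sum_list ns)"
    if "has_arities (fob Po A) ns bs \<and> a \<in> Po_ops A (length ns)" for ns bs a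
    using that Po_opm_in by blast
  show "Po_act A m \<phi> a \<in> Po_ops A m" if "\<phi> \<in> FF n m" "a \<in> Po_ops A n" for n m \<phi> a
    using that by (rule Po_act_in)
  show "Po_act A n [0..<n] q = q" if "q \<in> Po_ops A n" for n q
  proof -
    from that obtain x a where x: "set x \<subseteq> {..<n}" "a \<in> ops A (length x)" "q = po n x a" by (rule Po_ops_cases)
    show ?thesis
      unfolding x(3) Po_act_eq[OF ordinal_catD(4)[OF ordinal_cat_FF] x(1,2)] using x(1) by simp
  qed
  show "Po_act A k (\<psi> \<odot> \<phi>) q = Po_act A k \<psi> (Po_act A m \<phi> q)"
    if \<phi>: "\<phi> \<in> FF n m" and \<psi>: "\<psi> \<in> FF m k" and q: "q \<in> Po_ops A n" for n m k \<phi> \<psi> q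
  proof -
    from q obtain x a where x: "set x \<subseteq> {..<n}" "a \<in> ops A (length x)" "q = po n x a" by (rule Po_ops_cases)
    have \<phi>x: "set (\<phi> \<odot> x) \<subseteq> {..<m}" "a \<in> ops A (length (\<phi> \<odot> x))"
      using set_tcomp_subset[of x \<phi>] x(1,2) \<phi> by (auto simp: FF_iff)
    have "\<psi> \<odot> (\<phi> \<odot> x) = (\<psi> \<odot> \<phi>) \<odot> x" using x(1) \<phi> by (intro tcomp_assoc) (simp add: FF_iff)
    then show ?thesis
      unfolding x(3) Po_act_eq[OF ordinal_catD(5)[OF ordinal_cat_FF \<phi> \<psi>] x(1,2)]
        Po_act_eq[OF \<phi> x(1,2)] Po_act_eq[OF \<psi> \<phi>x] by simp
  qed
  show "Po_opm A (map sum_list nss) (map (\<lambda>i. Po_opm A (nss ! i) (css ! i) (bs ! i)) [0..<length nss]) q =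
    Po_opm A (concat nss) (concat css) (Po_opm A (map length nss) bs q)"
    if "list_all2 (has_arities (fob Po A)) nss css \<and> has_arities (fob Po A) (map length nss) bs \<and>
      q \<in> Po_ops A (length nss)" for nss css bs q
    using that Po_assoc by blast
  show "Po_opm A [n] [q] (Po_cls A 1 [0] (iota A)) = q" if "q \<in> Po_ops A n" for n q
  proof -
    from that obtain x a where x: "set x \<subseteq> {..<n}" "a \<in> ops A (length x)" "q = po n x a" by (rule Po_ops_cases)
    show ?thesis
      using Po_opm_eq[of "[n]" "\<lambda>_. x" "\<lambda>_. a" "[q]" "[0]" "iota A"] x iota_ops
      map_idI[of x "(+) 0"]
      unfolding Po_iota by (simp add: stars_def opm_iota)
  qed
  show "Po_opm A (replicate n 1) (replicate n (Po_cls A 1 [0] (iota A))) q = q" if "q \<in> Po_ops A n" for n q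
  proof -
    from that obtain x a where x: "set x \<subseteq> {..<n}" "a \<in> ops A (length x)" "q = po n x a" by (rule Po_ops_cases)
    \<comment> \<open>All summands have size 1, so the offset of summand \<open>j\<close> is
      \<open>j\<close> itself.\<close>
    have "stars (replicate n 1) (\<lambda>_. [0]) x = x"
      using x(1) by (induction x) (simp_all add: stars_def sum_list_replicate)
    then show ?thesis
      using Po_opm_eq[of "replicate n 1" "\<lambda>_. [0]" "\<lambda>_. iota A" "replicate n (po 1 [0] (iota A))" x a] x iota_ops
      unfolding Po_iota by (simp add: map_replicate_const iota_opm sum_list_replicate)
  qed
  show "Po_opm A ls (map (\<lambda>i. Po_act A (ls ! i) (\<psi>s ! i) (bs ! i)) [0..<m]) (Po_act A m \<phi> q) =
    Po_act A (sum_list ls) (star \<psi>s ls \<phi>) (Po_opm A (ks \<odot> \<phi>) (bs \<odot> \<phi>) q)"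
    if "\<phi> \<in> FF n m \<and> length \<psi>s = m \<and> length ks = m \<and> length ls = m \<and>
      (\<forall>i<m. \<psi>s ! i \<in> FF (ks ! i) (ls ! i)) \<and> has_arities (fob Po A) ks bs \<and> q \<in> Po_ops A n"
    for n m \<phi> \<psi>s ks ls bs q
    using that by (intro Po_opm_act) blast+
qed

end

section \<open>Functoriality of the generated full operad\<close>

lemma Po_map_eq:
  assumes "regular_operad U A" "regular_operad U B" and h: "operad_morphism SS A B h"
    and x: "set x \<subseteq> {..<n}" "a \<in> ops A (length x)"
  shows "Po_map A B h n (rc A {..<n} x a) = rc B {..<n} x (h (length x) a)"
proof -
  interpret A: regular_operad U A by fact
  interpret B: regular_operad U B by fact
  have hB: "h k c \<in> ops B k" if "c \<in> ops A k" for k c using PiE_mem[OF operad_morphismD(1)[OF h] that] .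
  have wd: "Po_cls B n f (h (length f) b) = B.po n x (h (length x) a)"
    if f: "(f, b) \<in> pairs A (Inj n)" "A.po n x a = Po_cls A n f b" for f b
  proof -
    have f': "set f \<subseteq> {..<n}" "b \<in> ops A (length f)" using f(1) by (simp_all add: A.pairs_Inj_iff)
    have "req A f b x a"
      using f(2) A.Po_cls_eq[OF f(1)] A.po_eq_iff[OF f' x] by simp
    then have "B.po n f (h (length f) b) = B.po n x (h (length x) a)"
    proof (rule A.req_lift[OF _ f'(2) x(2)])
      fix z \<alpha> k c assume z: "set z = set f" "\<alpha> \<in> SS k (length z)" "c \<in> ops A k"
      then show "B.po n (z \<odot> \<alpha>) (h (length (z \<odot> \<alpha>)) c) = B.po n z (h (length z) (act A (length z) \<alpha> c))"
        using B.po_tcomp[of z n \<alpha> k "h k c"] hB f'(1) operad_morphismD(3)[OF h z(2,3)] by (simp add: SS_iff)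
    qed
    moreover have "(f, h (length f) b) \<in> pairs B (Inj n)"
      using f(1) hB by (simp add: A.pairs_Inj_iff B.pairs_Inj_iff)
    ultimately show ?thesis using B.Po_cls_eq by simp
  qed
  obtain f b where f: "(f, b) \<in> pairs A (Inj n)" "A.po n x a = Po_cls A n f b" by (rule A.Po_repr[OF x])
  have "(THE q'. \<exists>f b. (f, b) \<in> pairs A (Inj n) \<and> A.po n x a = Po_cls A n f b \<and>
      q' = Po_cls B n f (h (length f) b)) = B.po n x (h (length x) a)"
    by (rule the_equality) (use f wd[OF f] in metis, use wd in blast)
  then show ?thesis using A.po_in[OF x] by (simp add: Po_map_def)
qed

lemma Po_map_morphism:
  assumes A': "regular_operad U A" and B': "regular_operad U B" and h: "operad_morphism SS A B h"
  shows "operad_morphism FF (fob Po A) (fob Po B) (Po_map A B h)"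
proof -
  interpret A: regular_operad U A by fact
  interpret B: regular_operad U B by fact
  note eq = Po_map_eq[OF assms]
  have hB: "h k c \<in> ops B k" if "c \<in> ops A k" for k c using PiE_mem[OF operad_morphismD(1)[OF h] that] .
  show ?thesis
  proof (rule operad_morphismI, unfold Po_simps)
    show "Po_map A B h n \<in> Po_ops A n \<rightarrow>\<^sub>E Po_ops B n" for n
    proof (rule PiE_I)
      show "Po_map A B h n q \<in> Po_ops B n" if "q \<in> Po_ops A n" for q
        by (rule A.Po_ops_cases[OF that]) (simp add: eq B.po_in hB)
    qed (simp add: Po_map_def)
    show "Po_map A B h (Suc 0) (Po_cls A 1 [0] (iota A)) = Po_cls B 1 [0] (iota B)"
      unfolding A.Po_iota B.Po_iota using eq[of "[0]" "Suc 0" "iota A"] A.iota_ops operad_morphismD(2)[OF h] by simp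
    show "Po_map A B h m (Po_act A m \<phi> q) = Po_act B m \<phi> (Po_map A B h n q)"
      if \<phi>: "\<phi> \<in> FF n m" and q: "q \<in> Po_ops A n" for n m \<phi> q
    proof -
      from q obtain x a where x: "set x \<subseteq> {..<n}" "a \<in> ops A (length x)" "q = A.po n x a" by (rule A.Po_ops_cases)
      have "set (\<phi> \<odot> x) \<subseteq> {..<m}" using set_tcomp_subset[of x \<phi>] x(1) \<phi> by (auto simp: FF_iff)
      then show ?thesis
        using A.Po_act_eq[OF \<phi> x(1,2)] B.Po_act_eq[OF \<phi> x(1) hB[OF x(2)]] eq[OF x(1,2)]
          eq[of "\<phi> \<odot> x" m a] x(2) by (simp add: x(3))
    qed
    fix L q assume L: "\<And>n b. (n, b) \<in> set L \<Longrightarrow> b \<in> Po_ops A n" and q: "q \<in> Po_ops A (length L)"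
    let ?ns = "map fst L"
    have "snd p \<in> Po_ops A (fst p)" if "p \<in> set L" for p using L[of "fst p" "snd p"] that by simp
    then have "has_arities (fob Po A) ?ns (map snd L)" by (simp add: has_arities_map)
    then obtain x b where "\<forall>i<length ?ns. set (x i) \<subseteq> {..<?ns ! i} \<and>
      b i \<in> ops A (length (x i)) \<and> map snd L ! i = A.po (?ns ! i) (x i) (b i)" by (rule A.Po_arities_cases)
    note x = this[rule_format]
    from q obtain f a where f: "set f \<subseteq> {..<length ?ns}" "a \<in> ops A (length f)" "q = A.po (length ?ns) f a"
      by (rule A.Po_ops_cases[of q "length ?ns", simplified]) simp
    have 1: "Po_opm A ?ns (map snd L) q = A.po (sum_list ?ns) (stars ?ns x f)
        (opm A (map (\<lambda>i. length (x i)) f) (map b f) a)"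
      unfolding f(3) by (rule A.Po_opm_eq[OF x f(1,2)])
    have p: "set (stars ?ns x f) \<subseteq> {..<sum_list ?ns}"
      "opm A (map (\<lambda>i. length (x i)) f) (map b f) a \<in> ops A (length (stars ?ns x f))"
      using A.Po_opm_pairs[of ?ns x b f a] x f(1,2) by blast+
    have "b i \<in> ops A (length (x i))" if "i \<in> set f" for i using x f(1) that by auto
    then have 2: "h (length (stars ?ns x f)) (opm A (map (\<lambda>i. length (x i)) f) (map b f) a) =
        opm B (map (\<lambda>i. length (x i)) f) (map (\<lambda>i. h (length (x i)) (b i)) f) (h (length f) a)"
      using operad_morphism_opm[OF h, of f b "\<lambda>i. length (x i)" a] f(2) by (simp add: length_stars)
    have 3: "set (x i) \<subseteq> {..<?ns ! i} \<and> h (length (x i)) (b i) \<in> ops B (length (x i)) \<and>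
        map (\<lambda>(n, b). Po_map A B h n b) L ! i = B.po (?ns ! i) (x i) (h (length (x i)) (b i))"
      if "i < length ?ns" for i
      using x[OF that] eq[of "x i" "?ns ! i" "b i"] hB that by (simp add: case_prod_beta)
    show "Po_map A B h (sum_list ?ns) (Po_opm A ?ns (map snd L) q) =
      Po_opm B ?ns (map (\<lambda>(n, b). Po_map A B h n b) L) (Po_map A B h (length L) q)"
      using eq[OF p] B.Po_opm_eq[OF 3 f(1) hB[OF f(2)]] eq[OF f(1,2)] unfolding 1 2 by (simp add: f(3))
  qed
qed

lemma Po_functor:
  assumes U: "universe U" shows "is_functor (RegOp U) (FOp U) Po"
  unfolding is_functor_def
proof (intro conjI ballI)
  show "is_category (RegOp U)" by (rule Operads_category[OF U ordinal_cat_SS])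
  show "is_category (FOp U)" by (rule Operads_category[OF U ordinal_cat_FF])
next
  fix A assume "A \<in> Ob (RegOp U)"
  then have A: "regular_operad U A" by (intro regular_operadI[OF U]) simp
  interpret regular_operad U A by (rule A)
  show "fob Po A \<in> Ob (FOp U)" using Po_operad by simp
  let ?i = "\<lambda>n. \<lambda>a\<in>ops A n. a"
  have i: "operad_morphism SS A A ?i" by (rule operad_morphism_id[of U]) unfold_locales
  have "Po_map A A ?i n = (\<lambda>q\<in>Po_ops A n. q)" for n
  proof (rule PiE_eqI)
    show "Po_map A A ?i n \<in> Po_ops A n \<rightarrow>\<^sub>E Po_ops A n"
      using operad_morphismD(1)[OF Po_map_morphism[OF A A i], of n] by simp
    show "Po_map A A ?i n q = (\<lambda>q\<in>Po_ops A n. q) q" if "q \<in> Po_ops A n" for q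
      by (rule Po_ops_cases[OF that]) (use that in \<open>simp add: Po_map_eq[OF A A i]\<close>)
  qed (rule PiE_restrict_id)
  then show "far Po A A (Idn (RegOp U) A) = Idn (FOp U) (fob Po A)" by (simp add: fun_eq_iff)
next
  fix A B h assume "A \<in> Ob (RegOp U)" "B \<in> Ob (RegOp U)" "h \<in> Hom (RegOp U) A B"
  then show "far Po A B h \<in> Hom (FOp U) (fob Po A) (fob Po B)"
    using Po_map_morphism[OF regular_operadI[OF U] regular_operadI[OF U]] by simp
next
  fix A B C h g
  assume "A \<in> Ob (RegOp U)" "B \<in> Ob (RegOp U)" "C \<in> Ob (RegOp U)" "h \<in> Hom (RegOp U) A B" "g \<in> Hom (RegOp U) B C"
  then have *: "regular_operad U A" "regular_operad U B" "regular_operad U C"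
    and h: "operad_morphism SS A B h" and g: "operad_morphism SS B C g"
    using regular_operadI[OF U] by simp_all
  interpret regular_operad U A by (rule *(1))
  let ?gh = "\<lambda>n. compose (ops A n) (g n) (h n)"
  have gh: "operad_morphism SS A C ?gh"
    by (rule operad_morphism_comp[OF _ h g, of U]) unfold_locales
  have "Po_map A C ?gh n = compose (Po_ops A n) (Po_map B C g n) (Po_map A B h n)" for n
  proof (rule PiE_eqI)
    show "Po_map A C ?gh n \<in> Po_ops A n \<rightarrow>\<^sub>E Po_ops C n"
      using operad_morphismD(1)[OF Po_map_morphism[OF *(1,3) gh], of n] by simp
    show "compose (Po_ops A n) (Po_map B C g n) (Po_map A B h n) \<in> Po_ops A n \<rightarrow>\<^sub>E Po_ops C n"
      using operad_morphismD(1)[OF Po_map_morphism[OF *(1,2) h], of n]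
        operad_morphismD(1)[OF Po_map_morphism[OF *(2,3) g], of n] by (intro compose_PiE) simp_all
    fix q assume q: "q \<in> Po_ops A n"
    from q obtain x a where x: "set x \<subseteq> {..<n}" "a \<in> ops A (length x)" "q = po n x a" by (rule Po_ops_cases)
    have "h (length x) a \<in> ops B (length x)" using PiE_mem[OF operad_morphismD(1)[OF h] x(2)] .
    then show "Po_map A C ?gh n q = compose (Po_ops A n) (Po_map B C g n) (Po_map A B h n) q"
      using q x Po_map_eq[OF *(1,3) gh x(1,2)] Po_map_eq[OF *(1,2) h x(1,2)] Po_map_eq[OF *(2,3) g x(1)] by simp
  qed
  then show "far Po A C (Cmp (RegOp U) A B C g h) =
    Cmp (FOp U) (fob Po A) (fob Po B) (fob Po C) (far Po B C g) (far Po A B h)"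
    by (simp add: fun_eq_iff)
qed

section \<open>The comparison\<close>

text \<open>The unit of the adjunction between regular and full operads.\<close>

definition Po_unit :: "'u operad \<Rightarrow> nat \<Rightarrow> 'u \<Rightarrow> 'u" where
  "Po_unit A n = (\<lambda>a\<in>ops A n. rc A {..<n} [0..<n] a)"

context regular_operad
begin

text \<open>For the action, both sides are represented by \<phi> itself as index map; for
  composition, identity blocks concatenate to an identity by \<open>stars_upt\<close>.\<close>

lemma Po_unit_morphism: "operad_morphism SS A (fob Po A) (Po_unit A)"
proof (rule operad_morphismI, unfold Po_simps)
  show "Po_unit A n \<in> ops A n \<rightarrow>\<^sub>E Po_ops A n" for n
    by (auto simp: Po_unit_def intro!: po_in)
  show "Po_unit A (Suc 0) (iota A) = Po_cls A 1 [0] (iota A)"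
    unfolding Po_iota by (simp add: Po_unit_def iota_ops)
  show "Po_unit A m (act A m \<phi> a) = Po_act A m \<phi> (Po_unit A n a)"
    if "\<phi> \<in> SS n m" "a \<in> ops A n" for n m \<phi> a
  proof -
    have \<phi>: "length \<phi> = n" "set \<phi> = {..<m}" "\<phi> \<in> FF n m" using that(1) by (simp_all add: SS_iff FF_iff)
    have "po m ([0..<m] \<odot> \<phi>) a = po m [0..<m] (act A m \<phi> a)"
      using po_tcomp[of "[0..<m]" m \<phi> n a] that by (simp add: lessThan_atLeast0)
    moreover have "Po_act A m \<phi> (po n [0..<n] a) = po m (\<phi> \<odot> [0..<n]) a"
      by (rule Po_act_eq[OF \<phi>(3)]) (use that in \<open>simp_all add: lessThan_atLeast0\<close>)
    ultimately show ?thesis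
      using that act_ops[OF that] \<phi> tcomp_id[of \<phi>] by (simp add: Po_unit_def)
  qed
  fix L a assume L: "\<And>n b. (n, b) \<in> set L \<Longrightarrow> b \<in> ops A n" and a: "a \<in> ops A (length L)"
  let ?ns = "map fst L"
  have Ls: "snd (L ! i) \<in> ops A (fst (L ! i))" if "i < length L" for i
    using L[of "fst (L ! i)" "snd (L ! i)"] that by simp
  have 1: "set [0..<?ns ! i] \<subseteq> {..<?ns ! i} \<and> snd (L ! i) \<in> ops A (length [0..<?ns ! i]) \<and>
      map (\<lambda>(n, b). Po_unit A n b) L ! i = po (?ns ! i) [0..<?ns ! i] (snd (L ! i))"
    if "i < length ?ns" for i
    using that Ls[of i] by (auto simp: Po_unit_def case_prod_beta)
  have "Po_opm A ?ns (map (\<lambda>(n, b). Po_unit A n b) L) (po (length ?ns) [0..<length ?ns] a) =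
    po (sum_list ?ns) (stars ?ns (\<lambda>i. [0..<?ns ! i]) [0..<length ?ns])
      (opm A (map (\<lambda>i. length [0..<?ns ! i]) [0..<length ?ns]) (map (\<lambda>i. snd (L ! i)) [0..<length ?ns]) a)"
    by (rule Po_opm_eq[OF 1]) (use a in \<open>simp_all add: lessThan_atLeast0\<close>)
  also have "stars ?ns (\<lambda>i. [0..<?ns ! i]) [0..<length ?ns] = [0..<sum_list ?ns]" by (rule stars_upt)
  also have "map (\<lambda>i. length [0..<?ns ! i]) [0..<length ?ns] = ?ns" by (rule nth_equalityI) simp_all
  also have "map (\<lambda>i. snd (L ! i)) [0..<length ?ns] = map snd L" by (rule nth_equalityI) simp_all
  finally show "Po_unit A (sum_list ?ns) (opm A ?ns (map snd L) a) =
    Po_opm A ?ns (map (\<lambda>(n, b). Po_unit A n b) L) (Po_unit A (length L) a)"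
    using a opm_ops_list[of L snd fst a] L by (force simp: Po_unit_def)
qed

end

text \<open>The description ranges over all tuples through \<open>rc\<close>, so that the map falls
  under \<open>tuple_monad_hom\<close> with \<open>SS\<close> at the source and \<open>FF\<close> at
  the target.\<close>

definition comparison :: "'u set set \<Rightarrow> 'u operad \<Rightarrow> 'u set \<Rightarrow> 'u \<Rightarrow> 'u" where
  "comparison U A = (\<lambda>X\<in>U. \<lambda>q\<in>Mr_ob A X. THE r. \<exists>x a. (x, a) \<in> pairs A (lists X) \<and> q = rc A X x a \<and>
     r = Mf_cls (fob Po A) X x (Po_unit A (length x) a))"

lemma comparison_hom:
  assumes U: "universe U" and A: "is_operad U SS A"
  shows "tuple_monad_hom U SS A (Mr_ob A) (rc A) FF (fob Po A) (Mf_ob (fob Po A)) (Mf_cls (fob Po A))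
    (Po_unit A) (fob (Mr U) A) (fob (Mf U) (fob Po A)) (comparison U A)"
proof -
  interpret S: regular_monad U A "Mr_ob A" "fob (Mr U) A" by (rule Mr_monad[OF U A])
  interpret T: tuple_monad U FF "fob Po A" "Mf_ob (fob Po A)" "Mf_cls (fob Po A)" "fob (Mf U) (fob Po A)"
    by (rule Mf_monad[OF U S.Po_operad])
  interpret tuple_quotient_hom U SS A "Mr_ob A" "rc A" FF "fob Po A" "Mf_ob (fob Po A)" "Mf_cls (fob Po A)" "Po_unit A"
    using S.Po_unit_morphism by unfold_locales (auto simp: SS_iff FF_iff)
  show ?thesis
  proof unfold_locales
    fix X x a assume X: "X \<in> U" and xa: "(x, a) \<in> pairs A (lists X)"
    have "(THE r. \<exists>y b. (y, b) \<in> pairs A (lists X) \<and> rc A X x a = rc A X y b \<and>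
        r = Mf_cls (fob Po A) X y (Po_unit A (length y) b)) = Mf_cls (fob Po A) X x (Po_unit A (length x) a)"
      by (rule the_equality) (use xa in blast, use hom_wd[OF X xa] in metis)
    then show "comparison U A X (rc A X x a) = Mf_cls (fob Po A) X x (Po_unit A (length x) a)"
      using X S.cl_in_ob[OF X xa] by (simp add: comparison_def)
  qed (simp add: comparison_def)
qed

lemma comparison_bij:
  assumes U: "universe U" and A: "is_operad U SS A" and X: "X \<in> U"
  shows "bij_betw (comparison U A X) (Mr_ob A X) (Mf_ob (fob Po A) X)"
proof -
  interpret regular_operad U A by (rule regular_operadI[OF U A])
  interpret tuple_monad_hom U SS A "Mr_ob A" "rc A" FF "fob Po A" "Mf_ob (fob Po A)" "Mf_cls (fob Po A)"
    "Po_unit A" "fob (Mr U) A" "fob (Mf U) (fob Po A)" "comparison U A" by (rule comparison_hom[OF U A])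
  \<comment> \<open>The inverse as a function of the pair \<open>(x, q)\<close>: the description
    removes the choice of \<open>(f, a)\<close> inside \<open>q\<close>, and invariance under gluing
    along functions is shown afterwards.\<close>
  define G where "G x q = (THE r. \<exists>f a. set f \<subseteq> {..<length x} \<and> a \<in> ops A (length f) \<and>
    q = po (length x) f a \<and> r = rc A X (x \<odot> f) a)" for x q
  have G: "G x (po (length x) f a) = rc A X (x \<odot> f) a"
    if x: "set x \<subseteq> X" and f: "set f \<subseteq> {..<length x}" "a \<in> ops A (length f)" for x f a
    unfolding G_def
  proof (rule the_equality)
    show "\<exists>g b. set g \<subseteq> {..<length x} \<and> b \<in> ops A (length g) \<and>
      po (length x) f a = po (length x) g b \<and> rc A X (x \<odot> f) a = rc A X (x \<odot> g) b" using f by blast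
    fix r assume "\<exists>g b. set g \<subseteq> {..<length x} \<and> b \<in> ops A (length g) \<and>
      po (length x) f a = po (length x) g b \<and> r = rc A X (x \<odot> g) b"
    then obtain g b where g: "set g \<subseteq> {..<length x}" "b \<in> ops A (length g)"
      "po (length x) f a = po (length x) g b" "r = rc A X (x \<odot> g) b" by blast
    have "req A g b f a" using po_eq_iff[OF g(1,2) f] g(3) by simp
    then show "r = rc A X (x \<odot> f) a"
      unfolding g(4)
    proof (rule req_lift[OF _ g(2) f(2)])
      fix z \<alpha> n c assume z: "set z = set g" "\<alpha> \<in> SS n (length z)" "c \<in> ops A n"
      have "x \<odot> (z \<odot> \<alpha>) = (x \<odot> z) \<odot> \<alpha>" using z(2) by (intro tcomp_assoc) (simp add: SS_iff)
      moreover have "set (x \<odot> z) \<subseteq> X" using set_tcomp_subset[of z x] z(1) g(1) x by auto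
      ultimately show "rc A X (x \<odot> (z \<odot> \<alpha>)) c = rc A X (x \<odot> z) (act A (length z) \<alpha> c)"
        using rc_tcomp[OF small_member[OF X], of "x \<odot> z" \<alpha> n c] z(2,3) by simp
    qed
  qed
  have "G x q = G y r"
    if "(x, q) \<in> pairs (fob Po A) (lists X)" "(y, r) \<in> pairs (fob Po A) (lists X)"
      "Mf_cls (fob Po A) X x q = Mf_cls (fob Po A) X y r" for x q y r
  proof (rule T.cl_lift[OF X that])
    fix x \<phi> q n assume x: "set x \<subseteq> X" "\<phi> \<in> FF n (length x)" and "q \<in> ops (fob Po A) n"
    then have "q \<in> Po_ops A n" by simp
    then obtain f a where f: "set f \<subseteq> {..<n}" "a \<in> ops A (length f)" "q = po n f a" by (rule Po_ops_cases)
    have \<phi>: "length \<phi> = n" "set \<phi> \<subseteq> {..<length x}" using x(2) by (simp_all add: FF_iff)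
    have "set (x \<odot> \<phi>) \<subseteq> X" using set_tcomp_subset[OF \<phi>(2)] x(1) by blast
    from G[OF this, of f a] have "G (x \<odot> \<phi>) q = rc A X ((x \<odot> \<phi>) \<odot> f) a" using f \<phi>(1) by simp
    \<comment> \<open>Invariance is associativity of composition: \<phi> moves from the tuple into
      the operation, where it acts by composition as well.\<close>
    also have "(x \<odot> \<phi>) \<odot> f = x \<odot> (\<phi> \<odot> f)" using f(1) \<phi>(1) by (intro tcomp_assoc[symmetric]) simp
    also have "rc A X (x \<odot> (\<phi> \<odot> f)) a = G x (po (length x) (\<phi> \<odot> f) a)"
      using set_tcomp_subset[of f \<phi>] f(1,2) \<phi> by (intro G[OF x(1), symmetric]) auto
    also have "po (length x) (\<phi> \<odot> f) a = act (fob Po A) (length x) \<phi> q"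
      using Po_act_eq[OF x(2) f(1,2)] f(3) by simp
    finally show "G (x \<odot> \<phi>) q = G x (act (fob Po A) (length x) \<phi> q)" .
  qed
  note G_wd = this
  have G_unit: "G x (Po_unit A (length x) a) = rc A X x a" if "(x, a) \<in> pairs A (lists X)" for x a
  proof -
    have "set x \<subseteq> X" "a \<in> ops A (length x)" using that by (simp_all add: pairs_lists_iff)
    then show ?thesis using G[of x "[0..<length x]" a] by (simp add: Po_unit_def lessThan_atLeast0)
  qed
  show ?thesis
  proof (rule bij_betw_imageI)
    show "inj_on (comparison U A X) (Mr_ob A X)"
    proof (rule inj_onI)
      fix q r assume "q \<in> Mr_ob A X" "r \<in> Mr_ob A X" and eq: "comparison U A X q = comparison U A X r"
      from this(1) X obtain x a where xa: "(x, a) \<in> pairs A (lists X)" "q = rc A X x a" by (rule S.ob_cases)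
      from \<open>r \<in> Mr_ob A X\<close> X obtain y b where yb: "(y, b) \<in> pairs A (lists X)" "r = rc A X y b" by (rule S.ob_cases)
      have "Mf_cls (fob Po A) X x (Po_unit A (length x) a) = Mf_cls (fob Po A) X y (Po_unit A (length y) b)"
        using eq \<sigma>_cl[OF X xa(1)] \<sigma>_cl[OF X yb(1)] xa(2) yb(2) by simp
      \<comment> \<open>\<open>G\<close> undoes the comparison on representatives and is constant on
        classes, which is enough for injectivity.\<close>
      from G_wd[OF hom_pairs[OF xa(1)] hom_pairs[OF yb(1)] this] show "q = r"
        using G_unit xa yb by simp
    qed
    show "comparison U A X ` Mr_ob A X = Mf_ob (fob Po A) X"
    proof
      show "comparison U A X ` Mr_ob A X \<subseteq> Mf_ob (fob Po A) X" using \<sigma>_in[OF X] by (auto dest: PiE_mem)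
      show "Mf_ob (fob Po A) X \<subseteq> comparison U A X ` Mr_ob A X"
      proof
        fix r assume "r \<in> Mf_ob (fob Po A) X"
        from this X obtain x q where xq: "(x, q) \<in> pairs (fob Po A) (lists X)" "r = Mf_cls (fob Po A) X x q"
          by (rule T.ob_cases)
        then have x: "set x \<subseteq> X" and "q \<in> Po_ops A (length x)" by (simp_all add: pairs_lists_iff)
        from this(2) obtain f a where f: "set f \<subseteq> {..<length x}" "a \<in> ops A (length f)" "q = po (length x) f a"
          by (rule Po_ops_cases)
        let ?k = "length f"
        have fF: "f \<in> FF ?k (length x)" using f(1) by (simp add: FF_iff)
        have u: "Po_unit A ?k a = po ?k [0..<?k] a" using f(2) by (simp add: Po_unit_def)
        have "Po_act A (length x) f (Po_unit A ?k a) = q"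
          using Po_act_eq[OF fF, of "[0..<?k]" a] f(2,3) u by (simp add: lessThan_atLeast0)
        moreover have "Po_unit A ?k a \<in> ops (fob Po A) ?k" by (rule hom_ops[OF f(2)])
        ultimately have "Mf_cls (fob Po A) X (x \<odot> f) (Po_unit A ?k a) = r"
          using T.cl_tcomp[OF X x fF] xq(2) by simp
        moreover have xf: "(x \<odot> f, a) \<in> pairs A (lists X)"
          using set_tcomp_subset[OF f(1)] x f(2) by (auto simp: pairs_lists_iff)
        ultimately have "comparison U A X (rc A X (x \<odot> f) a) = r" using \<sigma>_cl[OF X xf] by simp
        then show "r \<in> comparison U A X ` Mr_ob A X" using S.cl_in_ob[OF X xf] by blast
      qed
    qed
  qed
qed

lemma comparison_nat_iso:
  assumes U: "universe U"
  shows "nat_iso (RegOp U) (Mnd U) (functor_comp Pm (Mr U)) (functor_comp (Mf U) Po) (comparison U)"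
  unfolding nat_iso_def nat_trans_def
proof (intro conjI ballI)
  show "is_functor (RegOp U) (Mnd U) (functor_comp Pm (Mr U))"
    by (rule is_functor_comp[OF Mr_functor[OF U] Pm_functor[OF U]])
  show "is_functor (RegOp U) (Mnd U) (functor_comp (Mf U) Po)"
    by (rule is_functor_comp[OF Po_functor[OF U] Mf_functor[OF U]])
next
  have Pm: "fob Pm T = T" "far Pm T T' \<tau> = \<tau>" for T T' :: "'a mnd" and \<tau> by (simp_all add: Pm_def)
  {
    fix A assume "A \<in> Ob (RegOp U)"
    then have A: "is_operad U SS A" by simp
    interpret regular_operad U A by (rule regular_operadI[OF U A])
    interpret tuple_monad_hom U SS A "Mr_ob A" "rc A" FF "fob Po A" "Mf_ob (fob Po A)" "Mf_cls (fob Po A)"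
      "Po_unit A" "fob (Mr U) A" "fob (Mf U) (fob Po A)" "comparison U A" by (rule comparison_hom[OF U A])
    show hom: "comparison U A \<in> Hom (Mnd U) (fob (functor_comp Pm (Mr U)) A) (fob (functor_comp (Mf U) Po) A)"
      using monad_morphism_\<sigma> by (simp add: Pm comparison_def)
    have "is_iso (Mnd U) (fob (Mr U) A) (fob (Mf U) (fob Po A)) (comparison U A)"
    proof (rule Mnd_isoI)
      show "fob (Mr U) A \<in> Ob (Mnd U)" "fob (Mf U) (fob Po A) \<in> Ob (Mnd U)"
        using S.is_monad_T S.finitary_T T.is_monad_T T.finitary_T by simp_all
      show "comparison U A \<in> Hom (Mnd U) (fob (Mr U) A) (fob (Mf U) (fob Po A))"
        using hom by (simp add: Pm)
      show "bij_betw (comparison U A X) (fob (fn (fob (Mr U) A)) X) (fob (fn (fob (Mf U) (fob Po A))) X)"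
        if "X \<in> U" for X using comparison_bij[OF U A that] by simp
    qed
    then show "is_iso (Mnd U) (fob (functor_comp Pm (Mr U)) A) (fob (functor_comp (Mf U) Po) A) (comparison U A)"
      by (simp add: Pm)
  }
  fix A B h assume "A \<in> Ob (RegOp U)" "B \<in> Ob (RegOp U)" "h \<in> Hom (RegOp U) A B"
  then have A: "is_operad U SS A" and B: "is_operad U SS B" and h: "operad_morphism SS A B h" by simp_all
  have rA: "regular_operad U A" and rB: "regular_operad U B" using regular_operadI[OF U] A B by blast+
  interpret A: regular_operad U A by (rule rA)
  interpret B: regular_operad U B by (rule rB)
  interpret a: tuple_monad_hom U SS A "Mr_ob A" "rc A" FF "fob Po A" "Mf_ob (fob Po A)" "Mf_cls (fob Po A)"
    "Po_unit A" "fob (Mr U) A" "fob (Mf U) (fob Po A)" "comparison U A" by (rule comparison_hom[OF U A])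
  interpret b: tuple_monad_hom U SS B "Mr_ob B" "rc B" FF "fob Po B" "Mf_ob (fob Po B)" "Mf_cls (fob Po B)"
    "Po_unit B" "fob (Mr U) B" "fob (Mf U) (fob Po B)" "comparison U B" by (rule comparison_hom[OF U B])
  interpret r: tuple_monad_hom U SS A "Mr_ob A" "rc A" SS B "Mr_ob B" "rc B" h
    "fob (Mr U) A" "fob (Mr U) B" "Mr_map U A B h" by (rule Mr_hom[OF U A B h])
  interpret f: tuple_monad_hom U FF "fob Po A" "Mf_ob (fob Po A)" "Mf_cls (fob Po A)"
    FF "fob Po B" "Mf_ob (fob Po B)" "Mf_cls (fob Po B)" "Po_map A B h"
    "fob (Mf U) (fob Po A)" "fob (Mf U) (fob Po B)" "Mf_map U (fob Po A) (fob Po B) (Po_map A B h)"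
    by (rule Mf_hom[OF U A.Po_operad B.Po_operad Po_map_morphism[OF rA rB h]])
  have "mcomp U (fob (Mr U) A) (comparison U B) (Mr_map U A B h) =
    mcomp U (fob (Mr U) A) (Mf_map U (fob Po A) (fob Po B) (Po_map A B h)) (comparison U A)"
  proof (rule transf_eqI[OF mcomp_ext mcomp_ext])
    fix X assume X: "X \<in> U"
    show "mcomp U (fob (Mr U) A) (comparison U B) (Mr_map U A B h) X \<in> Mr_ob A X \<rightarrow>\<^sub>E Mf_ob (fob Po B) X"
      using compose_PiE[OF r.\<sigma>_in[OF X] b.\<sigma>_in[OF X]] X by (simp add: mcomp_def)
    show "mcomp U (fob (Mr U) A) (Mf_map U (fob Po A) (fob Po B) (Po_map A B h)) (comparison U A) X
        \<in> Mr_ob A X \<rightarrow>\<^sub>E Mf_ob (fob Po B) X"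
      using compose_PiE[OF a.\<sigma>_in[OF X] f.\<sigma>_in[OF X]] X by (simp add: mcomp_def)
    fix q assume q: "q \<in> Mr_ob A X"
    from q X obtain x c where xc: "(x, c) \<in> pairs A (lists X)" "q = rc A X x c" by (rule a.S.ob_cases)
    have c: "c \<in> ops A (length x)" using xc(1) by (simp add: pairs_lists_iff)
    \<comment> \<open>Naturality of the unit of the adjunction in the operad, from which naturality
      of the comparison follows on representatives.\<close>
    have "Po_map A B h (length x) (Po_unit A (length x) c) = Po_unit B (length x) (h (length x) c)"
      using Po_map_eq[OF rA rB h, of "[0..<length x]" "length x" c] c r.hom_ops[OF c]
      by (simp add: Po_unit_def lessThan_atLeast0)
    then have "comparison U B X (Mr_map U A B h X q) =
        Mf_map U (fob Po A) (fob Po B) (Po_map A B h) X (comparison U A X q)"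
      using r.\<sigma>_cl[OF X xc(1)] b.\<sigma>_cl[OF X r.hom_pairs[OF xc(1)]] a.\<sigma>_cl[OF X xc(1)]
        f.\<sigma>_cl[OF X a.hom_pairs[OF xc(1)]] by (simp add: xc(2))
    then show "mcomp U (fob (Mr U) A) (comparison U B) (Mr_map U A B h) X q =
      mcomp U (fob (Mr U) A) (Mf_map U (fob Po A) (fob Po B) (Po_map A B h)) (comparison U A) X q"
      using X q by simp
  qed
  then show "Cmp (Mnd U) (fob (functor_comp Pm (Mr U)) A) (fob (functor_comp Pm (Mr U)) B)
      (fob (functor_comp (Mf U) Po) B) (comparison U B) (far (functor_comp Pm (Mr U)) A B h) =
    Cmp (Mnd U) (fob (functor_comp Pm (Mr U)) A) (fob (functor_comp (Mf U) Po) A)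
      (fob (functor_comp (Mf U) Po) B) (far (functor_comp (Mf U) Po) A B h) (comparison U A)"
    by (simp add: Pm)
qed

theorem proposition5p1:
  fixes U :: "'u set set"
  assumes "universe U"
  shows "is_functor (RegOp U) (FOp U) Po \<and>
         is_functor (FOp U) (Mnd U) (Mf U) \<and>
         is_functor (RegOp U) (SanMnd U) (Mr U) \<and>
         is_functor (SanMnd U) (Mnd U) Pm \<and>
         (\<exists>\<tau>. nat_iso (RegOp U) (Mnd U) (functor_comp (Mf U) Po) (functor_comp Pm (Mr U)) \<tau>)"
  using Po_functor[OF assms] Mf_functor[OF assms] Mr_functor[OF assms] Pm_functor[OF assms]
    nat_iso_inverse[OF Operads_category[OF assms ordinal_cat_SS] Mnd_category comparison_nat_iso[OF assms]]
  by blast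

end
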